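(* Let $3\alpha+2\beta=\pi$ and assume triangle $ABC$ has angles $(2\alpha,\beta,\alpha+\beta)$ and is $N$-tiled by a tile with angles $(\alpha,\beta,\gamma)$. Then (i) $N$ satisfies the equation $M^2+N=2K^2$ for some positive integers $M$ and $K$ with $M^2<N$, where $2\sin(\alpha/2)=M/K$; and (ii) $N$ is a square times a product of distinct primes each of which is either $2$ or of the form $8n\pm1$.
   Context: An $N$-tiling of a triangle $ABC$ by a triangle $T$ (the tile) is a way of writing $ABC$ as a union of $N$ triangles congruent to $T$ (reflections allowed) overlapping only at their boundaries; tiles need not meet edge-to-edge. The product of primes in (ii) may be empty. *)

theory Defs
  imports "HOL-Analysis.Analysis" "HOL-Computational_Algebra.Primes"
begin

type_synonym point = "real^2"

text \<open>The angle at the vertex \<open>Y\<close> between the rays \<open>YX\<close> and \<open>YZ\<close>; meaningful for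
  \<open>X \<noteq> Y\<close> and \<open>Z \<noteq> Y\<close>.\<close>

definition vertex_angle :: "point \<Rightarrow> point \<Rightarrow> point \<Rightarrow> real" where
  "vertex_angle X Y Z = arccos (((X - Y) \<bullet> (Z - Y)) / (norm (X - Y) * norm (Z - Y)))"

definition triangle_with_angles ::
  "point \<Rightarrow> point \<Rightarrow> point \<Rightarrow> real \<Rightarrow> real \<Rightarrow> real \<Rightarrow> bool" where
  "triangle_with_angles A B C a b c \<longleftrightarrow>
     \<not> collinear {A, B, C} \<and>
     vertex_angle B A C = a \<and> vertex_angle A B C = b \<and> vertex_angle A C B = c"

text \<open>A triangle as a closed solid region.\<close>

definition triangle_region :: "point \<Rightarrow> point \<Rightarrow> point \<Rightarrow> point set" where
  "triangle_region A B C = convex hull {A, B, C}"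

text \<open>Distance-preserving maps of the plane include the orientation-reversing ones, so reflected
  copies count as congruent.\<close>

definition congruent_regions :: "point set \<Rightarrow> point set \<Rightarrow> bool" where
  "congruent_regions S T \<longleftrightarrow> (\<exists>f :: point \<Rightarrow> point. (\<forall>x y. dist (f x) (f y) = dist x y) \<and> T = f ` S)"

text \<open>Because triangular regions have nonempty interior, two tiles that overlap only at their
  boundaries are different sets; a set of tiles therefore loses no multiplicities.\<close>

definition tiling :: "nat \<Rightarrow> point set \<Rightarrow> point set \<Rightarrow> point set set \<Rightarrow> bool" where
  "tiling N R T \<T> \<longleftrightarrow>
     finite \<T> \<and> card \<T> = N \<and> \<Union>\<T> = R \<and>
     (\<forall>S\<in>\<T>. congruent_regions T S) \<and>
     (\<forall>S\<in>\<T>. \<forall>S'\<in>\<T>. S \<noteq> S' \<longrightarrow> S \<inter> S' \<subseteq> frontier S \<inter> frontier S')"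

definition N_tiled :: "nat \<Rightarrow> point set \<Rightarrow> point set \<Rightarrow> bool" where
  "N_tiled N R T \<longleftrightarrow> (\<exists>\<T>. tiling N R T \<T>)"

end

theory Submission
  imports Defs "HOL-Computational_Algebra.Polynomial_Factorial"
    "HOL-Computational_Algebra.Fundamental_Theorem_Algebra"
begin

text \<open>
  Put \<open>s = 2 sin (\<alpha>/2)\<close>. The tile has sides proportional to \<open>s\<close>, \<open>1 - s\<^sup>2\<close>, \<open>1\<close>, opposite \<open>\<alpha>\<close>, \<open>\<beta>\<close>,
  \<open>\<gamma> = 2\<alpha> + \<beta>\<close>. If \<open>X\<close> is the length of \<open>AB\<close> in units of the longest tile side, then comparing areas
  gives \<open>N = X\<^sup>2 (2 - s\<^sup>2)\<close>, and \<open>X\<close> is a nonnegative integer combination of \<open>1\<close>, \<open>1 - s\<^sup>2\<close>, \<open>s\<close> because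
  \<open>AB\<close> is composed of tile sides. If \<open>s\<close> is rational, a look at denominators shows that \<open>K = X\<close> and
  \<open>M = X s\<close> are integers, and (ii) follows because \<open>2\<close> is a square modulo each odd prime of odd
  multiplicity in \<open>N = 2 K\<^sup>2 - M\<^sup>2\<close>.

  The angle \<open>\<alpha>\<close> is not a rational multiple of \<open>\<pi>\<close>: otherwise \<open>s\<close> is an algebraic integer whose
  conjugates \<open>x\<close> are real and satisfy \<open>x\<^sup>2 < 2\<close> by the area equation, so the product of all
  \<open>x\<^sup>2 (2 - x\<^sup>2)\<close> is a nonzero integer of absolute value less than \<open>1\<close>. Hence the angles around a
  vertex determine how often \<open>\<alpha>\<close>, \<open>\<beta>\<close>, \<open>\<gamma>\<close> occur there. As there are no \<open>\<gamma>\<close> at the corners of \<open>ABC\<close>,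
  there are more vertices of type \<open>\<beta>\<gamma>\<gamma>\<gamma>\<close> than interior vertices of type \<open>\<alpha>\<alpha>\<alpha>\<beta>\<beta>\<close>.

  Let \<open>\<tau>\<close> be the tile side opposite \<open>\<beta>\<close> or \<open>\<gamma>\<close>, and suppose that no multiple of \<open>\<tau>\<close> is a
  combination of tile sides in a nontrivial way. Call a side of length \<open>\<tau>\<close> mismatched at an endpoint
  \<open>P\<close> if the tile side starting at \<open>P\<close> across the line is of another type. The run of \<open>\<tau>\<close>-sides that
  starts there can only end at a point lying inside a tile side across the line; this maps mismatched
  sides injectively to vertices with angle sum \<open>\<pi>\<close>. A parity count gives a mismatched side at every
  vertex of type \<open>\<beta>\<gamma>\<gamma>\<gamma>\<close> and at every image vertex of type \<open>\<alpha>\<beta>\<gamma>\<close>, so there are at least as many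
  vertices of type \<open>\<alpha>\<alpha>\<alpha>\<beta>\<beta>\<close> as of type \<open>\<beta>\<gamma>\<gamma>\<gamma>\<close>, a contradiction. The resulting relations for both
  choices of \<open>\<tau>\<close> make \<open>s\<^sup>2\<close> rational. Were \<open>s\<close> irrational, then \<open>AB\<close> or \<open>BC\<close> would consist of sides
  opposite \<open>\<alpha>\<close> only, which is impossible as each of these has a \<open>\<gamma>\<close> at one end.
\<close>

section \<open>Barycentric coordinates in the plane\<close>

definition cross2 :: "point \<Rightarrow> point \<Rightarrow> real" where
  "cross2 x y = x $ 1 * y $ 2 - x $ 2 * y $ 1"

lemma cross2_simps [simp]:
  "cross2 x x = 0" "cross2 0 x = 0" "cross2 x 0 = 0"
  "cross2 (r *\<^sub>R x) y = r * cross2 x y" "cross2 x (r *\<^sub>R y) = r * cross2 x y"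
  "cross2 (- x) y = - cross2 x y" "cross2 x (- y) = - cross2 x y"
  by (auto simp: cross2_def algebra_simps)

lemma cross2_add: "cross2 (x + y) z = cross2 x z + cross2 y z" "cross2 x (y + z) = cross2 x y + cross2 x z"
  by (auto simp: cross2_def algebra_simps)

lemma cross2_diff: "cross2 (x - y) z = cross2 x z - cross2 y z" "cross2 x (y - z) = cross2 x y - cross2 x z"
  by (auto simp: cross2_def algebra_simps)

lemma cross2_commute: "cross2 x y = - cross2 y x"
  by (simp add: cross2_def)

lemma point_eq_iff: "x = (y :: point) \<longleftrightarrow> x $ 1 = y $ 1 \<and> x $ 2 = y $ 2"
  by (auto simp: vec_eq_iff forall_2)

lemma inner_point: "(x :: point) \<bullet> y = x $ 1 * y $ 1 + x $ 2 * y $ 2"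
  by (simp add: inner_vec_def sum_2)

lemma cross2_sq: "(cross2 x y)\<^sup>2 = (norm x)\<^sup>2 * (norm y)\<^sup>2 - (x \<bullet> y)\<^sup>2"
  unfolding power2_norm_eq_inner inner_point cross2_def by algebra

lemma cross2_parallel:
  assumes "cross2 x y = 0" "norm y = 1"
  shows "x = (x \<bullet> y) *\<^sub>R y"
proof -
  have "y $ 1 * y $ 1 + y $ 2 * y $ 2 = 1"
    using assms(2) by (metis inner_point norm_eq_1)
  moreover have "x $ 1 * y $ 2 = x $ 2 * y $ 1"
    using assms(1) by (simp add: cross2_def)
  ultimately show ?thesis
    by (simp add: point_eq_iff inner_point) algebra
qed

definition perp :: "point \<Rightarrow> point" where
  "perp u = vector [- (u $ 2), u $ 1]"

lemma cross2_perp: "cross2 u (perp u) = (norm u)\<^sup>2"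
  by (simp add: cross2_def perp_def power2_norm_eq_inner inner_point)

lemma less_3_cases: "(k::nat) < 3 \<Longrightarrow> k = 0 \<or> k = 1 \<or> k = 2"
  by auto

lemma third_less:
  fixes i j :: nat
  assumes "i < 3" "j < 3" "i \<noteq> j"
  shows "3 - i - j < 3" "3 - i - j \<noteq> i" "3 - i - j \<noteq> j"
  using assms by (auto dest!: less_3_cases)

lemma third_cases:
  fixes i j k :: nat
  assumes "i < 3" "j < 3" "i \<noteq> j" "k < 3"
  shows "k = i \<or> k = j \<or> k = 3 - i - j"
  using assms by (auto dest!: less_3_cases)

definition nondeg :: "(nat \<Rightarrow> point) \<Rightarrow> bool" where
  "nondeg v \<longleftrightarrow> cross2 (v 1 - v 0) (v 2 - v 0) \<noteq> 0"

text \<open>The linear part of the \<open>k\<close>-th barycentric coordinate, written as a quotient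
  of determinants along the side opposite to vertex \<open>k\<close>. The normalisation makes its
  sign independent of the orientation of \<open>v\<close>, so no triangle has to be assumed
  counterclockwise.\<close>

definition bary_lin :: "(nat \<Rightarrow> point) \<Rightarrow> nat \<Rightarrow> point \<Rightarrow> real" where
  "bary_lin v k d = cross2 (v ((k + 2) mod 3) - v ((k + 1) mod 3)) d
     / cross2 (v ((k + 2) mod 3) - v ((k + 1) mod 3)) (v k - v ((k + 1) mod 3))"

definition bary :: "(nat \<Rightarrow> point) \<Rightarrow> nat \<Rightarrow> point \<Rightarrow> real" where
  "bary v k x = bary_lin v k (x - v ((k + 1) mod 3))"

lemma less_3_iff: "(\<forall>k<3. P (k::nat)) \<longleftrightarrow> P 0 \<and> P 1 \<and> P 2"
  by (auto dest: less_3_cases)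

lemma nondeg_cross2:
  assumes "nondeg v" "i < 3" "j < 3" "i \<noteq> j" "k = 3 - i - j"
  shows "cross2 (v j - v i) (v k - v i) \<noteq> 0"
proof -
  define D where "D x y z = cross2 (y - x) (z - x)" for x y z
  have cyc: "D y z x = D x y z" and swap: "D y x z = - D x y z" for x y z
    by (simp_all add: D_def cross2_def algebra_simps)
  have nz: "D (v 0) (v 1) (v 2) \<noteq> 0"
    using assms(1) by (simp add: nondeg_def D_def)
  have "i = 0 \<and> j = 1 \<and> k = 2 \<or> i = 1 \<and> j = 2 \<and> k = 0 \<or> i = 2 \<and> j = 0 \<and> k = 1 \<or>
      i = 1 \<and> j = 0 \<and> k = 2 \<or> i = 2 \<and> j = 1 \<and> k = 0 \<or> i = 0 \<and> j = 2 \<and> k = 1"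
    using less_3_cases[OF assms(2)] less_3_cases[OF assms(3)] assms(4,5)
    by (elim disjE) simp_all
  moreover have "D (v 1) (v 2) (v 0) \<noteq> 0" "D (v 2) (v 0) (v 1) \<noteq> 0" "D (v 1) (v 0) (v 2) \<noteq> 0"
      "D (v 2) (v 1) (v 0) \<noteq> 0" "D (v 0) (v 2) (v 1) \<noteq> 0"
    using nz cyc swap by (metis neg_equal_0_iff_equal)+
  ultimately have "D (v i) (v j) (v k) \<noteq> 0"
    using nz by metis
  then show ?thesis
    by (simp add: D_def)
qed

text \<open>Reversing the side opposite to \<open>k\<close> changes the sign of numerator and
  denominator alike. Later proofs can therefore name its endpoints \<open>i\<close> and
  \<open>j\<close> in either order.\<close>

lemma bary_lin_eq:
  assumes "i < 3" "j < 3" "i \<noteq> j" "k = 3 - i - j"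
  shows "bary_lin v k d = cross2 (v j - v i) d / cross2 (v j - v i) (v k - v i)"
proof -
  have *: "cross2 (v b - v a) d / cross2 (v b - v a) (v k - v a)
       = cross2 (v a - v b) d / cross2 (v a - v b) (v k - v b)" for a b
  proof -
    have "cross2 (v a - v b) d = - cross2 (v b - v a) d"
      by (simp add: cross2_diff)
    moreover have "cross2 (v a - v b) (v k - v b) = - cross2 (v b - v a) (v k - v a)"
      by (simp add: cross2_def algebra_simps)
    ultimately show ?thesis by simp
  qed
  have "(k + 1) mod 3 = i \<and> (k + 2) mod 3 = j \<or> (k + 1) mod 3 = j \<and> (k + 2) mod 3 = i"
    using assms less_3_cases[OF assms(1)] less_3_cases[OF assms(2)] by auto
  then show ?thesis
    unfolding bary_lin_def using *[of i j] by metis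
qed

lemma bary_lin_add: "bary_lin v k (x + y) = bary_lin v k x + bary_lin v k y"
  by (simp add: bary_lin_def cross2_add add_divide_distrib)

lemma bary_lin_diff: "bary_lin v k (x - y) = bary_lin v k x - bary_lin v k y"
  by (simp add: bary_lin_def cross2_diff diff_divide_distrib)

lemma bary_lin_scale [simp]: "bary_lin v k (r *\<^sub>R x) = r * bary_lin v k x"
  by (simp add: bary_lin_def)

lemma bary_lin_minus [simp]: "bary_lin v k (- x) = - bary_lin v k x"
  by (simp add: bary_lin_def)

lemma bary_lin_zero [simp]: "bary_lin v k 0 = 0"
  by (simp add: bary_lin_def)

lemma bary_add: "bary v k (x + d) = bary v k x + bary_lin v k d"
  by (simp add: bary_def bary_lin_diff bary_lin_add)

lemma bary_diff: "bary v k x - bary v k y = bary_lin v k (x - y)"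
  by (simp add: bary_def bary_lin_diff)

lemma bary_vertex:
  assumes "nondeg v" "j < 3" "k < 3"
  shows "bary v k (v j) = (if j = k then 1 else 0)"
proof -
  have "cross2 (v 2 - v 1) (v 0 - v 1) \<noteq> 0" "cross2 (v 0 - v 2) (v 1 - v 2) \<noteq> 0"
       "cross2 (v 1 - v 0) (v 2 - v 0) \<noteq> 0"
    by (simp_all add: nondeg_cross2[OF assms(1)])
  then show ?thesis
    using less_3_cases[OF assms(2)] less_3_cases[OF assms(3)]
    by (elim disjE) (simp_all add: bary_def bary_lin_def flip: numeral_2_eq_2)
qed

lemma bary_lin_edge:
  assumes "nondeg v" "i < 3" "j < 3" "k < 3"
  shows "bary_lin v k (v j - v i) = (if j = k then 1 else 0) - (if i = k then 1 else 0)"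
  using bary_diff[of v k "v j" "v i"] bary_vertex[OF assms(1)] assms by simp

lemma cross2_expand:
  assumes "cross2 p q \<noteq> 0"
  shows "d = (cross2 d q / cross2 p q) *\<^sub>R p + (cross2 p d / cross2 p q) *\<^sub>R q"
proof -
  have "cross2 p q *\<^sub>R d = cross2 d q *\<^sub>R p + cross2 p d *\<^sub>R q"
    by (simp add: point_eq_iff cross2_def algebra_simps)
  then have "d = (1 / cross2 p q) *\<^sub>R (cross2 d q *\<^sub>R p + cross2 p d *\<^sub>R q)"
    using assms by (metis inverse_eq_divide scaleR_scaleR right_inverse scaleR_one mult.commute)
  then show ?thesis
    by (simp add: scaleR_add_right)
qed

text \<open>Cramer's rule for the basis formed by the two sides at vertex \<open>i\<close>.\<close>

lemma bary_lin_expand: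
  assumes "nondeg v" "i < 3" "j < 3" "i \<noteq> j" "k = 3 - i - j"
  shows "d = bary_lin v j d *\<^sub>R (v j - v i) + bary_lin v k d *\<^sub>R (v k - v i)"
proof -
  have k: "k < 3" "k \<noteq> i" "k \<noteq> j" and j: "j = 3 - i - k"
    using third_less[OF assms(2-4)] assms(2-5) by auto
  have "bary_lin v k d = cross2 (v j - v i) d / cross2 (v j - v i) (v k - v i)"
    using bary_lin_eq assms by blast
  moreover have "bary_lin v j d = cross2 d (v k - v i) / cross2 (v j - v i) (v k - v i)"
    using bary_lin_eq[OF assms(2) k(1) k(2)[symmetric] j, of v d]
      cross2_commute[of d "v k - v i"] cross2_commute[of "v j - v i" "v k - v i"] by simp
  ultimately show ?thesis
    using cross2_expand[of "v j - v i" "v k - v i" d] nondeg_cross2[OF assms] by simp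
qed

lemma sum_bary_lin:
  assumes "nondeg v"
  shows "bary_lin v 0 d + bary_lin v 1 d + bary_lin v 2 d = 0"
proof -
  have "d = bary_lin v 1 d *\<^sub>R (v 1 - v 0) + bary_lin v 2 d *\<^sub>R (v 2 - v 0)"
    by (rule bary_lin_expand[OF assms]) simp_all
  from arg_cong[OF this, of "bary_lin v 0"]
  have "bary_lin v 0 d = bary_lin v 1 d * bary_lin v 0 (v 1 - v 0) + bary_lin v 2 d * bary_lin v 0 (v 2 - v 0)"
    by (simp only: bary_lin_add bary_lin_scale)
  also have "\<dots> = - bary_lin v 1 d - bary_lin v 2 d"
    by (simp add: bary_lin_edge[OF assms])
  finally show ?thesis by simp
qed

lemma sum_bary:
  assumes "nondeg v"
  shows "bary v 0 x + bary v 1 x + bary v 2 x = 1"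
proof -
  have "bary v 0 (v 0) = 1" "bary v 1 (v 0) = 0" "bary v 2 (v 0) = 0"
    by (simp_all add: bary_vertex[OF assms])
  then show ?thesis
    using sum_bary_lin[OF assms, of "x - v 0"] bary_diff[of v 0 x "v 0"] bary_diff[of v 1 x "v 0"]
      bary_diff[of v 2 x "v 0"] by linarith
qed

lemma bary_expand:
  assumes "nondeg v" "i < 3" "j < 3" "i \<noteq> j" "k = 3 - i - j"
  shows "x = v i + bary v j x *\<^sub>R (v j - v i) + bary v k x *\<^sub>R (v k - v i)"
proof -
  have k: "k < 3" "k \<noteq> i" "k \<noteq> j"
    using third_less[OF assms(2-4)] assms(2-5) by auto
  have "bary_lin v j (x - v i) = bary v j x" "bary_lin v k (x - v i) = bary v k x"
    using bary_diff[of v j x "v i"] bary_diff[of v k x "v i"] bary_vertex[OF assms(1,2), of j]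
      bary_vertex[OF assms(1,2), of k] assms(3,4) k(1,2) by auto
  then show ?thesis
    using bary_lin_expand[OF assms, of "x - v i"] by (simp add: algebra_simps)
qed

definition tri :: "(nat \<Rightarrow> point) \<Rightarrow> point set" where
  "tri v = convex hull {v 0, v 1, v 2}"

lemma tri_iff:
  assumes "nondeg v"
  shows "x \<in> tri v \<longleftrightarrow> (\<forall>k<3. 0 \<le> bary v k x)"
proof
  assume "x \<in> tri v"
  then obtain a b c where abc: "0 \<le> a" "0 \<le> b" "0 \<le> c" "a + b + c = 1"
      "x = a *\<^sub>R v 0 + b *\<^sub>R v 1 + c *\<^sub>R v 2"
    unfolding tri_def convex_hull_3 by auto
  have "x = v 0 + (b *\<^sub>R (v 1 - v 0) + c *\<^sub>R (v 2 - v 0))"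
    unfolding abc(5) using abc(4) by (simp add: algebra_simps flip: scaleR_add_left)
  then have "bary v k x = bary v k (v 0) + b * bary_lin v k (v 1 - v 0) + c * bary_lin v k (v 2 - v 0)" for k
    by (simp only: bary_add bary_lin_add bary_lin_scale)
  then show "\<forall>k<3. 0 \<le> bary v k x"
    using abc(1-4) by (simp add: less_3_iff bary_vertex[OF assms] bary_lin_edge[OF assms])
next
  assume *: "\<forall>k<3. 0 \<le> bary v k x"
  define p q r where "p = bary v 0 x" and "q = bary v 1 x" and "r = bary v 2 x"
  have "x = v 0 + q *\<^sub>R (v 1 - v 0) + r *\<^sub>R (v 2 - v 0)"
    unfolding q_def r_def by (rule bary_expand[OF assms]) simp_all
  moreover have p: "p = 1 - q - r"
    using sum_bary[OF assms, of x] unfolding p_def q_def r_def by simp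
  ultimately have "x = p *\<^sub>R v 0 + q *\<^sub>R v 1 + r *\<^sub>R v 2"
    unfolding p by (simp add: algebra_simps)
  moreover have "0 \<le> p" "0 \<le> q" "0 \<le> r" "p + q + r = 1"
    using *[rule_format, of 0] *[rule_format, of 1] *[rule_format, of 2] p
    unfolding p_def q_def r_def by linarith+
  ultimately show "x \<in> tri v"
    unfolding tri_def convex_hull_3
    by (intro CollectI exI[of _ p] exI[of _ q] exI[of _ r] conjI)
qed

definition tri_int :: "(nat \<Rightarrow> point) \<Rightarrow> point set" where
  "tri_int v = {x. \<forall>k<3. 0 < bary v k x}"

lemma continuous_cross2 [continuous_intros]:
  "continuous_on A f \<Longrightarrow> continuous_on A (\<lambda>x. cross2 c (f x))"
  unfolding cross2_def by (intro continuous_intros)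

lemma continuous_bary_lin [continuous_intros]:
  "continuous_on A f \<Longrightarrow> continuous_on A (\<lambda>x. bary_lin v k (f x))"
  unfolding bary_lin_def divide_inverse by (intro continuous_on_mult_right continuous_cross2)

lemma continuous_bary [continuous_intros]:
  "continuous_on A f \<Longrightarrow> continuous_on A (\<lambda>x. bary v k (f x))"
  unfolding bary_def by (intro continuous_bary_lin continuous_on_diff continuous_on_const)

lemma open_tri_int: "open (tri_int v)"
proof -
  have "tri_int v = {x. 0 < bary v 0 x} \<inter> {x. 0 < bary v 1 x} \<inter> {x. 0 < bary v 2 x}"
    by (auto simp: tri_int_def less_3_iff)
  also have "open \<dots>"
    by (intro open_Int open_Collect_less continuous_on_const continuous_bary continuous_on_id)
  finally show ?thesis .
qed

lemma tri_int_subset_tri: "nondeg v \<Longrightarrow> tri_int v \<subseteq> tri v"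
  unfolding tri_int_def by (auto simp: tri_iff order.order_iff_strict)

lemma tri_int_subset: "nondeg v \<Longrightarrow> tri_int v \<subseteq> interior (tri v)"
  by (rule interior_maximal[OF tri_int_subset_tri open_tri_int])

section \<open>Tangent cones and the measure of their directions\<close>

text \<open>The directions that lead from \<open>P\<close> into the open triangle; only the constraints active at \<open>P\<close> matter.\<close>
definition cone_open :: "(nat \<Rightarrow> point) \<Rightarrow> point \<Rightarrow> point set" where
  "cone_open v P = {d. \<forall>k<3. bary v k P = 0 \<longrightarrow> 0 < bary_lin v k d}"

definition cone_closed :: "(nat \<Rightarrow> point) \<Rightarrow> point \<Rightarrow> point set" where
  "cone_closed v P = {d. \<forall>k<3. bary v k P = 0 \<longrightarrow> 0 \<le> bary_lin v k d}"

lemma cone_open_subset_closed: "cone_open v P \<subseteq> cone_closed v P"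
  unfolding cone_open_def cone_closed_def using less_imp_le by blast

lemma small_step_pos:
  fixes a b :: real
  assumes "0 \<le> a" "a = 0 \<longrightarrow> 0 < b"
  shows "\<exists>e>0. \<forall>r. 0 < r \<and> r < e \<longrightarrow> 0 < a + r * b"
proof (cases "a = 0")
  case True
  then show ?thesis using assms by (intro exI[of _ 1]) auto
next
  case False
  then have a: "0 < a" using assms by simp
  have "0 < a + r * b" if "0 < r" "r < a / (\<bar>b\<bar> + 1)" for r
  proof -
    have "r * (\<bar>b\<bar> + 1) < a"
      using that by (simp add: pos_less_divide_eq)
    moreover have "- (r * b) \<le> r * \<bar>b\<bar>"
      using that(1) by (metis abs_ge_minus_self minus_mult_right mult_le_cancel_left_pos)
    ultimately show ?thesis using that(1) by (simp add: algebra_simps)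
  qed
  then show ?thesis using a by (intro exI[of _ "a / (\<bar>b\<bar> + 1)"]) auto
qed

lemma small_step_nonneg:
  fixes a b :: real
  assumes "0 \<le> a" "a = 0 \<longrightarrow> 0 \<le> b"
  shows "\<exists>e>0. \<forall>r. 0 < r \<and> r < e \<longrightarrow> 0 \<le> a + r * b"
proof (cases "a = 0")
  case True
  then show ?thesis using assms by (intro exI[of _ 1]) auto
next
  case False
  then show ?thesis
    using small_step_pos[of a b] assms less_imp_le by metis
qed

lemma less_3_common_bound:
  assumes "\<And>k. k < 3 \<Longrightarrow> \<exists>e>0. \<forall>r::real. 0 < r \<and> r < e \<longrightarrow> Q k r"
  shows "\<exists>e>0. \<forall>r::real. 0 < r \<and> r < e \<longrightarrow> (\<forall>k<(3::nat). Q k r)"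
proof -
  obtain e0 e1 e2 where e: "e0 > 0" "e1 > 0" "e2 > 0"
     "\<forall>r. 0 < r \<and> r < e0 \<longrightarrow> Q 0 r" "\<forall>r. 0 < r \<and> r < e1 \<longrightarrow> Q 1 r" "\<forall>r. 0 < r \<and> r < e2 \<longrightarrow> Q 2 r"
    using assms[of 0] assms[of 1] assms[of 2] by auto
  show ?thesis
    unfolding less_3_iff using e by (intro exI[of _ "min e0 (min e1 e2)"]) auto
qed

text \<open>Coordinates positive at \<open>P\<close> stay positive for small steps; those vanishing
  at \<open>P\<close> become positive because of \<open>d\<close>. Finitely many bounds on the step
  are then combined.\<close>

lemma cone_open_step:
  assumes "nondeg v" "P \<in> tri v" "d \<in> cone_open v P"
  shows "\<exists>e>0. \<forall>r. 0 < r \<and> r < e \<longrightarrow> P + r *\<^sub>R d \<in> tri_int v"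
proof -
  have "\<exists>e>0. \<forall>r. 0 < r \<and> r < e \<longrightarrow> 0 < bary v k P + r * bary_lin v k d" if "k < 3" for k
    using that assms by (intro small_step_pos) (auto simp: tri_iff cone_open_def)
  from less_3_common_bound[OF this] show ?thesis
    by (simp add: tri_int_def bary_add)
qed

lemma cone_closed_step:
  assumes "nondeg v" "P \<in> tri v" "d \<in> cone_closed v P"
  shows "\<exists>e>0. \<forall>r. 0 < r \<and> r < e \<longrightarrow> P + r *\<^sub>R d \<in> tri v"
proof -
  have "\<exists>e>0. \<forall>r. 0 < r \<and> r < e \<longrightarrow> 0 \<le> bary v k P + r * bary_lin v k d" if "k < 3" for k
    using that assms by (intro small_step_nonneg) (auto simp: tri_iff cone_closed_def)
  from less_3_common_bound[OF this] show ?thesis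
    by (simp add: tri_iff[OF assms(1)] bary_add)
qed

lemma cone_closedI:
  assumes "nondeg v" "0 < r" "P + r *\<^sub>R d \<in> tri v"
  shows "d \<in> cone_closed v P"
  unfolding cone_closed_def
proof (intro CollectI allI impI)
  fix k :: nat assume "k < 3" "bary v k P = 0"
  then have "0 \<le> r * bary_lin v k d"
    using assms(3) tri_iff[OF assms(1)] by (auto simp: bary_add)
  then show "0 \<le> bary_lin v k d"
    using assms(2) by (simp add: zero_le_mult_iff)
qed

lemma open_cone_open: "open (cone_open v P)"
proof -
  have "cone_open v P = (\<Inter>k\<in>{k. k < 3 \<and> bary v k P = 0}. {d. 0 < bary_lin v k d})"
    by (auto simp: cone_open_def)
  also have "open \<dots>"
    by (intro open_INT) (auto intro!: open_Collect_less continuous_on_const continuous_bary_lin continuous_on_id)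
  finally show ?thesis .
qed

section \<open>Directions as points of the circle and the size of a set of directions\<close>

definition unit_vector :: "real \<Rightarrow> point" where
  "unit_vector t = vector [cos t, sin t]"

lemma unit_vector_nth [simp]: "unit_vector t $ 1 = cos t" "unit_vector t $ 2 = sin t"
  by (simp_all add: unit_vector_def)

lemma norm_unit_vector [simp]: "norm (unit_vector t) = 1"
  unfolding norm_eq_1 inner_point by (simp flip: power2_eq_square)

lemma continuous_unit_vector: "continuous_on A unit_vector"
proof -
  have eq: "unit_vector = (\<lambda>t. cos t *\<^sub>R axis 1 1 + sin t *\<^sub>R axis 2 1)"
    by (auto simp: fun_eq_iff point_eq_iff axis_def)
  show ?thesis
    by (subst eq) (intro continuous_intros)
qed

lemma cross2_dir: "cross2 (unit_vector s) (unit_vector t) = sin (t - s)"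
  by (simp add: cross2_def sin_diff)

lemma inner_unit_vector: "unit_vector s \<bullet> unit_vector t = cos (t - s)"
  by (simp add: inner_point cos_diff)

lemma unit_vector_periodic: "unit_vector (t + 2 * pi) = unit_vector t"
  by (simp add: unit_vector_def)

lemma polar:
  assumes "w \<noteq> 0"
  obtains r \<tau> where "0 < r" "0 \<le> \<tau>" "\<tau> < 2 * pi" "w = r *\<^sub>R unit_vector \<tau>"
proof -
  define u where "u = (1 / norm w) *\<^sub>R w"
  have "norm u = 1" using assms by (simp add: u_def)
  then have "(u $ 1)\<^sup>2 + (u $ 2)\<^sup>2 = 1"
    by (simp add: norm_eq_1 inner_point power2_eq_square)
  then obtain \<tau> where t: "0 \<le> \<tau>" "\<tau> < 2 * pi" "u $ 1 = cos \<tau>" "u $ 2 = sin \<tau>"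
    using sincos_total_2pi by metis
  have "unit_vector \<tau> = u"
    using t(3,4) by (simp add: point_eq_iff)
  then have "w = norm w *\<^sub>R unit_vector \<tau>"
    using assms by (simp add: u_def)
  then show ?thesis
    using that[of "norm w" \<tau>] assms t by simp
qed

lemma negligible_ray:
  assumes "w \<noteq> 0"
  shows "negligible {t. cross2 w (unit_vector t) = 0}"
proof -
  obtain r \<tau> where w: "0 < r" "w = r *\<^sub>R unit_vector \<tau>" using polar[OF assms] by metis
  have "{t. cross2 w (unit_vector t) = 0} \<subseteq> range (\<lambda>i::int. of_int i * pi + \<tau>)"
    using w by (auto simp: cross2_dir sin_zero_iff_int2 image_iff) (metis diff_add_cancel)
  then show ?thesis
    by (meson countable_subset countable_image countableI_type countable_imp_null_set_lborel
        negligible_iff_null_sets null_sets_completionI)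
qed

text \<open>Angles are measured as Lebesgue measure on the circle, so that additivity of angles
  around a point becomes additivity of measure.\<close>

definition angle_measure :: "point set \<Rightarrow> real" where
  "angle_measure C = measure lebesgue {t. 0 \<le> t \<and> t < 2 * pi \<and> unit_vector t \<in> C}"

lemma lmeasurable_unit_vector:
  assumes "open C"
  shows "{t. a \<le> t \<and> t < b \<and> unit_vector t \<in> C} \<in> lmeasurable"
proof -
  have "open (unit_vector -` C)"
    using assms continuous_unit_vector open_vimage by blast
  then have "unit_vector -` C \<in> sets lebesgue" by simp
  then have "{a..<b} \<inter> unit_vector -` C \<in> sets lebesgue" by (intro sets.Int) simp_all
  moreover have "{t. a \<le> t \<and> t < b \<and> unit_vector t \<in> C} = {a..<b} \<inter> unit_vector -` C" by auto
  moreover have "bounded ({a..<b} \<inter> unit_vector -` C)"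
    by (rule bounded_subset[OF bounded_closed_interval[of a b]]) auto
  ultimately show ?thesis
    by (simp add: bounded_set_imp_lmeasurable)
qed

text \<open>By periodicity the parameter interval may start at any \<tau>. Starting at a boundary
  ray of a sector makes the sector a single interval instead of one that wraps around 0.\<close>

lemma angle_measure_shift:
  assumes "open C" "0 \<le> \<tau>" "\<tau> < 2 * pi"
  shows "angle_measure C = measure lebesgue {t. \<tau> \<le> t \<and> t < \<tau> + 2 * pi \<and> unit_vector t \<in> C}"
proof -
  let ?S = "\<lambda>a b. {t. a \<le> t \<and> t < b \<and> unit_vector t \<in> C}"
  have m: "?S a b \<in> lmeasurable" for a b
    by (rule lmeasurable_unit_vector[OF assms(1)])
  have split: "measure lebesgue (?S a c) = measure lebesgue (?S a b) + measure lebesgue (?S b c)"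
    if "a \<le> b" "b \<le> c" for a b c
  proof -
    have "?S a c = ?S a b \<union> ?S b c" "?S b c - ?S a b = ?S b c" using that by auto
    then show ?thesis using measure_Un2[OF m[of a b] m[of b c]] by (simp only:)
  qed
  have "?S (2 * pi) (\<tau> + 2 * pi) = (+) (2 * pi) ` ?S 0 \<tau>"
  proof (intro set_eqI iffI)
    fix t assume "t \<in> ?S (2 * pi) (\<tau> + 2 * pi)"
    then have "t - 2 * pi \<in> ?S 0 \<tau>" using unit_vector_periodic[of "t - 2 * pi"] by auto
    then show "t \<in> (+) (2 * pi) ` ?S 0 \<tau>" by (intro image_eqI[of _ _ "t - 2 * pi"]) auto
  next
    fix t assume "t \<in> (+) (2 * pi) ` ?S 0 \<tau>"
    then show "t \<in> ?S (2 * pi) (\<tau> + 2 * pi)" using unit_vector_periodic by (auto simp: add.commute)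
  qed
  then have "measure lebesgue (?S (2 * pi) (\<tau> + 2 * pi)) = measure lebesgue (?S 0 \<tau>)"
    by (simp add: measure_translation)
  then show ?thesis
    unfolding angle_measure_def using split[of 0 \<tau> "2 * pi"] split[of \<tau> "2 * pi" "\<tau> + 2 * pi"] assms
    by simp
qed

lemma angle_measure_UNIV: "angle_measure UNIV = 2 * pi"
proof -
  have "{t. 0 \<le> t \<and> t < 2 * pi \<and> unit_vector t \<in> UNIV} = {0..<2 * pi}" by auto
  then show ?thesis by (simp add: angle_measure_def)
qed

lemma angle_measure_half:
  assumes "w \<noteq> 0"
  shows "angle_measure {d. 0 < cross2 w d} = pi"
proof -
  obtain r \<tau> where w: "0 < r" "0 \<le> \<tau>" "\<tau> < 2 * pi" "w = r *\<^sub>R unit_vector \<tau>" using polar[OF assms] by metis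
  have "{t. \<tau> \<le> t \<and> t < \<tau> + 2 * pi \<and> unit_vector t \<in> {d. 0 < cross2 w d}} = {\<tau><..<\<tau> + pi}"
  proof (intro set_eqI iffI)
    fix t assume "t \<in> {t. \<tau> \<le> t \<and> t < \<tau> + 2 * pi \<and> unit_vector t \<in> {d. 0 < cross2 w d}}"
    then have t: "\<tau> \<le> t" "t < \<tau> + 2 * pi" "0 < sin (t - \<tau>)"
      using w by (auto simp: cross2_dir zero_less_mult_iff)
    then have "t \<noteq> \<tau>" by auto
    moreover have "\<not> \<tau> + pi \<le> t"
      using t sin_le_zero[of "t - \<tau>"] by auto
    ultimately show "t \<in> {\<tau><..<\<tau> + pi}" using t by auto
  next
    fix t assume "t \<in> {\<tau><..<\<tau> + pi}"
    then have "\<tau> \<le> t" "t < \<tau> + 2 * pi" "0 < sin (t - \<tau>)"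
      by (auto intro!: sin_gt_zero)
    then show "t \<in> {t. \<tau> \<le> t \<and> t < \<tau> + 2 * pi \<and> unit_vector t \<in> {d. 0 < cross2 w d}}"
      using w by (auto simp: cross2_dir)
  qed
  moreover have "open {d. 0 < cross2 w d}"
    by (intro open_Collect_less continuous_on_const continuous_cross2 continuous_on_id)
  ultimately show ?thesis
    using angle_measure_shift w by simp
qed

lemma angle_measure_sector:
  assumes "0 < cross2 p q"
  shows "angle_measure {d. 0 < cross2 p d \<and> 0 < cross2 d q} = arccos (p \<bullet> q / (norm p * norm q))"
    and "0 < arccos (p \<bullet> q / (norm p * norm q))" "arccos (p \<bullet> q / (norm p * norm q)) < pi"
proof -
  have "p \<noteq> 0" "q \<noteq> 0" using assms by auto
  then obtain r \<tau> \<rho> \<tau>' where p: "0 < r" "0 \<le> \<tau>" "\<tau> < 2 * pi" "p = r *\<^sub>R unit_vector \<tau>"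
      and q: "0 < \<rho>" "0 \<le> \<tau>'" "\<tau>' < 2 * pi" "q = \<rho> *\<^sub>R unit_vector \<tau>'"
    using polar by metis
  \<comment> \<open>The counterclockwise angle from \<open>p\<close> to \<open>q\<close>, reduced to
    the range from 0 to \<open>2 * pi\<close>. The positive determinant then forces it below
    \<open>pi\<close>, where \<open>arccos\<close> inverts \<open>cos\<close>.\<close>
  define \<theta> where "\<theta> = (if \<tau> \<le> \<tau>' then \<tau>' - \<tau> else \<tau>' - \<tau> + 2 * pi)"
  have th: "0 \<le> \<theta>" "\<theta> < 2 * pi" "unit_vector \<tau>' = unit_vector (\<tau> + \<theta>)"
    using p q unit_vector_periodic[of \<tau>'] by (auto simp: \<theta>_def algebra_simps)
  have "0 < sin \<theta>"
    using assms p(1,4) q(1,4) th(3) by (simp add: cross2_dir zero_less_mult_iff)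
  then have th2: "0 < \<theta>" "\<theta> < pi"
    using th(1,2) sin_le_zero[of \<theta>] by (cases "\<theta> = 0"; force)+
  have "p \<bullet> q / (norm p * norm q) = cos \<theta>"
    using p(1,4) q(1,4) th(3) by (simp add: inner_unit_vector)
  then have ac: "arccos (p \<bullet> q / (norm p * norm q)) = \<theta>"
    using th2 by (simp add: arccos_cos)
  have sec: "0 < cross2 p (unit_vector t) \<and> 0 < cross2 (unit_vector t) q \<longleftrightarrow> 0 < sin (t - \<tau>) \<and> 0 < sin (\<tau> + \<theta> - t)" for t
    using p(1,4) q(1,4) th(3) by (simp add: cross2_dir zero_less_mult_iff)
  have "{t. \<tau> \<le> t \<and> t < \<tau> + 2 * pi \<and> unit_vector t \<in> {d. 0 < cross2 p d \<and> 0 < cross2 d q}} = {\<tau><..<\<tau> + \<theta>}"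
  proof (intro set_eqI iffI)
    fix t assume "t \<in> {t. \<tau> \<le> t \<and> t < \<tau> + 2 * pi \<and> unit_vector t \<in> {d. 0 < cross2 p d \<and> 0 < cross2 d q}}"
    then have t: "\<tau> \<le> t" "t < \<tau> + 2 * pi" "0 < sin (t - \<tau>)" "0 < sin (\<tau> + \<theta> - t)"
      using sec by auto
    have "t \<noteq> \<tau>" using t by auto
    moreover have "t < \<tau> + pi"
      using t sin_le_zero[of "t - \<tau>"] by force
    moreover have "\<not> \<tau> + \<theta> \<le> t"
    proof
      assume "\<tau> + \<theta> \<le> t"
      then have "0 \<le> sin (t - (\<tau> + \<theta>))"
        using \<open>t < \<tau> + pi\<close> th2 by (intro sin_ge_zero) auto
      also have "\<dots> = - sin (\<tau> + \<theta> - t)"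
        by (metis minus_diff_eq sin_minus)
      finally show False using t by simp
    qed
    ultimately show "t \<in> {\<tau><..<\<tau> + \<theta>}" using t by auto
  next
    fix t assume "t \<in> {\<tau><..<\<tau> + \<theta>}"
    then have "\<tau> \<le> t" "t < \<tau> + 2 * pi" "0 < sin (t - \<tau>)" "0 < sin (\<tau> + \<theta> - t)"
      using th2 by (auto intro!: sin_gt_zero)
    then show "t \<in> {t. \<tau> \<le> t \<and> t < \<tau> + 2 * pi \<and> unit_vector t \<in> {d. 0 < cross2 p d \<and> 0 < cross2 d q}}"
      using sec by auto
  qed
  moreover have "open {d. 0 < cross2 p d \<and> 0 < cross2 d q}"
  proof -
    have "{d. 0 < cross2 p d \<and> 0 < cross2 d q} = {d. 0 < cross2 p d} \<inter> {d. 0 < cross2 (- q) d}"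
      using cross2_commute[of _ q] by auto
    then show ?thesis
      by (auto intro!: open_Int open_Collect_less continuous_on_const continuous_cross2 continuous_on_id)
  qed
  ultimately show "angle_measure {d. 0 < cross2 p d \<and> 0 < cross2 d q} = arccos (p \<bullet> q / (norm p * norm q))"
    using angle_measure_shift[of _ \<tau>] p(2,3) th2 ac by simp
  show "0 < arccos (p \<bullet> q / (norm p * norm q))" "arccos (p \<bullet> q / (norm p * norm q)) < pi"
    using ac th2 by auto
qed

section \<open>Interior, open sides and vertices of a triangle, and the cones there\<close>

definition tri_edge :: "(nat \<Rightarrow> point) \<Rightarrow> nat \<Rightarrow> point set" where
  "tri_edge v k = {x. bary v k x = 0 \<and> (\<forall>j<3. j \<noteq> k \<longrightarrow> 0 < bary v j x)}"

definition tri_edges :: "(nat \<Rightarrow> point) \<Rightarrow> point set" where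
  "tri_edges v = (\<Union>k<3. tri_edge v k)"

definition tri_angle :: "(nat \<Rightarrow> point) \<Rightarrow> nat \<Rightarrow> real" where
  "tri_angle v i = vertex_angle (v ((i + 1) mod 3)) (v i) (v ((i + 2) mod 3))"

lemma vertex_angle_commute: "vertex_angle X Y Z = vertex_angle Z Y X"
  by (simp add: vertex_angle_def inner_commute mult.commute)

lemma tri_cases:
  assumes "nondeg v" "x \<in> tri v"
  obtains "x \<in> tri_int v" | k where "k < 3" "x \<in> tri_edge v k" | i where "i < 3" "x = v i"
proof -
  have nn: "0 \<le> bary v k x" if "k < 3" for k
    using assms that by (simp add: tri_iff)
  consider "\<forall>k<3. bary v k x \<noteq> 0"
    | k where "k < 3" "bary v k x = 0" "\<forall>j<3. j \<noteq> k \<longrightarrow> bary v j x \<noteq> 0"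
    | j k where "k < 3" "j < 3" "j \<noteq> k" "bary v k x = 0" "bary v j x = 0"
    by metis
  then show ?thesis
  proof cases
    case 1
    then have "x \<in> tri_int v" using nn by (auto simp: tri_int_def order.order_iff_strict)
    then show ?thesis using that by blast
  next
    case (2 k)
    then have "x \<in> tri_edge v k" using nn by (auto simp: tri_edge_def order.order_iff_strict)
    then show ?thesis using that 2 by blast
  next
    case (3 j k)
    define i where "i = 3 - j - k"
    have i: "i < 3" "i \<noteq> j" "i \<noteq> k" "k = 3 - i - j"
      using third_less[OF 3(2,1,3)] 3(1-3) by (auto simp: i_def)
    have "x = v i"
      using bary_expand[OF assms(1) i(1) 3(2) i(2) i(4), of x] 3(4,5) by simp
    then show ?thesis using that i by blast
  qed
qed

lemma tri_vertex_mem: "i < 3 \<Longrightarrow> v i \<in> tri v"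
  unfolding tri_def by (rule hull_inc) (use less_3_cases[of i] in fastforce)

lemma tri_edge_subset: "nondeg v \<Longrightarrow> k < 3 \<Longrightarrow> tri_edge v k \<subseteq> tri v"
  by (simp add: subset_iff tri_edge_def tri_iff) (metis less_imp_le order_refl)

lemma tri_parts_disjoint:
  assumes "nondeg v"
  shows "tri_int v \<inter> tri_edges v = {}" "i < 3 \<Longrightarrow> v i \<notin> tri_int v" "i < 3 \<Longrightarrow> v i \<notin> tri_edges v"
    "i < 3 \<Longrightarrow> j < 3 \<Longrightarrow> v i = v j \<Longrightarrow> i = j"
proof -
  show "tri_int v \<inter> tri_edges v = {}"
    by (auto simp: tri_int_def tri_edges_def tri_edge_def)
  show ij: "i < 3 \<Longrightarrow> j < 3 \<Longrightarrow> v i = v j \<Longrightarrow> i = j" for i j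
    using bary_vertex[OF assms, of i j] bary_vertex[OF assms, of j j] by (auto split: if_splits)
  assume i: "i < 3"
  have z: "bary v k (v i) = 0" if "k < 3" "k \<noteq> i" for k
    using bary_vertex[OF assms i that(1)] that by simp
  have "\<exists>k<3. k \<noteq> i" "\<And>k. k < 3 \<Longrightarrow> \<exists>j<3. j \<noteq> k \<and> j \<noteq> i"
    using i by presburger+
  then show "v i \<notin> tri_int v" "v i \<notin> tri_edges v"
    unfolding tri_int_def tri_edges_def tri_edge_def mem_Collect_eq UN_iff lessThan_iff
    using z by (metis less_irrefl)+
qed

lemma cone_open_int: "x \<in> tri_int v \<Longrightarrow> cone_open v x = UNIV"
  by (auto simp: cone_open_def tri_int_def)

lemma cone_open_edge: "k < 3 \<Longrightarrow> x \<in> tri_edge v k \<Longrightarrow> cone_open v x = {d. 0 < bary_lin v k d}"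
  unfolding cone_open_def tri_edge_def by (auto dest: less_imp_neq)

lemma cone_open_vertex:
  assumes "nondeg v" "i < 3" "j < 3" "i \<noteq> j" "k = 3 - i - j"
  shows "cone_open v (v i) = {d. 0 < bary_lin v j d \<and> 0 < bary_lin v k d}"
proof -
  have k: "k < 3" "k \<noteq> i" "k \<noteq> j"
    using third_less[OF assms(2-4)] assms(5) by auto
  have "bary v i (v i) = 1" "bary v j (v i) = 0" "bary v k (v i) = 0"
    using bary_vertex[OF assms(1,2)] assms k by auto
  then show ?thesis
    unfolding cone_open_def using third_cases[OF assms(2-4)] assms k by force
qed

lemma angle_measure_int: "x \<in> tri_int v \<Longrightarrow> angle_measure (cone_open v x) = 2 * pi"
  by (simp add: cone_open_int angle_measure_UNIV)

lemma bary_lin_cr: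
  assumes "nondeg v" "k < 3"
  shows "\<exists>w. w \<noteq> 0 \<and> (\<forall>d. bary_lin v k d = cross2 w d)"
proof -
  obtain i j where ij: "i < 3" "j < 3" "i \<noteq> j" "k = 3 - i - j"
    using that[of 1 2] that[of 0 2] that[of 0 1] less_3_cases[OF assms(2)] by auto
  have D: "cross2 (v j - v i) (v k - v i) \<noteq> 0"
    by (rule nondeg_cross2[OF assms(1) ij])
  define w where "w = (1 / cross2 (v j - v i) (v k - v i)) *\<^sub>R (v j - v i)"
  have "w \<noteq> 0"
    using D by (auto simp: w_def)
  moreover have "bary_lin v k d = cross2 w d" for d
    using bary_lin_eq[OF ij, of v d] by (simp add: w_def)
  ultimately show ?thesis by blast
qed

lemma angle_measure_edge:
  assumes "nondeg v" "x \<in> tri_edges v"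
  shows "angle_measure (cone_open v x) = pi"
proof -
  obtain k where k: "k < 3" "x \<in> tri_edge v k"
    using assms(2) by (auto simp: tri_edges_def)
  obtain w where "w \<noteq> 0" "\<And>d. bary_lin v k d = cross2 w d"
    using bary_lin_cr[OF assms(1) k(1)] by blast
  then show ?thesis
    using cone_open_edge[OF k] angle_measure_half by simp
qed

text \<open>The cone at a vertex is the sector between the two sides \<open>p\<close> and
  \<open>q\<close>. The two cases are the two orientations, which exchange the roles of
  \<open>p\<close> and \<open>q\<close>.\<close>

lemma angle_measure_vertex:
  assumes "nondeg v" "i < 3"
  shows "angle_measure (cone_open v (v i)) = tri_angle v i" "0 < tri_angle v i" "tri_angle v i < pi"
proof -
  define j where "j = (i + 1) mod 3"
  define k where "k = (i + 2) mod 3"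
  have j: "j < 3" "i \<noteq> j" "k = 3 - i - j"
    using less_3_cases[OF assms(2)] by (auto simp: j_def k_def)
  have k: "k < 3" "i \<noteq> k" "j = 3 - i - k"
    using third_less[OF assms(2) j(1,2)] j assms(2) by auto
  define p q where "p = v j - v i" and "q = v k - v i"
  have nz: "cross2 p q \<noteq> 0"
    using nondeg_cross2[OF assms j] by (simp add: p_def q_def)
  have bk: "bary_lin v k d = cross2 p d / cross2 p q" for d
    using bary_lin_eq[OF assms(2) j] by (simp add: p_def q_def)
  have bj: "bary_lin v j d = cross2 d q / cross2 p q" for d
    using bary_lin_eq[OF assms(2) k, of v d] cross2_commute[of d q] cross2_commute[of p q] by (simp add: p_def q_def)
  have ang: "tri_angle v i = arccos (p \<bullet> q / (norm p * norm q))"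
    by (simp add: tri_angle_def vertex_angle_def p_def q_def j_def k_def)
  have "angle_measure (cone_open v (v i)) = tri_angle v i \<and> 0 < tri_angle v i \<and> tri_angle v i < pi"
  proof (cases "0 < cross2 p q")
    case True
    then have "cone_open v (v i) = {d. 0 < cross2 p d \<and> 0 < cross2 d q}"
      unfolding cone_open_vertex[OF assms j] bk bj by (auto simp: zero_less_divide_iff)
    then show ?thesis using angle_measure_sector[OF True] ang by simp
  next
    case False
    then have neg: "cross2 p q < 0" and T: "0 < cross2 q p"
      using nz cross2_commute[of p q] by auto
    have "0 < cross2 d q / cross2 p q \<and> 0 < cross2 p d / cross2 p q \<longleftrightarrow> 0 < cross2 q d \<and> 0 < cross2 d p" for d
      using neg cross2_commute[of d q] cross2_commute[of p d] by (auto simp: zero_less_divide_iff divide_less_0_iff)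
    then have "cone_open v (v i) = {d. 0 < cross2 q d \<and> 0 < cross2 d p}"
      unfolding cone_open_vertex[OF assms j] bk bj by blast
    then show ?thesis
      using angle_measure_sector[OF T] ang by (simp add: inner_commute mult.commute)
  qed
  then show "angle_measure (cone_open v (v i)) = tri_angle v i" "0 < tri_angle v i" "tri_angle v i < pi"
    by auto
qed

lemma negligible_cone_boundary:
  assumes "nondeg v"
  shows "negligible {t. unit_vector t \<in> cone_closed v P - cone_open v P}"
proof -
  have "negligible {t. bary_lin v k (unit_vector t) = 0}" if k: "k < 3" for k
  proof -
    obtain w where "w \<noteq> 0" "\<And>d. bary_lin v k d = cross2 w d"
      using bary_lin_cr[OF assms k] by blast
    then show ?thesis using negligible_ray by simp
  qed
  then have "negligible (\<Union>k\<in>{..<3}. {t. bary_lin v k (unit_vector t) = 0})"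
    by (intro negligible_Union) auto
  then show ?thesis
  proof (rule negligible_subset)
    show "{t. unit_vector t \<in> cone_closed v P - cone_open v P} \<subseteq> (\<Union>k\<in>{..<3}. {t. bary_lin v k (unit_vector t) = 0})"
      unfolding cone_closed_def cone_open_def
      by (simp add: subset_iff) (metis lessThan_iff order.order_iff_strict)
  qed
qed

text \<open>It suffices that the open cones are disjoint and the closed cones cover, since open and
  closed cones differ only in a negligible set of directions.\<close>

lemma sum_angle_measure:
  assumes "finite J" "\<And>t. t \<in> J \<Longrightarrow> nondeg (v t)" "nondeg w"
    and "\<And>t t'. t \<in> J \<Longrightarrow> t' \<in> J \<Longrightarrow> t \<noteq> t' \<Longrightarrow> cone_open (v t) P \<inter> cone_open (v t') P = {}"
    and "\<And>t. t \<in> J \<Longrightarrow> cone_open (v t) P \<subseteq> cone_closed w P"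
    and "cone_open w P \<subseteq> (\<Union>t\<in>J. cone_closed (v t) P)"
  shows "(\<Sum>t\<in>J. angle_measure (cone_open (v t) P)) = angle_measure (cone_open w P)"
proof -
  define S where "S C = {t. 0 \<le> t \<and> t < 2 * pi \<and> unit_vector t \<in> C}" for C
  have m: "S (cone_open u P) \<in> lmeasurable" for u
    unfolding S_def by (rule lmeasurable_unit_vector[OF open_cone_open])
  have "measure lebesgue (\<Union>t\<in>J. S (cone_open (v t) P)) = (\<Sum>t\<in>J. measure lebesgue (S (cone_open (v t) P)))"
  proof (rule measure_UNION')
    show "pairwise (\<lambda>i j. disjnt (S (cone_open (v i) P)) (S (cone_open (v j) P))) J"
      unfolding pairwise_def disjnt_def S_def using assms(4) by blast
  qed (use assms(1) m in auto)
  moreover have "measure lebesgue (\<Union>t\<in>J. S (cone_open (v t) P)) = measure lebesgue (S (cone_open w P))"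
  proof (rule measure_negligible_symdiff[OF m])
    let ?N = "(\<Union>t\<in>J. {s. unit_vector s \<in> cone_closed (v t) P - cone_open (v t) P})
      \<union> {s. unit_vector s \<in> cone_closed w P - cone_open w P}"
    have "negligible ?N"
      using assms(1-3) negligible_cone_boundary by (intro negligible_Un negligible_Union) auto
    then show "negligible (S (cone_open w P) - (\<Union>t\<in>J. S (cone_open (v t) P)) \<union>
        ((\<Union>t\<in>J. S (cone_open (v t) P)) - S (cone_open w P)))"
    proof (rule negligible_subset, intro subsetI)
      fix s assume "s \<in> S (cone_open w P) - (\<Union>t\<in>J. S (cone_open (v t) P)) \<union>
        ((\<Union>t\<in>J. S (cone_open (v t) P)) - S (cone_open w P))"
      then consider "s \<in> S (cone_open w P)" "\<forall>t\<in>J. s \<notin> S (cone_open (v t) P)"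
        | t where "t \<in> J" "s \<in> S (cone_open (v t) P)" "s \<notin> S (cone_open w P)" by blast
      then show "s \<in> ?N"
      proof cases
        case 1
        then obtain t where "t \<in> J" "unit_vector s \<in> cone_closed (v t) P"
          using assms(6) by (auto simp: S_def)
        then show ?thesis using 1 by (auto simp: S_def)
      next
        case 2
        then show ?thesis using assms(5) by (auto simp: S_def)
      qed
    qed
  qed
  ultimately show ?thesis
    unfolding angle_measure_def S_def by simp
qed

section \<open>Tilings by congruent triangles\<close>

text \<open>The side joining the vertices \<open>i\<close> and \<open>j\<close> of a tile has type \<open>i + j \<in> {1, 2, 3}\<close>, and the third vertex
  has index \<open>3 - i - j\<close>. With the angles \<open>\<alpha>, \<beta>, \<gamma>\<close> at the vertices \<open>0, 1, 2\<close>, the types \<open>1, 2, 3\<close> are the sides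
  opposite \<open>\<gamma>, \<beta>, \<alpha>\<close>.\<close>
locale tri_tiling =
  fixes I :: "'t set" and V :: "'t \<Rightarrow> nat \<Rightarrow> point" and W :: "nat \<Rightarrow> point"
    and len :: "nat \<Rightarrow> real" and ang :: "nat \<Rightarrow> real"
  assumes finite_I: "finite I"
    and nondeg_V: "t \<in> I \<Longrightarrow> nondeg (V t)"
    and nondeg_W: "nondeg W"
    and cover: "(\<Union>t\<in>I. tri (V t)) = tri W"
    and no_overlap: "t \<in> I \<Longrightarrow> t' \<in> I \<Longrightarrow> t \<noteq> t' \<Longrightarrow> tri_int (V t) \<inter> tri (V t') = {}"
    and len_V: "t \<in> I \<Longrightarrow> i < 3 \<Longrightarrow> j < 3 \<Longrightarrow> i \<noteq> j \<Longrightarrow> dist (V t i) (V t j) = len (i + j)"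
    and ang_V: "t \<in> I \<Longrightarrow> i < 3 \<Longrightarrow> tri_angle (V t) i = ang i"
begin

lemma tile_subset: "t \<in> I \<Longrightarrow> tri (V t) \<subseteq> tri W"
  using cover by blast

text \<open>A common direction would lead, after a small step, to a point interior to one tile and
  contained in the other.\<close>

lemma cones_disjoint:
  assumes "t \<in> I" "t' \<in> I" "t \<noteq> t'" "P \<in> tri (V t)" "P \<in> tri (V t')"
  shows "cone_open (V t) P \<inter> cone_closed (V t') P = {}"
proof (rule ccontr)
  assume "cone_open (V t) P \<inter> cone_closed (V t') P \<noteq> {}"
  then obtain d where d: "d \<in> cone_open (V t) P" "d \<in> cone_closed (V t') P" by blast
  obtain e where e: "0 < e" "\<forall>r. 0 < r \<and> r < e \<longrightarrow> P + r *\<^sub>R d \<in> tri_int (V t)"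
    using cone_open_step[OF nondeg_V[OF assms(1)] assms(4) d(1)] by blast
  obtain e' where e': "0 < e'" "\<forall>r. 0 < r \<and> r < e' \<longrightarrow> P + r *\<^sub>R d \<in> tri (V t')"
    using cone_closed_step[OF nondeg_V[OF assms(2)] assms(5) d(2)] by blast
  have "P + (min e e' / 2) *\<^sub>R d \<in> tri_int (V t) \<inter> tri (V t')"
    using e e' by auto
  then show False using no_overlap[OF assms(1-3)] by blast
qed

lemma cone_closed_mono:
  assumes "t \<in> I" "P \<in> tri (V t)"
  shows "cone_closed (V t) P \<subseteq> cone_closed W P"
proof
  fix d assume "d \<in> cone_closed (V t) P"
  then obtain e where e: "0 < e" "\<forall>r. 0 < r \<and> r < e \<longrightarrow> P + r *\<^sub>R d \<in> tri (V t)"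
    using cone_closed_step[OF nondeg_V[OF assms(1)] assms(2)] by blast
  then have "P + (e / 2) *\<^sub>R d \<in> tri W"
    using tile_subset[OF assms(1)] by auto
  then show "d \<in> cone_closed W P"
    using cone_closedI[OF nondeg_W, of "e / 2"] e(1) by simp
qed

text \<open>Points on the ray converging to \<open>P\<close> lie in tiles. By the pigeonhole
  principle one tile contains infinitely many of them, hence also the limit \<open>P\<close>, and
  the direction lies in its closed cone.\<close>

lemma cone_closed_covered:
  assumes "P \<in> tri W" "d \<in> cone_closed W P"
  shows "\<exists>t\<in>I. P \<in> tri (V t) \<and> d \<in> cone_closed (V t) P"
proof -
  obtain e where e: "0 < e" "\<forall>r. 0 < r \<and> r < e \<longrightarrow> P + r *\<^sub>R d \<in> tri W"
    using cone_closed_step[OF nondeg_W assms] by blast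
  \<comment> \<open>The summand 2 keeps \<open>r n\<close> strictly below \<open>e\<close> even for
    \<open>n = 0\<close>.\<close>
  define r where "r n = e / real (n + 2)" for n :: nat
  have r: "0 < r n" "r n < e" for n
    using e(1) by (auto simp: r_def field_simps add_pos_nonneg)
  have "\<exists>t\<in>I. P + r n *\<^sub>R d \<in> tri (V t)" for n
    using e(2) r[of n] cover by blast
  then obtain f where f: "\<And>n. f n \<in> I" "\<And>n. P + r n *\<^sub>R d \<in> tri (V (f n))"
    by metis
  have "finite (f ` UNIV)"
    using finite_I f(1) by (meson finite_subset image_subsetI)
  then obtain n0 where "infinite {n \<in> UNIV. f n = f n0}"
    using pigeonhole_infinite[of UNIV f] by auto
  then have inf: "\<exists>n>m. f n = f n0" for m
    by (simp add: infinite_nat_iff_unbounded)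
  define t where "t = f n0"
  have t: "t \<in> I" and nd: "nondeg (V t)" using f(1) nondeg_V by (auto simp: t_def)
  have "0 \<le> bary (V t) k P" if k: "k < 3" for k
  proof (rule ccontr)
    assume "\<not> 0 \<le> bary (V t) k P"
    then obtain e' where e': "0 < e'" "\<forall>s. 0 < s \<and> s < e' \<longrightarrow> 0 < - bary (V t) k P + s * (- bary_lin (V t) k d)"
      using small_step_pos[of "- bary (V t) k P" "- bary_lin (V t) k d"] by auto
    obtain m :: nat where "e / e' < real m"
      using reals_Archimedean2 by blast
    moreover obtain n where n: "n > m" "f n = t" using inf t_def by blast
    ultimately have "e / e' < real (n + 2)" by simp
    then have "r n < e'"
      using e'(1) e(1) by (simp add: r_def field_simps)
    then have "bary (V t) k (P + r n *\<^sub>R d) < 0"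
      using e'(2) r(1)[of n] by (auto simp: bary_add)
    moreover have "P + r n *\<^sub>R d \<in> tri (V t)" using f(2)[of n] n(2) by simp
    ultimately show False using k by (auto simp: tri_iff[OF nd])
  qed
  then have "P \<in> tri (V t)" by (simp add: tri_iff[OF nd])
  moreover have "d \<in> cone_closed (V t) P"
    using cone_closedI[OF nd r(1)[of n0]] f(2)[of n0] by (simp add: t_def)
  ultimately show ?thesis using t by blast
qed

lemma sum_cones:
  assumes "P \<in> tri W"
  shows "(\<Sum>t\<in>{t\<in>I. P \<in> tri (V t)}. angle_measure (cone_open (V t) P)) = angle_measure (cone_open W P)"
proof (rule sum_angle_measure)
  fix t t' assume t: "t \<in> {t \<in> I. P \<in> tri (V t)}" "t' \<in> {t \<in> I. P \<in> tri (V t)}" "t \<noteq> t'"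
  show "cone_open (V t) P \<inter> cone_open (V t') P = {}"
    using cones_disjoint[of t t' P] t cone_open_subset_closed[of "V t'" P] by auto
next
  fix t assume "t \<in> {t \<in> I. P \<in> tri (V t)}"
  then show "cone_open (V t) P \<subseteq> cone_closed W P"
    using cone_closed_mono[of t P] cone_open_subset_closed[of "V t" P] by auto
next
  show "cone_open W P \<subseteq> (\<Union>t\<in>{t \<in> I. P \<in> tri (V t)}. cone_closed (V t) P)"
    using cone_closed_covered[OF assms] cone_open_subset_closed[of W P] by blast
qed (use finite_I nondeg_V nondeg_W in auto)

definition count :: "nat \<Rightarrow> point \<Rightarrow> nat" where
  "count i P = card {t\<in>I. V t i = P}"

definition through :: "point \<Rightarrow> nat" where
  "through P = card {t\<in>I. P \<in> tri_edges (V t)}"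

text \<open>The tiles containing \<open>P\<close> have it as a vertex, inside a side, or in the
  interior. Their cones have size \<open>ang i\<close>, \<open>pi\<close> and \<open>2 * pi\<close>
  respectively, and together they fill the cone of \<open>W\<close>.\<close>

lemma angle_sum:
  assumes "P \<in> tri W"
  shows "real (count 0 P) * ang 0 + real (count 1 P) * ang 1 + real (count 2 P) * ang 2
    + real (through P) * pi + real (card {t\<in>I. P \<in> tri_int (V t)}) * (2 * pi)
    = angle_measure (cone_open W P)"
proof -
  define J where "J i = {t\<in>I. V t i = P}" for i
  define E where "E = {t\<in>I. P \<in> tri_edges (V t)}"
  define F where "F = {t\<in>I. P \<in> tri_int (V t)}"
  have fin: "finite (J i)" "finite E" "finite F" for i
    using finite_I by (auto simp: J_def E_def F_def)
  let ?m = "\<lambda>t. angle_measure (cone_open (V t) P)"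
  have "{t\<in>I. P \<in> tri (V t)} = J 0 \<union> J 1 \<union> J 2 \<union> E \<union> F"
  proof (intro set_eqI iffI)
    fix t assume "t \<in> {t\<in>I. P \<in> tri (V t)}"
    then have t: "t \<in> I" "P \<in> tri (V t)" by auto
    from nondeg_V[OF t(1)] t(2) show "t \<in> J 0 \<union> J 1 \<union> J 2 \<union> E \<union> F"
    proof (cases rule: tri_cases)
      case (3 i)
      then have "t \<in> J i" using t by (simp add: J_def)
      then show ?thesis using less_3_cases[OF 3(1)] by auto
    qed (use t in \<open>auto simp: E_def F_def tri_edges_def\<close>)
  next
    fix t assume "t \<in> J 0 \<union> J 1 \<union> J 2 \<union> E \<union> F"
    then show "t \<in> {t\<in>I. P \<in> tri (V t)}"
      using tri_vertex_mem[of 0 "V t"] tri_vertex_mem[of 1 "V t"] tri_vertex_mem[of 2 "V t"]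
        tri_edge_subset[OF nondeg_V[of t]] tri_int_subset_tri[OF nondeg_V[of t]]
      by (auto simp: J_def E_def F_def tri_edges_def)
  qed
  moreover have "J i \<inter> J j = {}" if "i < 3" "j < 3" "i \<noteq> j" for i j
    using tri_parts_disjoint(4)[OF nondeg_V that(1,2)] that(3) by (fastforce simp: J_def)
  then have "J 0 \<inter> J 1 = {}" "(J 0 \<union> J 1) \<inter> J 2 = {}" by (simp_all add: Int_Un_distrib2)
  moreover have "J i \<inter> E = {}" "J i \<inter> F = {}" if "i < 3" for i
    using tri_parts_disjoint(2,3)[OF nondeg_V that] by (auto simp: J_def E_def F_def)
  then have "(J 0 \<union> J 1 \<union> J 2) \<inter> E = {}" "(J 0 \<union> J 1 \<union> J 2) \<inter> F = {}"
    by (simp_all add: Int_Un_distrib2)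
  moreover have "E \<inter> F = {}"
    using tri_parts_disjoint(1)[OF nondeg_V] by (auto simp: E_def F_def)
  then have "(J 0 \<union> J 1 \<union> J 2 \<union> E) \<inter> F = {}" using calculation(5) by blast
  ultimately have "sum ?m {t\<in>I. P \<in> tri (V t)} = sum ?m (J 0) + sum ?m (J 1) + sum ?m (J 2) + sum ?m E + sum ?m F"
    using fin by (simp add: sum.union_disjoint)
  moreover have "sum ?m (J i) = real (card (J i)) * ang i" if "i < 3" for i
  proof -
    have "sum ?m (J i) = (\<Sum>t\<in>J i. ang i)"
    proof (rule sum.cong)
      fix t assume "t \<in> J i"
      then show "?m t = ang i"
        using angle_measure_vertex(1)[OF nondeg_V that, of t] ang_V[OF _ that, of t] by (auto simp: J_def)
    qed simp
    then show ?thesis by simp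
  qed
  moreover have "sum ?m E = real (card E) * pi"
    using angle_measure_edge[OF nondeg_V] by (simp add: E_def)
  moreover have "sum ?m F = real (card F) * (2 * pi)"
    using angle_measure_int by (simp add: F_def)
  ultimately show ?thesis
    using sum_cones[OF assms] by (simp add: count_def through_def J_def E_def F_def)
qed

lemma ang_bounds: "I \<noteq> {} \<Longrightarrow> i < 3 \<Longrightarrow> 0 < ang i \<and> ang i < pi"
  using angle_measure_vertex(2,3)[OF nondeg_V, of _ i] ang_V by fastforce

lemma len_pos: "I \<noteq> {} \<Longrightarrow> i < 3 \<Longrightarrow> j < 3 \<Longrightarrow> i \<noteq> j \<Longrightarrow> 0 < len (i + j)"
  using len_V[of _ i j] tri_parts_disjoint(4)[OF nondeg_V, of _ i j] by (metis ex_in_conv zero_less_dist_iff)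

lemma I_nonempty: "I \<noteq> {}"
  using cover tri_vertex_mem[of 0 W] by auto

end

section \<open>Sides of tiles along a line\<close>

text \<open>The sign \<open>\<sigma>\<close> tells on which side of the directed line \<open>u\<close> the triangle lies.\<close>
definition tri_side :: "(nat \<Rightarrow> point) \<Rightarrow> nat \<Rightarrow> nat \<Rightarrow> point \<Rightarrow> real \<Rightarrow> real \<Rightarrow> bool" where
  "tri_side v i j u \<sigma> L \<longleftrightarrow> i < 3 \<and> j < 3 \<and> i \<noteq> j \<and> norm u = 1 \<and> 0 < L \<and> v j = v i + L *\<^sub>R u
     \<and> sgn (cross2 u (v (3 - i - j) - v i)) = \<sigma>"

lemma tri_sideD:
  assumes "tri_side v i j u \<sigma> L"
  shows "i < 3" "j < 3" "i \<noteq> j" "norm u = 1" "0 < L" "v j = v i + L *\<^sub>R u" "v j - v i = L *\<^sub>R u"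
    "sgn (cross2 u (v (3 - i - j) - v i)) = \<sigma>"
  using assms by (auto simp: tri_side_def)

lemma tri_side_ex:
  assumes "nondeg v" "i < 3" "j < 3" "i \<noteq> j"
  shows "\<exists>u \<sigma>. tri_side v i j u \<sigma> (dist (v i) (v j)) \<and> \<sigma> \<in> {1, -1}"
proof -
  define L where "L = dist (v i) (v j)"
  have L: "0 < L" using tri_parts_disjoint(4)[OF assms(1,2,3)] assms(4) by (auto simp: L_def)
  define u where "u = (1 / L) *\<^sub>R (v j - v i)"
  have u: "v j - v i = L *\<^sub>R u" using L by (simp add: u_def)
  have "norm u = 1" using L by (simp add: u_def L_def dist_norm norm_minus_commute)
  moreover have "cross2 u (v (3 - i - j) - v i) \<noteq> 0"
    using nondeg_cross2[OF assms refl] u by auto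
  moreover have "v j = v i + L *\<^sub>R u" using u by (simp add: algebra_simps)
  ultimately have "tri_side v i j u (sgn (cross2 u (v (3 - i - j) - v i))) L"
      "sgn (cross2 u (v (3 - i - j) - v i)) \<in> {1, -1}"
    using assms L by (auto simp: tri_side_def sgn_if)
  then show ?thesis by (auto simp: L_def)
qed

lemma tri_side_rev:
  assumes "tri_side v i j u \<sigma> L"
  shows "tri_side v j i (- u) (- \<sigma>) L"
proof -
  note d = tri_sideD[OF assms]
  have "cross2 (- u) (v (3 - j - i) - v j) = - cross2 u (v (3 - i - j) - v i)"
    by (simp add: d(6) cross2_diff cross2_add diff_right_commute add.commute diff_diff_left)
  then have "sgn (cross2 (- u) (v (3 - j - i) - v j)) = - \<sigma>"
    using d(8) by (simp add: sgn_minus)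
  moreover have "v i = v j + L *\<^sub>R (- u)"
    using d(6) by simp
  ultimately show ?thesis
    using d(1-5) by (simp add: tri_side_def)
qed

lemma tri_side_bary_lin:
  assumes "nondeg v" "tri_side v i j u \<sigma> L"
  shows "bary_lin v (3 - i - j) u = 0" "bary_lin v j u = 1 / L" "bary_lin v i u = - (1 / L)"
    "0 < \<sigma> * bary_lin v (3 - i - j) (perp u)" "\<sigma> \<in> {1, -1}"
proof -
  note d = tri_sideD[OF assms(2)]
  define k where "k = 3 - i - j"
  have k: "k < 3" "k \<noteq> i" "k \<noteq> j" using third_less[OF d(1-3)] by (auto simp: k_def)
  have "u = (1 / L) *\<^sub>R (v j - v i)" using d(5,7) by simp
  then have *: "bary_lin v l u = bary_lin v l (v j - v i) / L" for l
    by (metis bary_lin_scale divide_inverse inverse_eq_divide mult.commute)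
  show "bary_lin v (3 - i - j) u = 0" "bary_lin v j u = 1 / L" "bary_lin v i u = - (1 / L)"
    using bary_lin_edge[OF assms(1) d(1,2)] d(1-3) k by (auto simp: * k_def)
  have "cross2 (v j - v i) (v k - v i) \<noteq> 0"
    by (rule nondeg_cross2[OF assms(1) d(1-3) k_def])
  then have nz: "cross2 u (v k - v i) \<noteq> 0" by (auto simp: d(7))
  have "bary_lin v k (perp u) = cross2 (v j - v i) (perp u) / cross2 (v j - v i) (v k - v i)"
    by (rule bary_lin_eq[OF d(1-3) k_def])
  also have "\<dots> = 1 / cross2 u (v k - v i)"
    unfolding d(7) using d(4,5) by (simp add: cross2_perp)
  finally have "bary_lin v k (perp u) = 1 / cross2 u (v k - v i)" .
  moreover have "\<sigma> = sgn (cross2 u (v k - v i))" using d(8) by (simp add: k_def)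
  ultimately show "0 < \<sigma> * bary_lin v (3 - i - j) (perp u)" "\<sigma> \<in> {1, -1}"
    using nz by (auto simp: k_def sgn_if zero_less_mult_iff)
qed

lemma tri_side_bary:
  assumes "nondeg v" "tri_side v i j u \<sigma> L"
  shows "bary v (3 - i - j) (v i + m *\<^sub>R u) = 0" "bary v j (v i + m *\<^sub>R u) = m / L"
    "bary v i (v i + m *\<^sub>R u) = 1 - m / L"
proof -
  note d = tri_sideD[OF assms(2)]
  have k: "3 - i - j < 3" "3 - i - j \<noteq> i" "3 - i - j \<noteq> j" using third_less[OF d(1-3)] by auto
  show "bary v (3 - i - j) (v i + m *\<^sub>R u) = 0" "bary v j (v i + m *\<^sub>R u) = m / L"
    "bary v i (v i + m *\<^sub>R u) = 1 - m / L"
    using bary_vertex[OF assms(1) d(1)] k d(1-3) tri_side_bary_lin[OF assms] by (auto simp: bary_add)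
qed

lemma tri_side_mem:
  assumes "nondeg v" "tri_side v i j u \<sigma> L" "0 \<le> m" "m \<le> L"
  shows "v i + m *\<^sub>R u \<in> tri v"
  unfolding tri_iff[OF assms(1)]
proof (intro allI impI)
  fix k :: nat assume k: "k < 3"
  then show "0 \<le> bary v k (v i + m *\<^sub>R u)"
    using tri_side_bary[OF assms(1,2), of m] third_cases[OF tri_sideD(1-3)[OF assms(2)] k] assms(3,4)
      tri_sideD(5)[OF assms(2)] by auto
qed

lemma tri_side_edge:
  assumes "nondeg v" "tri_side v i j u \<sigma> L" "0 < m" "m < L"
  shows "v i + m *\<^sub>R u \<in> tri_edge v (3 - i - j)"
  unfolding tri_edge_def
proof (intro CollectI conjI allI impI)
  fix k :: nat assume k: "k < 3" "k \<noteq> 3 - i - j"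
  then show "0 < bary v k (v i + m *\<^sub>R u)"
    using tri_side_bary[OF assms(1,2), of m] third_cases[OF tri_sideD(1-3)[OF assms(2)] k(1)] assms(3,4) k(2)
      tri_sideD(5)[OF assms(2)] by auto
qed (use tri_side_bary[OF assms(1,2)] in auto)

lemma eventually_less_3:
  assumes "\<And>k::nat. k < 3 \<Longrightarrow> eventually (Q k) F"
  shows "eventually (\<lambda>x. \<forall>k<3. Q k x) F"
  unfolding less_3_iff using assms[of 0] assms[of 1] assms[of 2] by (auto intro: eventually_conj)

lemma eventually_small_step:
  fixes a b :: real
  assumes "0 \<le> a" "a = 0 \<longrightarrow> 0 < b"
  shows "\<forall>\<^sub>F r in at_right 0. 0 < a + r * b"
  using small_step_pos[OF assms] by (auto simp: eventually_at_right_field)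

lemma eventually_cone_open:
  assumes "u \<in> cone_open v x"
  shows "\<forall>\<^sub>F r in at_right 0. u + r *\<^sub>R w \<in> cone_open v x"
proof -
  have "\<forall>\<^sub>F r in at_right 0. bary v k x = 0 \<longrightarrow> 0 < bary_lin v k u + r * bary_lin v k w" if "k < 3" for k
  proof (cases "bary v k x = 0")
    case True
    then have "0 < bary_lin v k u" using assms that by (simp add: cone_open_def)
    then show ?thesis using eventually_small_step[of "bary_lin v k u" "bary_lin v k w"] by simp
  qed simp
  from eventually_less_3[OF this] show ?thesis
    by (simp add: cone_open_def bary_lin_add)
qed

text \<open>Tilting \<open>u\<close> slightly towards the triangle enters it from every point of the
  side except the far end. There the coordinate of \<open>i\<close> vanishes and decreases along
  \<open>u\<close>, which is why \<open>m < L\<close> is required.\<close>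

lemma eventually_side_cone:
  assumes "nondeg v" "tri_side v i j u \<sigma> L" "0 \<le> m" "m < L"
  shows "\<forall>\<^sub>F r in at_right 0. u + (r * \<sigma>) *\<^sub>R perp u \<in> cone_open v (v i + m *\<^sub>R u)"
proof -
  let ?x = "v i + m *\<^sub>R u"
  note d = tri_sideD[OF assms(2)]
  have "\<forall>\<^sub>F r in at_right 0. bary v k ?x = 0 \<longrightarrow> 0 < bary_lin v k u + r * (\<sigma> * bary_lin v k (perp u))"
    if k: "k < 3" for k
  proof (cases "k = i")
    case True
    then have "bary v k ?x \<noteq> 0"
      using tri_side_bary(3)[OF assms(1,2), of m] assms(4) d(5) by auto
    then show ?thesis by simp
  next
    case False
    then have "0 \<le> bary_lin v k u" "bary_lin v k u = 0 \<longrightarrow> 0 < \<sigma> * bary_lin v k (perp u)"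
      using tri_side_bary_lin[OF assms(1,2)] third_cases[OF d(1-3) k] d(5) by auto
    from eventually_small_step[OF this] show ?thesis by (rule eventually_mono) simp
  qed
  from eventually_less_3[OF this] show ?thesis
    by (simp add: cone_open_def bary_lin_add mult.assoc)
qed

lemma side_not_in_cone:
  assumes "nondeg v" "tri_side v i j u \<sigma> L"
  shows "u \<notin> cone_open v (v i + m *\<^sub>R u)" "0 < r \<Longrightarrow> u - (r * \<sigma>) *\<^sub>R perp u \<notin> cone_closed v (v i + m *\<^sub>R u)"
proof -
  note d = tri_sideD[OF assms(2)]
  have k: "3 - i - j < 3" using third_less[OF d(1-3)] by auto
  show "u \<notin> cone_open v (v i + m *\<^sub>R u)"
    using k tri_side_bary(1)[OF assms, of m] tri_side_bary_lin(1)[OF assms] by (force simp: cone_open_def)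
  assume "0 < r"
  then have "0 < r * (\<sigma> * bary_lin v (3 - i - j) (perp u))"
    using tri_side_bary_lin(4)[OF assms] by (rule mult_pos_pos)
  then have "bary_lin v (3 - i - j) (u - (r * \<sigma>) *\<^sub>R perp u) < 0"
    using tri_side_bary_lin(1)[OF assms] by (simp add: bary_lin_diff mult.assoc)
  then show "u - (r * \<sigma>) *\<^sub>R perp u \<notin> cone_closed v (v i + m *\<^sub>R u)"
    using k tri_side_bary(1)[OF assms, of m] by (force simp: cone_closed_def)
qed

text \<open>Along \<open>u\<close> the coordinate of the end vertex is the only increasing one and
  that of the start vertex the only decreasing one, so \<open>u\<close> determines both.\<close>

lemma tri_side_unique:
  assumes "nondeg v" "tri_side v i j u \<sigma> L" "tri_side v i' j' u \<sigma>' L'"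
  shows "i = i' \<and> j = j'"
proof -
  note d = tri_sideD[OF assms(2)] and d' = tri_sideD[OF assms(3)]
  note b = tri_side_bary_lin[OF assms(1,2)] and b' = tri_side_bary_lin[OF assms(1,3)]
  have k: "3 - i - j < 3" "3 - i - j \<noteq> i" "3 - i - j \<noteq> j" using third_less[OF d(1-3)] by auto
  have "0 < bary_lin v l u \<longleftrightarrow> l = j" if "l < 3" for l
    using b third_cases[OF d(1-3) that] d(3,5) k by auto
  moreover have "0 < bary_lin v j' u" using b' d'(5) by simp
  ultimately have "j' = j" using d' by blast
  moreover have "bary_lin v l u < 0 \<longleftrightarrow> l = i" if "l < 3" for l
    using b third_cases[OF d(1-3) that] d(3,5) k by auto
  moreover have "bary_lin v i' u < 0" using b' d'(5) by simp
  ultimately show ?thesis using d' by blast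
qed

text \<open>As \<open>u\<close> is on the boundary of the cone at \<open>x\<close>, some coordinate
  vanishing at \<open>x\<close> is constant along \<open>u\<close>, so a side through
  \<open>x\<close> has this direction. The tilted direction in the hypothesis decides on which side
  of the line the triangle lies.\<close>

lemma side_through:
  assumes "nondeg v" "x \<in> tri v" "norm u = 1" "u \<in> cone_closed v x" "u \<notin> cone_open v x"
    and "0 < r" "u + (r * \<sigma>) *\<^sub>R perp u \<in> cone_closed v x" "\<sigma> \<in> {1, -1}"
  shows "\<exists>i j m L. tri_side v i j u \<sigma> L \<and> x = v i + m *\<^sub>R u \<and> 0 \<le> m \<and> m < L"
proof -
  obtain k where k: "k < 3" "bary v k x = 0" "bary_lin v k u = 0"
    using assms(4,5) by (force simp: cone_closed_def cone_open_def)
  have ex: "\<exists>i j. i < 3 \<and> j < 3 \<and> i \<noteq> j \<and> k = 3 - i - j \<and> 0 < bary_lin v j u"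
  proof -
    obtain i j where ij: "i < 3" "j < 3" "i \<noteq> j" "k = 3 - i - j" "k = 3 - j - i" "bary_lin v i u + bary_lin v j u = 0"
      using that[of 1 2] that[of 0 2] that[of 0 1] less_3_cases[OF k(1)] sum_bary_lin[OF assms(1), of u] k(3)
      by force
    have "bary_lin v j u \<noteq> 0"
      using bary_lin_expand[OF assms(1) ij(1-4), of u] k(3) assms(3) by auto
    then have "0 < bary_lin v j u \<or> 0 < bary_lin v i u" using ij(6) by linarith
    then show ?thesis using ij by metis
  qed
  then obtain i j where ij: "i < 3" "j < 3" "i \<noteq> j" "k = 3 - i - j" and c: "0 < bary_lin v j u" by blast
  \<comment> \<open>The rate at which the coordinate of \<open>j\<close> grows along
    \<open>u\<close>. It rises from 0 to 1 over the whole side, so the side has length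
    \<open>1 / c\<close>.\<close>
  define c where "c = bary_lin v j u"
  define L where "L = 1 / c"
  have L: "0 < L" using c by (simp add: L_def c_def)
  have u: "u = c *\<^sub>R (v j - v i)"
    using bary_lin_expand[OF assms(1) ij, of u] k(3) by (simp add: c_def)
  have vj: "v j - v i = L *\<^sub>R u"
    by (subst u) (use c in \<open>simp add: L_def c_def\<close>)
  have nz: "cross2 (v j - v i) (v k - v i) \<noteq> 0" by (rule nondeg_cross2[OF assms(1) ij])
  then have nz': "cross2 u (v k - v i) \<noteq> 0" by (auto simp: vj)
  have "0 \<le> r * (\<sigma> * bary_lin v k (perp u))"
    using assms(7) k by (auto simp: cone_closed_def bary_lin_add mult.assoc)
  then have "0 \<le> \<sigma> * bary_lin v k (perp u)" using assms(6) by (simp add: zero_le_mult_iff)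
  moreover have "bary_lin v k (perp u) = 1 / cross2 u (v k - v i)"
    using bary_lin_eq[OF ij, of v "perp u"] L assms(3) unfolding vj by (simp add: cross2_perp)
  ultimately have "sgn (cross2 u (v k - v i)) = \<sigma>"
    using nz' assms(8) by (auto simp: sgn_if zero_le_mult_iff)
  then have side: "tri_side v i j u \<sigma> L"
    using ij L assms(3) vj unfolding tri_side_def by (auto simp: algebra_simps)
  have x: "x = v i + (bary v j x * L) *\<^sub>R u"
    using bary_expand[OF assms(1) ij, of x] k(2) by (simp add: vj)
  have "bary v i x = 1 - bary v j x"
    using tri_side_bary[OF assms(1) side, of "bary v j x * L"] L x by simp
  moreover have "0 \<le> bary v i x" "0 \<le> bary v j x"
    using assms(2) ij by (auto simp: tri_iff[OF assms(1)])
  moreover have "bary v i x \<noteq> 0"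
  proof
    assume "bary v i x = 0"
    then have "0 \<le> bary_lin v i u" using assms(4) ij by (auto simp: cone_closed_def)
    then show False using tri_side_bary_lin(3)[OF assms(1) side] L by simp
  qed
  ultimately have "0 \<le> bary v j x * L" "bary v j x * L < L" using L by auto
  then show ?thesis using side x by blast
qed

section \<open>Chains of tile sides along a directed line\<close>

context tri_tiling
begin

definition side :: "'t \<Rightarrow> nat \<Rightarrow> nat \<Rightarrow> point \<Rightarrow> real \<Rightarrow> bool" where
  "side t i j u \<sigma> \<longleftrightarrow> t \<in> I \<and> tri_side (V t) i j u \<sigma> (len (i + j))"

lemma sideD:
  assumes "side t i j u \<sigma>"
  shows "t \<in> I" "nondeg (V t)" "tri_side (V t) i j u \<sigma> (len (i + j))" "i < 3" "j < 3" "i \<noteq> j"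
    "norm u = 1" "0 < len (i + j)" "V t j = V t i + len (i + j) *\<^sub>R u" "\<sigma> \<in> {1, -1}"
proof -
  show s: "t \<in> I" "nondeg (V t)" "tri_side (V t) i j u \<sigma> (len (i + j))"
    using assms nondeg_V by (auto simp: side_def)
  show "\<sigma> \<in> {1, -1}" by (rule tri_side_bary_lin(5)[OF s(2,3)])
  show "i < 3" "j < 3" "i \<noteq> j" "norm u = 1" "0 < len (i + j)" "V t j = V t i + len (i + j) *\<^sub>R u"
    using tri_sideD(1-6)[OF s(3)] by auto
qed

lemma side_len:
  assumes "t \<in> I" "tri_side (V t) i j u \<sigma> L"
  shows "L = len (i + j)" "side t i j u \<sigma>"
proof -
  note d = tri_sideD[OF assms(2)]
  have "len (i + j) = dist (V t j) (V t i)"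
    using len_V[OF assms(1) d(1-3)] by (simp add: dist_commute)
  also have "\<dots> = L" unfolding dist_norm d(7) using d(4,5) by simp
  finally show L: "L = len (i + j)" ..
  then show "side t i j u \<sigma>" using assms by (simp add: side_def)
qed

lemma side_ex:
  assumes "t \<in> I" "i < 3" "j < 3" "i \<noteq> j"
  shows "\<exists>u \<sigma>. side t i j u \<sigma>"
  using tri_side_ex[OF nondeg_V[OF assms(1)] assms(2-4)] side_len(2)[OF assms(1)] by blast

lemma side_rev: "side t i j u \<sigma> \<Longrightarrow> side t j i (- u) (- \<sigma>)"
  using tri_side_rev by (auto simp: side_def add.commute)

lemma side_mem:
  assumes "side t i j u \<sigma>" "0 \<le> m" "m \<le> len (i + j)"
  shows "V t i + m *\<^sub>R u \<in> tri (V t)" "V t i + m *\<^sub>R u \<in> tri W"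
  using tri_side_mem[OF sideD(2,3)[OF assms(1)] assms(2,3)] tile_subset[OF sideD(1)[OF assms(1)]] by auto

text \<open>The tilted directions are covered for all small \<open>r\<close>. By finiteness a single
  tile serves arbitrarily small \<open>r\<close>, so \<open>u\<close> itself lies in its closed
  cone. As \<open>u\<close> lies in no open cone, it runs along a side of that tile.\<close>

lemma tile_at_small_angle:
  assumes "x \<in> tri W" "norm u = 1" "\<sigma> \<in> {1, -1}"
    and ev: "\<forall>\<^sub>F r in at_right 0. u + (r * \<sigma>) *\<^sub>R perp u \<in> cone_closed W x"
    and nin: "\<And>t. t \<in> I \<Longrightarrow> x \<in> tri (V t) \<Longrightarrow> u \<notin> cone_open (V t) x"
  shows "\<exists>t i j m. side t i j u \<sigma> \<and> x = V t i + m *\<^sub>R u \<and> 0 \<le> m \<and> m < len (i + j)"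
proof -
  let ?d = "\<lambda>r. u + (r * \<sigma>) *\<^sub>R perp u"
  have "\<forall>\<^sub>F r in at_right 0. \<exists>t\<in>I. x \<in> tri (V t) \<and> ?d r \<in> cone_closed (V t) x"
    using ev by (rule eventually_mono) (rule cone_closed_covered[OF assms(1)])
  then have fr0: "\<exists>\<^sub>F r in at_right 0. \<exists>t\<in>I. x \<in> tri (V t) \<and> ?d r \<in> cone_closed (V t) x"
    by (intro eventually_frequently) auto
  then obtain t where t: "t \<in> I" and fr: "\<exists>\<^sub>F r in at_right 0. x \<in> tri (V t) \<and> ?d r \<in> cone_closed (V t) x"
    using frequently_bex_finite[OF finite_I fr0] by blast
  have "\<forall>\<^sub>F r::real in at_right 0. 0 < r" by (rule eventually_at_right_less)
  then have "\<exists>\<^sub>F r in at_right 0. (x \<in> tri (V t) \<and> ?d r \<in> cone_closed (V t) x) \<and> 0 < r"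
    by (rule frequently_eventually_frequently[OF fr])
  then obtain r where r: "x \<in> tri (V t)" "?d r \<in> cone_closed (V t) x" "0 < r"
    using frequently_ex by blast
  have "u \<in> cone_closed (V t) x"
    unfolding cone_closed_def
  proof (intro CollectI allI impI)
    fix k :: nat assume k: "k < 3" "bary (V t) k x = 0"
    show "0 \<le> bary_lin (V t) k u"
    proof (rule ccontr)
      assume "\<not> 0 \<le> bary_lin (V t) k u"
      then have "\<forall>\<^sub>F r in at_right 0. 0 < - bary_lin (V t) k u + r * (- (\<sigma> * bary_lin (V t) k (perp u)))"
        by (intro eventually_small_step) auto
      then have "\<forall>\<^sub>F r in at_right 0. \<not> (x \<in> tri (V t) \<and> ?d r \<in> cone_closed (V t) x)"
        by (rule eventually_mono) (use k in \<open>auto simp: cone_closed_def bary_lin_add mult.assoc\<close>)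
      then show False using fr by (simp add: frequently_def)
    qed
  qed
  from side_through[OF nondeg_V[OF t] r(1) assms(2) this nin[OF t r(1)] r(3,2) assms(3)]
  show ?thesis using side_len[OF t] by metis
qed

text \<open>If \<open>u\<close> were in the open cone of some tile, that tile would overlap
  \<open>t\<close> slightly off the line. The assumption on the cone of \<open>W\<close> ensures
  that \<open>W\<close> extends beyond the line.\<close>

lemma side_opposite:
  assumes "side t i j u \<sigma>" "0 \<le> m" "m < len (i + j)" "u \<in> cone_open W (V t i + m *\<^sub>R u)"
  shows "\<exists>t' i' j' m'. side t' i' j' u (- \<sigma>) \<and> V t i + m *\<^sub>R u = V t' i' + m' *\<^sub>R u \<and> 0 \<le> m' \<and> m' < len (i' + j')"
proof (rule tile_at_small_angle)
  note d = sideD[OF assms(1)]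
  let ?x = "V t i + m *\<^sub>R u"
  show "?x \<in> tri W" using side_mem[OF assms(1,2)] assms(3) by simp
  show "norm u = 1" "- \<sigma> \<in> {1, -1}" using d by auto
  have "\<forall>\<^sub>F r in at_right 0. u + r *\<^sub>R (- \<sigma> *\<^sub>R perp u) \<in> cone_open W ?x"
    by (rule eventually_cone_open[OF assms(4)])
  then show "\<forall>\<^sub>F r in at_right 0. u + (r * - \<sigma>) *\<^sub>R perp u \<in> cone_closed W ?x"
    by (rule eventually_mono) (use cone_open_subset_closed in auto)
  fix t' assume t': "t' \<in> I" "?x \<in> tri (V t')"
  show "u \<notin> cone_open (V t') ?x"
  proof
    assume u: "u \<in> cone_open (V t') ?x"
    then have "t \<noteq> t'" using side_not_in_cone(1)[OF d(2,3)] by auto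
    have "\<forall>\<^sub>F r in at_right 0. u + r *\<^sub>R (\<sigma> *\<^sub>R perp u) \<in> cone_open (V t') ?x"
      by (rule eventually_cone_open[OF u])
    moreover have "\<forall>\<^sub>F r in at_right 0. u + (r * \<sigma>) *\<^sub>R perp u \<in> cone_open (V t) ?x"
      by (rule eventually_side_cone[OF d(2,3) assms(2,3)])
    ultimately have "\<forall>\<^sub>F r in at_right 0. u + (r * \<sigma>) *\<^sub>R perp u \<in> cone_open (V t) ?x \<inter> cone_open (V t') ?x"
      by eventually_elim auto
    then obtain r where "u + (r * \<sigma>) *\<^sub>R perp u \<in> cone_open (V t) ?x \<inter> cone_open (V t') ?x"
      using eventually_happens by force
    then show False
      using cones_disjoint[OF d(1) t'(1) \<open>t \<noteq> t'\<close> side_mem(1)[OF assms(1,2)] t'(2)] assms(3)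
        cone_open_subset_closed[of "V t'" ?x] by auto
  qed
qed

text \<open>No open cone of a tile contains \<open>u\<close> here, because it would then also
  contain directions that leave \<open>W\<close>.\<close>

lemma boundary_side:
  assumes "tri_side W i j u \<sigma> L" "0 \<le> y" "y < L"
  shows "\<exists>t' i' j' m'. side t' i' j' u \<sigma> \<and> W i + y *\<^sub>R u = V t' i' + m' *\<^sub>R u \<and> 0 \<le> m' \<and> m' < len (i' + j')"
proof (rule tile_at_small_angle)
  let ?x = "W i + y *\<^sub>R u"
  show "?x \<in> tri W" using tri_side_mem[OF nondeg_W assms(1,2)] assms(3) by simp
  show "norm u = 1" "\<sigma> \<in> {1, -1}" using tri_sideD(4)[OF assms(1)] tri_side_bary_lin(5)[OF nondeg_W assms(1)] .
  show "\<forall>\<^sub>F r in at_right 0. u + (r * \<sigma>) *\<^sub>R perp u \<in> cone_closed W ?x"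
    using eventually_side_cone[OF nondeg_W assms] cone_open_subset_closed[of W ?x]
    by (auto elim: eventually_mono)
  fix t' assume t': "t' \<in> I" "?x \<in> tri (V t')"
  show "u \<notin> cone_open (V t') ?x"
  proof
    assume "u \<in> cone_open (V t') ?x"
    then have "\<forall>\<^sub>F r in at_right 0. u + r *\<^sub>R (- \<sigma> *\<^sub>R perp u) \<in> cone_open (V t') ?x"
      by (rule eventually_cone_open)
    then have "\<forall>\<^sub>F r in at_right 0. 0 < r \<and> u + r *\<^sub>R (- \<sigma> *\<^sub>R perp u) \<in> cone_open (V t') ?x"
      using eventually_at_right_less[of "0::real"] by eventually_elim auto
    then obtain r where r: "0 < r" "u - (r * \<sigma>) *\<^sub>R perp u \<in> cone_open (V t') ?x"
      using eventually_happens by force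
    then have "u - (r * \<sigma>) *\<^sub>R perp u \<in> cone_closed W ?x"
      using cone_open_subset_closed[of "V t'" ?x] cone_closed_mono[OF t'] by blast
    then show False using side_not_in_cone(2)[OF nondeg_W assms(1) r(1)] by blast
  qed
qed

text \<open>Slightly tilted directions enter the open cones of both tiles, so distinct tiles would
  overlap. The half-open ranges of \<open>m\<close> and \<open>m'\<close> assign the junction of two
  consecutive sides to the later one.\<close>

lemma side_unique:
  assumes "side t i j u \<sigma>" "side t' i' j' u \<sigma>" "V t i + m *\<^sub>R u = V t' i' + m' *\<^sub>R u"
    "0 \<le> m" "m < len (i + j)" "0 \<le> m'" "m' < len (i' + j')"
  shows "t = t' \<and> i = i' \<and> j = j' \<and> m = m'"
proof -
  note d = sideD[OF assms(1)] and d' = sideD[OF assms(2)]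
  let ?x = "V t i + m *\<^sub>R u"
  have "t = t'"
  proof (rule ccontr)
    assume ne: "t \<noteq> t'"
    have "\<forall>\<^sub>F r in at_right 0. u + (r * \<sigma>) *\<^sub>R perp u \<in> cone_open (V t) ?x"
      by (rule eventually_side_cone[OF d(2,3) assms(4,5)])
    moreover have "\<forall>\<^sub>F r in at_right 0. u + (r * \<sigma>) *\<^sub>R perp u \<in> cone_open (V t') ?x"
      unfolding assms(3) by (rule eventually_side_cone[OF d'(2,3) assms(6,7)])
    ultimately have "\<forall>\<^sub>F r in at_right 0. u + (r * \<sigma>) *\<^sub>R perp u \<in> cone_open (V t) ?x \<inter> cone_open (V t') ?x"
      by eventually_elim auto
    then obtain r where "u + (r * \<sigma>) *\<^sub>R perp u \<in> cone_open (V t) ?x \<inter> cone_open (V t') ?x"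
      using eventually_happens by force
    then show False
      using cones_disjoint[OF d(1) d'(1) ne side_mem(1)[OF assms(1,4)] ] assms(5)
        side_mem(1)[OF assms(2,6)] assms(3,7) cone_open_subset_closed[of "V t'" ?x] by auto
  qed
  moreover from this have "i = i' \<and> j = j'"
    using tri_side_unique[OF d(2,3)] d'(3) by blast
  moreover have "u \<noteq> 0" using d(7) by auto
  ultimately show ?thesis using assms(3) by auto
qed

lemma edge_type_cases:
  fixes i j :: nat
  shows "i < 3 \<Longrightarrow> j < 3 \<Longrightarrow> i \<noteq> j \<Longrightarrow> i + j \<in> {1, 2, 3}"
  by auto

lemma len_type_pos: "k \<in> {1, 2, 3} \<Longrightarrow> 0 < len k"
proof -
  have "0 < len (0 + 1)" "0 < len (0 + 2)" "0 < len (1 + 2)"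
    by (rule len_pos[OF I_nonempty]; simp)+
  moreover have "(0::nat) + 1 = 1" "(0::nat) + 2 = 2" "(1::nat) + 2 = 3" by simp_all
  ultimately have "0 < len 1" "0 < len 2" "0 < len 3" by (simp_all only:)
  then show "k \<in> {1, 2, 3} \<Longrightarrow> 0 < len k" by blast
qed

lemma min_len: "\<exists>\<epsilon>>0. \<forall>i<3. \<forall>j<3. i \<noteq> j \<longrightarrow> \<epsilon> \<le> len (i + j)"
proof (intro exI[of _ "Min (len ` {1, 2, 3})"] conjI allI impI)
  show "0 < Min (len ` {1, 2, 3})"
    using len_type_pos by (simp add: Min_gr_iff)
  show "Min (len ` {1, 2, 3}) \<le> len (i + j)" if "i < 3" "j < 3" "i \<noteq> j" for i j
    by (rule Min_le) (use edge_type_cases[OF that] in auto)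
qed

lemma side_consecutive:
  assumes "side t i j u \<sigma>" "side t' i' j' u \<sigma>" "V t j = V t' i' + m' *\<^sub>R u" "0 \<le> m'" "m' < len (i' + j')"
  shows "m' = 0"
proof (rule ccontr)
  assume "m' \<noteq> 0"
  then have m': "0 < m'" using assms(4) by simp
  note d = sideD[OF assms(1)]
  \<comment> \<open>Going back by \<delta> from the end of the first side reaches a point of both
    sides, to which \<open>side_unique\<close> applies.\<close>
  define \<delta> where "\<delta> = min m' (len (i + j)) "
  have dl: "0 < \<delta>" "\<delta> \<le> m'" "\<delta> \<le> len (i + j)" using m' d(8) by (auto simp: \<delta>_def)
  have "V t i + (len (i + j) - \<delta>) *\<^sub>R u = V t' i' + (m' - \<delta>) *\<^sub>R u"
    using assms(3) d(9) by (simp add: algebra_simps)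
  from side_unique[OF assms(1,2) this] dl assms(5)
  have "i = i' \<and> j = j' \<and> len (i + j) - \<delta> = m' - \<delta>" by auto
  then show False using assms(5) by auto
qed

text \<open>A walk from side to side. By \<open>side_consecutive\<close> each side starts where the
  previous one ends, and the minimal side length bounds the number of steps. As no side crosses
  \<open>L\<close>, the last one ends exactly there. \<open>Q\<close> is an invariant carried
  along.\<close>

lemma side_chain:
  assumes cov: "\<And>y. 0 \<le> y \<Longrightarrow> y < L \<Longrightarrow>
      \<exists>t i j m. side t i j u \<sigma> \<and> P + y *\<^sub>R u = V t i + m *\<^sub>R u \<and> 0 \<le> m \<and> m < len (i + j)"
    and nocross: "\<And>t i j y. side t i j u \<sigma> \<Longrightarrow> V t i = P + y *\<^sub>R u \<Longrightarrow> 0 \<le> y \<Longrightarrow> y < L \<Longrightarrow> y + len (i + j) \<le> L"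
    and step: "\<And>t i j t' i' j' y. side t i j u \<sigma> \<Longrightarrow> V t i = P + y *\<^sub>R u \<Longrightarrow> 0 \<le> y \<Longrightarrow>
      y + len (i + j) < L \<Longrightarrow> Q t i j y \<Longrightarrow> side t' i' j' u \<sigma> \<Longrightarrow> V t' i' = P + (y + len (i + j)) *\<^sub>R u \<Longrightarrow>
      V t' i' = V t j \<Longrightarrow> Q t' i' j' (y + len (i + j))"
    and start: "side t0 i0 j0 u \<sigma>" "V t0 i0 = P" "Q t0 i0 j0 0" "0 < L"
  shows "\<exists>t i j y. side t i j u \<sigma> \<and> V t i = P + y *\<^sub>R u \<and> 0 \<le> y \<and> y + len (i + j) = L \<and> Q t i j y"
proof -
  obtain \<epsilon> where eps: "0 < \<epsilon>" "\<And>i j. i < 3 \<Longrightarrow> j < 3 \<Longrightarrow> i \<noteq> j \<Longrightarrow> \<epsilon> \<le> len (i + j)"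
    using min_len by blast
  have "\<exists>t i j y. side t i j u \<sigma> \<and> V t i = P + y *\<^sub>R u \<and> 0 \<le> y \<and> y + len (i + j) = L \<and> Q t i j y"
    if "L - y \<le> real n * \<epsilon>" "side t i j u \<sigma>" "V t i = P + y *\<^sub>R u" "0 \<le> y" "y < L" "Q t i j y" for n t i j y
    using that
  proof (induction n arbitrary: t i j y)
    case 0
    then show ?case by simp
  next
    case (Suc n)
    note d = sideD[OF Suc.prems(2)]
    let ?z = "y + len (i + j)"
    have le: "?z \<le> L" using nocross Suc.prems by blast
    show ?case
    proof (cases "?z = L")
      case True
      then show ?thesis using Suc.prems by blast
    next
      case False
      then have z: "0 \<le> ?z" "?z < L" using le Suc.prems(4) d(8) by auto
      obtain t' i' j' m where s': "side t' i' j' u \<sigma>" "P + ?z *\<^sub>R u = V t' i' + m *\<^sub>R u" "0 \<le> m" "m < len (i' + j')"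
        using cov[OF z] by blast
      have Vj: "V t j = P + ?z *\<^sub>R u"
        using d(9) Suc.prems(3) by (simp add: algebra_simps)
      then have "V t j = V t' i' + m *\<^sub>R u" using s'(2) by simp
      then have "m = 0" using side_consecutive[OF Suc.prems(2) s'(1)] s'(3,4) by blast
      then have V': "V t' i' = P + ?z *\<^sub>R u" using s'(2) by simp
      have "L - ?z \<le> real n * \<epsilon>"
        using Suc.prems(1) eps(2)[OF d(4-6)] by (simp add: algebra_simps)
      moreover have "Q t' i' j' ?z"
        using step[OF Suc.prems(2-4) z(2) Suc.prems(6) s'(1) V'] Vj V' by simp
      ultimately show ?thesis using Suc.IH[OF _ s'(1) V' z] by blast
    qed
  qed
  moreover obtain n :: nat where "L / \<epsilon> \<le> real n" using real_arch_simple by blast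
  then have "L - 0 \<le> real n * \<epsilon>" using eps(1) by (simp add: pos_divide_le_eq)
  ultimately show ?thesis
    using start by (metis add.right_neutral order_refl scaleR_zero_left)
qed

lemma side_chain_counts:
  assumes cov: "\<And>y. 0 \<le> y \<Longrightarrow> y < L \<Longrightarrow>
      \<exists>t i j m. side t i j u \<sigma> \<and> P + y *\<^sub>R u = V t i + m *\<^sub>R u \<and> 0 \<le> m \<and> m < len (i + j)"
    and nocross: "\<And>t i j y. side t i j u \<sigma> \<Longrightarrow> V t i = P + y *\<^sub>R u \<Longrightarrow> 0 \<le> y \<Longrightarrow> y < L \<Longrightarrow> y + len (i + j) \<le> L"
    and start: "side t0 i0 j0 u \<sigma>" "V t0 i0 = P" "0 < L"
  shows "\<exists>c :: nat \<Rightarrow> nat. L = (\<Sum>k\<in>{1,2,3}. real (c k) * len k) \<and> 0 < c (i0 + j0)"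
proof -
  define Q where "Q t i j y \<longleftrightarrow>
    (\<exists>c :: nat \<Rightarrow> nat. y + len (i + j) = (\<Sum>k\<in>{1,2,3}. real (c k) * len k) \<and> 0 < c (i0 + j0))"
    for t :: 't and i j y
  have add: "\<exists>c' :: nat \<Rightarrow> nat. (\<Sum>k\<in>{1,2,3}. real (c k) * len k) + len (i + j) = (\<Sum>k\<in>{1,2,3}. real (c' k) * len k)
      \<and> c' (i + j) = Suc (c (i + j)) \<and> (\<forall>k. c k \<le> c' k)" if "i < 3" "j < 3" "i \<noteq> j" for c :: "nat \<Rightarrow> nat" and i j
  proof -
    have "i + j = 1 \<or> i + j = 2 \<or> i + j = 3" using that by auto
    then show ?thesis
      by (intro exI[of _ "c (i + j := Suc (c (i + j)))"]) (auto simp: algebra_simps)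
  qed
  have "Q t0 i0 j0 0"
    unfolding Q_def using add[OF sideD(4-6)[OF start(1)], of "\<lambda>_. 0"] by fastforce
  have "\<exists>t i j y. side t i j u \<sigma> \<and> V t i = P + y *\<^sub>R u \<and> 0 \<le> y \<and> y + len (i + j) = L \<and> Q t i j y"
  proof (rule side_chain[where Q = Q, OF cov nocross])
    fix t i j t' i' j' y
    assume "Q t i j y" and s': "side t' i' j' u \<sigma>"
    then obtain c :: "nat \<Rightarrow> nat" where c: "y + len (i + j) = (\<Sum>k\<in>{1,2,3}. real (c k) * len k)" "0 < c (i0 + j0)"
      unfolding Q_def by blast
    obtain c' :: "nat \<Rightarrow> nat" where c': "(\<Sum>k\<in>{1,2,3}. real (c k) * len k) + len (i' + j')
        = (\<Sum>k\<in>{1,2,3}. real (c' k) * len k)" "\<forall>k. c k \<le> c' k"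
      using add[OF sideD(4-6)[OF s'], of c] by blast
    then have "0 < c' (i0 + j0)" using c(2) less_le_trans by blast
    then show "Q t' i' j' (y + len (i + j))"
      unfolding Q_def using c c' by metis
  qed (use start \<open>Q t0 i0 j0 0\<close> in auto)
  then show ?thesis by (auto simp: Q_def)
qed


lemma side_det: "side t i j u \<sigma> \<Longrightarrow> side t i j u' \<sigma>' \<Longrightarrow> u = u' \<and> \<sigma> = \<sigma>'"
proof -
  assume a: "side t i j u \<sigma>" "side t i j u' \<sigma>'"
  have "len (i + j) *\<^sub>R u = len (i + j) *\<^sub>R u'"
    using sideD(9)[OF a(1)] sideD(9)[OF a(2)] by (metis add_left_cancel)
  then have "u = u'" using sideD(8)[OF a(1)] by simp
  then show ?thesis
    using tri_sideD(8)[OF sideD(3)[OF a(1)]] tri_sideD(8)[OF sideD(3)[OF a(2)]] by simp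
qed

lemma side_base_mem: "side t i j u \<sigma> \<Longrightarrow> V t i \<in> tri W \<and> V t j \<in> tri W"
  using tri_vertex_mem[of i "V t"] tri_vertex_mem[of j "V t"] sideD(1,4,5) tile_subset by blast

lemma count_pos: "t \<in> I \<Longrightarrow> V t i = P \<Longrightarrow> 0 < count i P"
  unfolding count_def using finite_I by (auto simp: card_gt_0_iff)

lemma count_le_1: "count i P \<le> 1 \<Longrightarrow> t \<in> I \<Longrightarrow> t' \<in> I \<Longrightarrow> V t i = P \<Longrightarrow> V t' i = P \<Longrightarrow> t = t'"
  unfolding count_def using finite_I by (auto simp: card_le_Suc0_iff_eq)

text \<open>The point is that sides of type 3 alone do not suffice. The first would have to run from
  vertex 1 to vertex 2, since the corner meets no vertex 2. As two tiles never share a vertex 2 on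
  the open side, this direction persists, and the last side would put a vertex 2 at the final
  corner.\<close>

lemma W_side_counts:
  assumes W: "tri_side W i0 j0 u \<sigma> L"
    and corner: "count 2 (W i0) = 0" "count 2 (W j0) = 0"
    and open_side: "\<And>y. 0 < y \<Longrightarrow> y < L \<Longrightarrow> count 2 (W i0 + y *\<^sub>R u) \<le> 1"
  shows "\<exists>c :: nat \<Rightarrow> nat. L = real (c 1) * len 1 + real (c 2) * len 2 + real (c 3) * len 3 \<and> 0 < c 1 + c 2"
proof -
  note w = tri_sideD[OF W] and wb = tri_side_bary[OF nondeg_W W]
  \<comment> \<open>Either a side of type 1 or 2 has already occurred, or all sides so far have type
    3 and the latest runs from vertex 1 to vertex 2.\<close>
  define Q where "Q t i j y \<longleftrightarrow>
      (\<exists>c :: nat \<Rightarrow> nat. y + len (i + j) = real (c 1) * len 1 + real (c 2) * len 2 + real (c 3) * len 3 \<and> 0 < c 1 + c 2)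
      \<or> (i = 1 \<and> j = 2 \<and> (\<exists>n :: nat. y + len 3 = real n * len 3))" for t :: 't and i j y
  have type3: "i = 1 \<and> j = 2 \<or> i = 2 \<and> j = 1" if "i < 3" "j < 3" "i \<noteq> j" "i + j \<notin> {1, 2}" for i j :: nat
    using that by auto
  have new: "\<exists>c :: nat \<Rightarrow> nat. real n * len 3 + len (i + j) = real (c 1) * len 1 + real (c 2) * len 2 + real (c 3) * len 3 \<and> 0 < c 1 + c 2"
    if "i + j \<in> {1, 2}" for n i j :: nat
  proof -
    from that consider "i + j = 1" | "i + j = 2" by blast
    then show ?thesis
    proof cases
      case 1
      then show ?thesis unfolding 1 by (intro exI[of _ "\<lambda>k. if k = 3 then n else if k = 1 then 1 else 0"]) simp
    next
      case 2
      then show ?thesis unfolding 2 by (intro exI[of _ "\<lambda>k. if k = 3 then n else if k = 2 then 1 else 0"]) simp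
    qed
  qed
  obtain t0 i1 j1 m where s0: "side t0 i1 j1 u \<sigma>" "W i0 + 0 *\<^sub>R u = V t0 i1 + m *\<^sub>R u" "0 \<le> m"
    using boundary_side[OF W order_refl w(5)] by blast
  have "W i0 + (- m) *\<^sub>R u = V t0 i1" using s0(2) by simp
  then have "0 \<le> bary W j0 (W i0 + (- m) *\<^sub>R u)"
    using side_base_mem[OF s0(1)] w(2) by (simp add: tri_iff[OF nondeg_W])
  then have "0 \<le> - m / L" using wb(2)[of "- m"] by (simp only:)
  then have "m = 0" using s0(3) w(5) by (simp add: divide_le_0_iff)
  then have V0: "V t0 i1 = W i0" using s0(2) by simp
  have Q0: "Q t0 i1 j1 0"
  proof (cases "i1 + j1 \<in> {1, 2}")
    case True
    then show ?thesis using new[of i1 j1 0] by (simp add: Q_def)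
  next
    case False
    then have "i1 = 1 \<and> j1 = 2 \<or> i1 = 2 \<and> j1 = 1" using type3 sideD(4-6)[OF s0(1)] by blast
    moreover have "i1 \<noteq> 2" using count_pos[OF sideD(1)[OF s0(1)] V0] corner(1) by auto
    ultimately have "i1 = 1" "j1 = 2" by auto
    then show ?thesis unfolding Q_def by (intro disjI2 conjI exI[of _ 1]) auto
  qed
  have "\<exists>t i j y. side t i j u \<sigma> \<and> V t i = W i0 + y *\<^sub>R u \<and> 0 \<le> y \<and> y + len (i + j) = L \<and> Q t i j y"
  proof (rule side_chain[where Q = Q])
    show "\<exists>t i j m. side t i j u \<sigma> \<and> W i0 + y *\<^sub>R u = V t i + m *\<^sub>R u \<and> 0 \<le> m \<and> m < len (i + j)"
      if "0 \<le> y" "y < L" for y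
      by (rule boundary_side[OF W that])
    show "y + len (i + j) \<le> L" if "side t i j u \<sigma>" "V t i = W i0 + y *\<^sub>R u" for t i j y
    proof -
      have "V t j = W i0 + (y + len (i + j)) *\<^sub>R u"
        using sideD(9)[OF that(1)] that(2) by (simp add: algebra_simps)
      then have "0 \<le> bary W i0 (W i0 + (y + len (i + j)) *\<^sub>R u)"
        using side_base_mem[OF that(1)] w(1) by (simp add: tri_iff[OF nondeg_W])
      then show ?thesis using wb(3)[of "y + len (i + j)"] w(5) by (simp add: pos_divide_le_eq)
    qed
    show "side t0 i1 j1 u \<sigma>" "V t0 i1 = W i0" "0 < L" "Q t0 i1 j1 0"
      using s0(1) V0 w(5) Q0 by auto
  next
    fix t i j t' i' j' y
    assume s: "side t i j u \<sigma>" and "0 \<le> y" and z: "y + len (i + j) < L" and Qt: "Q t i j y"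
      and s': "side t' i' j' u \<sigma>" and V': "V t' i' = W i0 + (y + len (i + j)) *\<^sub>R u" "V t' i' = V t j"
    have zpos: "0 < y + len (i + j)" using \<open>0 \<le> y\<close> sideD(8)[OF s] by simp
    show "Q t' i' j' (y + len (i + j))"
    proof (cases "\<exists>c :: nat \<Rightarrow> nat. y + len (i + j) = real (c 1) * len 1 + real (c 2) * len 2 + real (c 3) * len 3 \<and> 0 < c 1 + c 2")
      case True
      then obtain c :: "nat \<Rightarrow> nat" where
        c: "y + len (i + j) = real (c 1) * len 1 + real (c 2) * len 2 + real (c 3) * len 3 \<and> 0 < c 1 + c 2"
        by (elim exE)
      have "\<exists>c' :: nat \<Rightarrow> nat. y + len (i + j) + len e = real (c' 1) * len 1 + real (c' 2) * len 2 + real (c' 3) * len 3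
          \<and> 0 < c' 1 + c' 2" if e: "e \<in> {1, 2, 3}" for e
      proof -
        from e consider "e = 1" | "e = 2" | "e = 3" by blast
        then show ?thesis
        proof cases
          case 1
          then show ?thesis using c by (intro exI[of _ "c (1 := Suc (c 1))"]) (simp add: distrib_right)
        next
          case 2
          then show ?thesis using c by (intro exI[of _ "c (2 := Suc (c 2))"]) (simp add: distrib_right)
        next
          case 3
          then show ?thesis using c by (intro exI[of _ "c (3 := Suc (c 3))"]) (simp add: distrib_right)
        qed
      qed
      from this[OF edge_type_cases[OF sideD(4-6)[OF s']]] show ?thesis
        unfolding Q_def by blast
    next
      case False
      then obtain n :: nat where n0: "i = 1" "j = 2" "y + len 3 = real n * len 3"
        using Qt unfolding Q_def by blast
      then have "i + j = 3" by simp
      then have n: "i = 1" "j = 2" "y + len (i + j) = real n * len 3"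
        using n0(1,2) by (simp_all only: \<open>i + j = 3\<close> n0(3))
      show ?thesis
      proof (cases "i' + j' \<in> {1, 2}")
        case True
        then show ?thesis using new[of i' j' n] n(3) by (simp add: Q_def)
      next
        case False
        then have "i' = 1 \<and> j' = 2 \<or> i' = 2 \<and> j' = 1" using type3 sideD(4-6)[OF s'] by blast
        moreover have "i' \<noteq> 2"
        proof
          assume i': "i' = 2"
          then have "j' = 1" using calculation by simp
          have "V t 2 = V t' 2" using V'(2) i' n by simp
          \<comment> \<open>Both sides would be the same side of the same tile, once in each
            direction; but both displacements point along \<open>u\<close> and cannot
            cancel.\<close>
          then have "t = t'"
            using count_le_1[OF open_side[OF zpos z] sideD(1)[OF s] sideD(1)[OF s']] V'(1) i' by simp
          then have "V t 1 = V t 1 + len (1 + 2) *\<^sub>R u + len (2 + 1) *\<^sub>R u"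
            using sideD(9)[OF s] sideD(9)[OF s'] n i' \<open>j' = 1\<close> by simp
          then have "len (1 + 2) *\<^sub>R u + len (2 + 1) *\<^sub>R u = 0"
            unfolding add.assoc by (rule add_cancel_left_right[THEN iffD1, OF sym])
          then have "(len (1 + 2) + len (2 + 1)) *\<^sub>R u = 0" by (simp only: scaleR_left_distrib)
          moreover have "u \<noteq> 0" using w(4) by auto
          moreover have "0 < len (1 + 2)" "0 < len (2 + 1)"
            using sideD(8)[OF s] sideD(8)[OF s'] n i' \<open>j' = 1\<close> by auto
          ultimately show False unfolding scaleR_eq_0_iff by linarith
        qed
        ultimately have ij: "i' = 1" "j' = 2" by auto
        have "y + len (i + j) + len 3 = real (Suc n) * len 3"
          using n(3) by (simp add: algebra_simps)
        then show ?thesis unfolding Q_def using ij by blast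
      qed
    qed
  qed
  then obtain t i j y where s: "side t i j u \<sigma>" "V t i = W i0 + y *\<^sub>R u" "y + len (i + j) = L" "Q t i j y"
    by blast
  have "V t j = W i0 + L *\<^sub>R u"
    using sideD(9)[OF s(1)] s(2) unfolding s(3)[symmetric] by (simp add: algebra_simps)
  then have "V t j = W j0" using w(6) by simp
  then have "j \<noteq> 2" using count_pos[OF sideD(1)[OF s(1)], of j "W j0"] corner(2) by auto
  then show ?thesis using s(4) unfolding Q_def s(3) by blast
qed

text \<open>Tilting \<open>u\<close> to either side stays in the closed cone of \<open>W\<close>, so
  each active linear form is nonnegative on both tilted directions. If it vanished on
  \<open>u\<close>, it would vanish on \<open>perp u\<close> too and be zero.\<close>

lemma opposite_sides_inside:
  assumes "side t i j u \<sigma>" "side t' i' j' u (- \<sigma>)" "V t i = V t' i'"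
  shows "u \<in> cone_open W (V t i)"
  unfolding cone_open_def
proof (intro CollectI allI impI)
  fix k :: nat assume k: "k < 3" "bary W k (V t i) = 0"
  note d = sideD[OF assms(1)] and d' = sideD[OF assms(2)]
  have "\<forall>\<^sub>F r in at_right 0. u + (r * \<sigma>) *\<^sub>R perp u \<in> cone_open (V t) (V t i + 0 *\<^sub>R u)"
    by (rule eventually_side_cone[OF d(2,3) order_refl d(8)])
  moreover have "\<forall>\<^sub>F r in at_right 0. u + (r * - \<sigma>) *\<^sub>R perp u \<in> cone_open (V t') (V t' i' + 0 *\<^sub>R u)"
    by (rule eventually_side_cone[OF d'(2,3) order_refl d'(8)])
  moreover have "\<forall>\<^sub>F r::real in at_right 0. 0 < r" by (rule eventually_at_right_less)
  ultimately have "\<forall>\<^sub>F r in at_right 0. 0 < r \<and> u + (r * \<sigma>) *\<^sub>R perp u \<in> cone_open (V t) (V t i)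
      \<and> u + (r * - \<sigma>) *\<^sub>R perp u \<in> cone_open (V t') (V t' i')"
    by eventually_elim auto
  then obtain r where r: "0 < r" "u + (r * \<sigma>) *\<^sub>R perp u \<in> cone_open (V t) (V t i)"
      "u + (r * - \<sigma>) *\<^sub>R perp u \<in> cone_open (V t') (V t' i')"
    using eventually_happens[of _ "at_right (0::real)"] by auto
  have "u + (r * \<sigma>) *\<^sub>R perp u \<in> cone_closed W (V t i)" "u + (r * - \<sigma>) *\<^sub>R perp u \<in> cone_closed W (V t i)"
    using subsetD[OF cone_closed_mono[OF d(1) tri_vertex_mem[OF d(4)]] subsetD[OF cone_open_subset_closed r(2)]]
      subsetD[OF cone_closed_mono[OF d'(1) tri_vertex_mem[OF d'(4)]] subsetD[OF cone_open_subset_closed r(3)]]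
    unfolding assms(3) .
  then have ge: "0 \<le> bary_lin W k u + r * \<sigma> * bary_lin W k (perp u)" "0 \<le> bary_lin W k u - r * \<sigma> * bary_lin W k (perp u)"
    using k by (auto simp: cone_closed_def bary_lin_add bary_lin_diff)
  show "0 < bary_lin W k u"
  proof (rule ccontr)
    assume "\<not> 0 < bary_lin W k u"
    then have "bary_lin W k u = 0" "r * \<sigma> * bary_lin W k (perp u) = 0" using ge by linarith+
    then have z: "bary_lin W k u = 0" "bary_lin W k (perp u) = 0" using r(1) d(10) by auto
    obtain w where w: "w \<noteq> 0" "\<forall>d. bary_lin W k d = cross2 w d"
      using bary_lin_cr[OF nondeg_W k(1)] by blast
    have "cross2 w u = 0" "cross2 w (perp u) = 0" using z w(2) by auto
    then have wu: "w = (w \<bullet> u) *\<^sub>R u" using cross2_parallel d(7) by blast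
    from arg_cong[OF this, of "\<lambda>x. cross2 x (perp u)"] have "cross2 w (perp u) = w \<bullet> u"
      unfolding cross2_simps cross2_perp d(7) by simp
    then have "w \<bullet> u = 0" using \<open>cross2 w (perp u) = 0\<close> by simp
    then show False using wu w(1) by (metis scaleR_zero_left)
  qed
qed

text \<open>Each coordinate of \<open>W\<close> is affine along the segment, nonnegative at both
  ends, and increases from the start if it vanishes there.\<close>

lemma inside_segment:
  assumes "P \<in> tri W" "u \<in> cone_open W P" "P + Y *\<^sub>R u \<in> tri W"
  shows "0 < y \<Longrightarrow> y < Y \<Longrightarrow> P + y *\<^sub>R u \<in> tri_int W" "0 < Y \<Longrightarrow> - u \<in> cone_open W (P + Y *\<^sub>R u)"
proof -
  have b: "0 \<le> bary W k P" "0 \<le> bary W k P + Y * bary_lin W k u" "bary W k P = 0 \<longrightarrow> 0 < bary_lin W k u" if "k < 3" for k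
    using assms that by (auto simp: tri_iff[OF nondeg_W] bary_add cone_open_def)
  show "P + y *\<^sub>R u \<in> tri_int W" if y: "0 < y" "y < Y"
    unfolding tri_int_def
  proof (intro CollectI allI impI)
    fix k :: nat assume k: "k < 3"
    show "0 < bary W k (P + y *\<^sub>R u)"
    proof (cases "0 \<le> bary_lin W k u")
      case True
      then show ?thesis
        using b(1,3)[OF k] y by (cases "bary W k P = 0") (auto simp: bary_add add_pos_nonneg)
    next
      case False
      then have "Y * bary_lin W k u < y * bary_lin W k u" using y by simp
      then show ?thesis using b(2)[OF k] by (simp add: bary_add)
    qed
  qed
  show "- u \<in> cone_open W (P + Y *\<^sub>R u)" if "0 < Y"
    unfolding cone_open_def
  proof (intro CollectI allI impI)
    fix k :: nat assume k: "k < 3" "bary W k (P + Y *\<^sub>R u) = 0"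
    show "0 < bary_lin W k (- u)"
    proof (rule ccontr)
      assume "\<not> 0 < bary_lin W k (- u)"
      then have "0 \<le> Y * bary_lin W k u" using that by simp
      moreover have "bary W k P + Y * bary_lin W k u = 0" using k(2) by (simp add: bary_add)
      ultimately have "bary W k P = 0" "Y * bary_lin W k u = 0" using b(1)[OF k(1)] by linarith+
      then show False using b(3)[OF k(1)] that by auto
    qed
  qed
qed

end

section \<open>Mismatched sides\<close>

lemma even_card_involution:
  assumes "finite A" "\<And>x. x \<in> A \<Longrightarrow> h x \<in> A" "\<And>x. x \<in> A \<Longrightarrow> h (h x) = x" "\<And>x. x \<in> A \<Longrightarrow> h x \<noteq> x"
  shows "even (card A)"
  using assms
proof (induction "card A" arbitrary: A rule: less_induct)
  case less
  show ?case
  proof (cases "A = {}")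
    case False
    then obtain x where x: "x \<in> A" by blast
    define B where "B = A - {x, h x}"
    have "{x, h x} \<subseteq> A" "card {x, h x} = 2" using less.prems(2,4) x by force+
    then have card: "card A = card B + 2"
      using less.prems(1) card_mono[of A "{x, h x}"] by (simp add: B_def card_Diff_subset)
    have "even (card B)"
    proof (rule less.hyps)
      show "h y \<in> B" "h (h y) = y" "h y \<noteq> y" if "y \<in> B" for y
        using that less.prems(2,3,4) x unfolding B_def by (metis Diff_iff insert_iff empty_iff)+
    qed (use card less.prems(1) in \<open>auto simp: B_def\<close>)
    then show ?thesis using card by simp
  qed simp
qed

context tri_tiling
begin

definition no_relation :: "nat \<Rightarrow> bool" where
  "no_relation \<tau> \<longleftrightarrow> (\<forall>(n::nat) (c :: nat \<Rightarrow> nat). real n * len \<tau> = (\<Sum>k\<in>{1,2,3}. real (c k) * len k)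
      \<longrightarrow> (\<forall>k\<in>{1,2,3}. k \<noteq> \<tau> \<longrightarrow> c k = 0))"

text \<open>Since reversing a directed line exchanges left and right,
  \<open>flag (- u) \<sigma>\<close> speaks of the same half-plane as
  \<open>flag u (- \<sigma>)\<close>, but of sides leaving \<open>P\<close> backwards.\<close>

definition flag :: "point \<Rightarrow> real \<Rightarrow> point \<Rightarrow> bool" where
  "flag u \<sigma> P \<longleftrightarrow> (\<exists>t i j. side t i j u \<sigma> \<and> V t i = P)"

definition typed_flag :: "nat \<Rightarrow> point \<Rightarrow> real \<Rightarrow> point \<Rightarrow> bool" where
  "typed_flag \<tau> u \<sigma> P \<longleftrightarrow> (\<exists>t i j. side t i j u \<sigma> \<and> V t i = P \<and> i + j = \<tau>)"

definition mismatch :: "nat \<Rightarrow> 't \<Rightarrow> nat \<Rightarrow> nat \<Rightarrow> point \<Rightarrow> real \<Rightarrow> bool" where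
  "mismatch \<tau> t i j u \<sigma> \<longleftrightarrow> side t i j u \<sigma> \<and> i + j = \<tau> \<and>
     (\<exists>t' i' j'. side t' i' j' u (- \<sigma>) \<and> V t' i' = V t i \<and> i' + j' \<noteq> \<tau>)"

lemma typed_flag_end_mem: "typed_flag \<tau> u \<sigma> P \<Longrightarrow> P + len \<tau> *\<^sub>R u \<in> tri W"
  unfolding typed_flag_def using side_base_mem sideD(9) by metis

lemma mismatch_inside: "mismatch \<tau> t i j u \<sigma> \<Longrightarrow> u \<in> cone_open W (V t i)"
  unfolding mismatch_def using opposite_sides_inside by metis

text \<open>Beyond the line the run faces a chain of tile sides whose first member is not of type
  \<tau>. A flag across the end of the run, in either direction, would prevent that chain from
  crossing this point. The length of the run would then be a combination of side lengths that
  \<open>no_relation\<close> forbids.\<close>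

lemma run_blocked:
  assumes nr: "no_relation \<tau>" and mis: "mismatch \<tau> t i j u \<sigma>" and m: "1 \<le> m"
    and run: "\<And>a. a < m \<Longrightarrow> typed_flag \<tau> u \<sigma> (V t i + (real a * len \<tau>) *\<^sub>R u)"
  shows "\<not> flag u (- \<sigma>) (V t i + (real m * len \<tau>) *\<^sub>R u)" "\<not> flag (- u) \<sigma> (V t i + (real m * len \<tau>) *\<^sub>R u)"
proof -
  define P where "P = V t i"
  define l where "l = len \<tau>"
  obtain t' i' j' where s: "side t i j u \<sigma>" "i + j = \<tau>" and g: "side t' i' j' u (- \<sigma>)" "V t' i' = P" "i' + j' \<noteq> \<tau>"
    using mis by (auto simp: mismatch_def P_def)
  have l: "0 < l" using sideD(8)[OF s(1)] s(2) by (simp add: l_def)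
  define Y where "Y = real m * l"
  have Y: "0 < Y" using m l by (simp add: Y_def)
  have run': "typed_flag \<tau> u \<sigma> (P + (real a * l) *\<^sub>R u)" if "a < m" for a
    using run[OF that] by (simp add: P_def l_def)
  have PW: "P \<in> tri W" using side_base_mem[OF s(1)] by (simp add: P_def)
  have uP: "u \<in> cone_open W P" using mismatch_inside[OF mis] by (simp add: P_def)
  have "P + (real (m - 1) * l) *\<^sub>R u + l *\<^sub>R u \<in> tri W"
    using typed_flag_end_mem[OF run'[of "m - 1"]] m by (simp add: l_def)
  moreover have "real (m - 1) * l + l = Y" using m by (simp add: Y_def of_nat_diff algebra_simps)
  ultimately have QW: "P + Y *\<^sub>R u \<in> tri W" by (simp add: add.assoc flip: scaleR_add_left)
  have cov: "\<exists>t i j m. side t i j u (- \<sigma>) \<and> P + y *\<^sub>R u = V t i + m *\<^sub>R u \<and> 0 \<le> m \<and> m < len (i + j)"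
    if y: "0 \<le> y" "y < Y" for y
  proof (cases "y = 0")
    case True
    then show ?thesis using g sideD(8)[OF g(1)] by (intro exI[of _ t'] exI[of _ i'] exI[of _ j'] exI[of _ 0]) auto
  next
    case False
    \<comment> \<open>The point at distance \<open>y\<close> lies on the \<open>a\<close>-th side of
      the run; the tile across that side covers it.\<close>
    define a where "a = nat \<lfloor>y / l\<rfloor>"
    have ra: "real a = of_int \<lfloor>y / l\<rfloor>" using y l by (simp add: a_def)
    have "real a \<le> y / l" "y / l < real a + 1" unfolding ra by linarith+
    then have b: "real a * l \<le> y" "y < real a * l + l"
      using l by (auto simp: pos_le_divide_eq pos_divide_less_eq algebra_simps)
    have "real a * l < real m * l" using b(1) y(2) by (simp add: Y_def)
    then have "a < m" using l by simp
    then obtain ta ia ja where sa: "side ta ia ja u \<sigma>" "V ta ia = P + (real a * l) *\<^sub>R u" "ia + ja = \<tau>"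
      using run' unfolding typed_flag_def by blast
    have x: "V ta ia + (y - real a * l) *\<^sub>R u = P + y *\<^sub>R u"
      unfolding sa(2) by (simp add: scaleR_diff_left)
    have "P + y *\<^sub>R u \<in> tri_int W"
      using inside_segment(1)[OF PW uP QW] y False by simp
    then have "u \<in> cone_open W (V ta ia + (y - real a * l) *\<^sub>R u)"
      unfolding x by (simp add: cone_open_int)
    from side_opposite[OF sa(1) _ _ this] b show ?thesis
      unfolding x sa(3) l_def[symmetric] by auto
  qed
  have contra: False
    if nc: "\<And>t i j y. side t i j u (- \<sigma>) \<Longrightarrow> V t i = P + y *\<^sub>R u \<Longrightarrow> 0 \<le> y \<Longrightarrow> y < Y \<Longrightarrow> y + len (i + j) \<le> Y"
  proof -
    have "\<exists>c :: nat \<Rightarrow> nat. Y = (\<Sum>k\<in>{1,2,3}. real (c k) * len k) \<and> 0 < c (i' + j')"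
      by (rule side_chain_counts) (fact cov nc g(1,2) Y)+
    then obtain c :: "nat \<Rightarrow> nat" where c: "Y = (\<Sum>k\<in>{1,2,3}. real (c k) * len k)" "0 < c (i' + j')"
      by blast
    then have "c (i' + j') = 0"
      using nr edge_type_cases[OF sideD(4-6)[OF g(1)]] g(3) unfolding no_relation_def Y_def l_def by blast
    then show False using c(2) by simp
  qed
  show "\<not> flag u (- \<sigma>) (V t i + (real m * len \<tau>) *\<^sub>R u)"
  proof
    assume "flag u (- \<sigma>) (V t i + (real m * len \<tau>) *\<^sub>R u)"
    then obtain f k h where f: "side f k h u (- \<sigma>)" "V f k = P + Y *\<^sub>R u"
      by (auto simp: flag_def P_def Y_def l_def)
    show False
    proof (rule contra, rule ccontr)
      fix t i j y assume a: "side t i j u (- \<sigma>)" "V t i = P + y *\<^sub>R u" "0 \<le> y" "y < Y" "\<not> y + len (i + j) \<le> Y"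
      have "V t i + (Y - y) *\<^sub>R u = V f k + 0 *\<^sub>R u"
        unfolding a(2) f(2) by (simp add: scaleR_diff_left)
      from side_unique[OF a(1) f(1) this] a(4,5) sideD(8)[OF f(1)] have "Y - y = 0" by auto
      then show False using a(4) by simp
    qed
  qed
  show "\<not> flag (- u) \<sigma> (V t i + (real m * len \<tau>) *\<^sub>R u)"
  proof
    assume "flag (- u) \<sigma> (V t i + (real m * len \<tau>) *\<^sub>R u)"
    then obtain f k h where f: "side f k h (- u) \<sigma>" "V f k = P + Y *\<^sub>R u"
      by (auto simp: flag_def P_def Y_def l_def)
    have f': "side f h k u (- \<sigma>)" using side_rev[OF f(1)] by simp
    show False
    proof (rule contra, rule ccontr)
      fix t i j y assume a: "side t i j u (- \<sigma>)" "V t i = P + y *\<^sub>R u" "0 \<le> y" "y < Y" "\<not> y + len (i + j) \<le> Y"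
      have "V f k = V t i + (Y - y) *\<^sub>R u"
        unfolding a(2) f(2) by (simp add: scaleR_diff_left)
      from side_consecutive[OF f' a(1) this] a(4,5) have "Y - y = 0" by auto
      then show False using a(4) by simp
    qed
  qed
qed

text \<open>The straight angle of \<open>t\<close> and a positive angle of \<open>t'\<close> exceed
  \<open>pi\<close> together, so \<open>Q\<close> is interior to \<open>W\<close> with full angle
  \<open>2 * pi\<close>. This leaves room for exactly one straight angle and for vertex angles of
  sum \<open>pi\<close>.\<close>

lemma through_interior:
  assumes "Q \<in> tri W" "t \<in> I" "Q \<in> tri_edges (V t)" "t' \<in> I" "j < 3" "V t' j = Q"
  shows "Q \<in> tri_int W" "through Q = 1"
    "real (count 0 Q) * ang 0 + real (count 1 Q) * ang 1 + real (count 2 Q) * ang 2 = pi"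
proof -
  define S where "S = real (count 0 Q) * ang 0 + real (count 1 Q) * ang 1 + real (count 2 Q) * ang 2"
  have ang: "0 < ang 0" "0 < ang 1" "0 < ang 2" using ang_bounds[OF I_nonempty] by auto
  have "0 < count j Q" by (rule count_pos[OF assms(4,6)])
  then have pos: "0 < real (count j Q) * ang j" using ang_bounds[OF I_nonempty assms(5)] by simp
  have nn: "0 \<le> real (count 0 Q) * ang 0" "0 \<le> real (count 1 Q) * ang 1" "0 \<le> real (count 2 Q) * ang 2"
    using ang by simp_all
  from less_3_cases[OF assms(5)] consider "j = 0" | "j = 1" | "j = 2" by blast
  then have S: "0 < S"
  proof cases
    case 1
    then show ?thesis using pos nn unfolding S_def 1 by linarith
  next
    case 2
    then show ?thesis using pos nn unfolding S_def 2 by linarith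
  next
    case 3
    then show ?thesis using pos nn unfolding S_def 3 by linarith
  qed
  have th: "1 \<le> through Q"
    unfolding through_def using assms(2,3) finite_I by (auto simp: Suc_le_eq card_gt_0_iff)
  define n where "n = card {t\<in>I. Q \<in> tri_int (V t)}"
  have sum: "S + real (through Q) * pi + real n * (2 * pi) = angle_measure (cone_open W Q)"
    using angle_sum[OF assms(1)] by (simp add: S_def n_def)
  have "0 \<le> real n * (2 * pi)" by simp
  moreover have "1 * pi \<le> real (through Q) * pi" using th by (intro mult_right_mono) auto
  ultimately have ge: "pi < angle_measure (cone_open W Q)"
    using sum S by linarith
  from nondeg_W assms(1) show int: "Q \<in> tri_int W"
  proof (cases rule: tri_cases)
    case (2 k)
    then have "Q \<in> tri_edges W" by (auto simp: tri_edges_def)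
    then show ?thesis using angle_measure_edge[OF nondeg_W] ge by simp
  next
    case (3 i)
    then show ?thesis using angle_measure_vertex(1,3)[OF nondeg_W 3(1)] ge by simp
  qed
  then have eq: "S + real (through Q) * pi + real n * (2 * pi) = 2 * pi"
    using sum angle_measure_int by simp
  have "real (through Q) * pi + real (2 * n) * pi < 2 * pi" using eq S by simp
  then have "(real (through Q) + real (2 * n)) * pi < 2 * pi" by (simp add: algebra_simps)
  then have "real (through Q) + real (2 * n) < 2" by simp
  then have "through Q + 2 * n < 2" by linarith
  then have "through Q = 1" "n = 0" using th by auto
  then show "through Q = 1" "real (count 0 Q) * ang 0 + real (count 1 Q) * ang 1 + real (count 2 Q) * ang 2 = pi"
    using eq by (auto simp: S_def)
qed

text \<open>Records the maximal run of \<open>n\<close> sides of type \<tau> from \<open>P\<close>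
  and its end \<open>Q\<close>, which lies inside a tile side across the line. The absence of flags
  across is recorded at all intermediate points as well, because injectivity must exclude a second
  run that starts in the middle of the first.\<close>

definition landing :: "nat \<Rightarrow> point \<Rightarrow> point \<Rightarrow> real \<Rightarrow> nat \<Rightarrow> point \<Rightarrow> bool" where
  "landing \<tau> P u \<sigma> n Q \<longleftrightarrow> 1 \<le> n \<and> Q = P + (real n * len \<tau>) *\<^sub>R u
     \<and> (\<forall>a<n. typed_flag \<tau> u \<sigma> (P + (real a * len \<tau>) *\<^sub>R u)) \<and> \<not> typed_flag \<tau> u \<sigma> Q
     \<and> (\<forall>m. 1 \<le> m \<and> m \<le> n \<longrightarrow> \<not> flag u (- \<sigma>) (P + (real m * len \<tau>) *\<^sub>R u) \<and> \<not> flag (- u) \<sigma> (P + (real m * len \<tau>) *\<^sub>R u))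
     \<and> typed_flag \<tau> (- u) (- \<sigma>) Q
     \<and> (\<exists>s i j m. side s i j u (- \<sigma>) \<and> Q = V s i + m *\<^sub>R u \<and> 0 < m \<and> m < len (i + j))
     \<and> Q \<in> tri_int W \<and> through Q = 1
     \<and> real (count 0 Q) * ang 0 + real (count 1 Q) * ang 1 + real (count 2 Q) * ang 2 = pi"

lemma run_stops:
  assumes "norm u = 1" "0 < l"
  shows "\<exists>n. P + (real n * l) *\<^sub>R u \<notin> tri W"
proof (rule ccontr)
  assume "\<not> ?thesis"
  then have all: "P + (real n * l) *\<^sub>R u \<in> tri W" for n by blast
  have "bounded (tri W)" unfolding tri_def by (intro compact_imp_bounded compact_convex_hull) auto
  then obtain B where B: "\<And>x. x \<in> tri W \<Longrightarrow> norm x \<le> B" by (auto simp: bounded_iff)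
  obtain n :: nat where "(B + norm P) / l < real n" using reals_Archimedean2 by blast
  then have n: "B + norm P < real n * l" using assms(2) by (simp add: pos_divide_less_eq)
  have "real n * l = norm ((real n * l) *\<^sub>R u)" using assms by simp
  also have "\<dots> = norm ((P + (real n * l) *\<^sub>R u) - P)" by simp
  also have "\<dots> \<le> norm (P + (real n * l) *\<^sub>R u) + norm P" by (rule norm_triangle_ineq4)
  finally show False using B[OF all[of n]] n by linarith
qed

text \<open>\<open>n\<close> is the first index at which the run cannot be continued; it exists
  because \<open>W\<close> is bounded. Looking back from \<open>Q\<close>, the tile side across the
  line does not start at \<open>Q\<close> by \<open>run_blocked\<close>, so it contains
  \<open>Q\<close> in its relative interior.\<close>

lemma landing_exists:
  assumes nr: "no_relation \<tau>" and mis: "mismatch \<tau> t i j u \<sigma>"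
  shows "\<exists>n Q. landing \<tau> (V t i) u \<sigma> n Q"
proof -
  define P where "P = V t i"
  have s: "side t i j u \<sigma>" "i + j = \<tau>" using mis by (auto simp: mismatch_def)
  have l: "0 < len \<tau>" using sideD(8)[OF s(1)] s(2) by simp
  let ?p = "\<lambda>n::nat. P + (real n * len \<tau>) *\<^sub>R u"
  have ex: "\<exists>n. \<not> typed_flag \<tau> u \<sigma> (?p n)"
    using run_stops[OF sideD(7)[OF s(1)] l, of P] side_base_mem unfolding typed_flag_def by metis
  then obtain n where n: "\<not> typed_flag \<tau> u \<sigma> (?p n)" "\<And>a. a < n \<Longrightarrow> typed_flag \<tau> u \<sigma> (?p a)"
    using iffD1[OF exists_least_iff ex] by blast
  have "typed_flag \<tau> u \<sigma> (?p 0)" unfolding typed_flag_def using s by (auto simp: P_def)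
  then have n1: "1 \<le> n" using n(1) by (cases n) auto
  define Q where "Q = ?p n"
  have blocked: "\<not> flag u (- \<sigma>) (?p m)" "\<not> flag (- u) \<sigma> (?p m)" if "1 \<le> m" "m \<le> n" for m
    using run_blocked[OF nr mis that(1)] n(2) that(2) unfolding P_def by auto
  obtain tl il jl where sl: "side tl il jl u \<sigma>" "V tl il = ?p (n - 1)" "il + jl = \<tau>"
    using n(2)[of "n - 1"] n1 unfolding typed_flag_def by auto
  have "V tl jl = ?p (n - 1) + len \<tau> *\<^sub>R u" using sideD(9)[OF sl(1)] sl(2,3) by simp
  also have "\<dots> = Q"
  proof -
    have "real (n - 1) * len \<tau> + len \<tau> = real n * len \<tau>" using n1 by (simp add: of_nat_diff algebra_simps)
    then show ?thesis unfolding Q_def by (metis add.assoc scaleR_add_left)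
  qed
  finally have VQ: "V tl jl = Q" .
  have QW: "Q \<in> tri W" using side_base_mem[OF sl(1)] VQ by simp
  have rl: "side tl jl il (- u) (- \<sigma>)" by (rule side_rev[OF sl(1)])
  have "- u \<in> cone_open W Q"
    using inside_segment(2)[of P u "real n * len \<tau>"] mismatch_inside[OF mis] side_base_mem[OF s(1)] QW l n1
    by (simp add: P_def Q_def)
  then have "- u \<in> cone_open W (V tl jl + 0 *\<^sub>R (- u))" using VQ by simp
  from side_opposite[OF rl order_refl sideD(8)[OF rl] this] obtain s i' j' m'
    where o: "side s i' j' (- u) \<sigma>" "V tl jl + 0 *\<^sub>R (- u) = V s i' + m' *\<^sub>R (- u)" "0 \<le> m'" "m' < len (i' + j')"
    by auto
  then have oQ: "Q = V s i' + m' *\<^sub>R (- u)" using VQ by simp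
  have "m' \<noteq> 0"
  proof
    assume "m' = 0"
    then have "flag (- u) \<sigma> (?p n)" using o(1) oQ unfolding flag_def Q_def by auto
    then show False using blocked(2)[of n] n1 by simp
  qed
  then have m': "0 < m'" using o(3) by simp
  have "Q \<in> tri_edges (V s)"
    unfolding tri_edges_def oQ using tri_side_edge[OF sideD(2,3)[OF o(1)] m' o(4)] third_less(1)[OF sideD(4-6)[OF o(1)]]
    by blast
  note ti = through_interior[OF QW sideD(1)[OF o(1)] this sideD(1)[OF sl(1)] sideD(5)[OF sl(1)] VQ]
  have ro: "side s j' i' u (- \<sigma>)" using side_rev[OF o(1)] by simp
  have "Q = V s j' + (len (j' + i') - m') *\<^sub>R u"
    using oQ sideD(9)[OF o(1)] by (simp add: algebra_simps)
  then have ex: "\<exists>s i j m. side s i j u (- \<sigma>) \<and> Q = V s i + m *\<^sub>R u \<and> 0 < m \<and> m < len (i + j)"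
    using ro m' o(4) by (intro exI[of _ s] exI[of _ j'] exI[of _ i'] exI[of _ "len (j' + i') - m'"]) (auto simp: add.commute)
  have "typed_flag \<tau> (- u) (- \<sigma>) Q" unfolding typed_flag_def using rl VQ sl(3) by (metis add.commute)
  then have "landing \<tau> P u \<sigma> n Q"
    unfolding landing_def using n1 n blocked ti ex by (auto simp: Q_def)
  then show ?thesis by (auto simp: P_def)
qed

end

lemma even_card_matching:
  assumes "finite A" "\<And>x. x \<in> A \<Longrightarrow> \<exists>y\<in>A. R x y" "\<And>x y. R x y \<Longrightarrow> R y x"
    "\<And>x y z. R x y \<Longrightarrow> R x z \<Longrightarrow> y = z" "\<And>x. \<not> R x x"
  shows "even (card A)"
proof -
  define h where "h x = (SOME y. y \<in> A \<and> R x y)" for x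
  have h: "h x \<in> A" "R x (h x)" if "x \<in> A" for x
    using someI_ex[of "\<lambda>y. y \<in> A \<and> R x y"] assms(2)[OF that] unfolding h_def by blast+
  show ?thesis
  proof (rule even_card_involution[OF assms(1), of h])
    fix x assume x: "x \<in> A"
    show "h x \<in> A" by (rule h(1)[OF x])
    show "h (h x) = x" using h(2)[OF h(1)[OF x]] assms(3)[OF h(2)[OF x]] assms(4) by blast
    show "h x \<noteq> x" using h(2)[OF x] assms(5) by metis
  qed
qed

section \<open>Injectivity of landing, and parity of the sides at a vertex\<close>

context tri_tiling
begin

lemma through_unique:
  assumes "through Q = 1" "s \<in> I" "s' \<in> I" "Q \<in> tri_edges (V s)" "Q \<in> tri_edges (V s')"
  shows "s = s'"
proof -
  obtain z where "{t\<in>I. Q \<in> tri_edges (V t)} = {z}"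
    using assms(1) unfolding through_def by (rule card_1_singletonE)
  moreover have "s \<in> {t\<in>I. Q \<in> tri_edges (V t)}" "s' \<in> {t\<in>I. Q \<in> tri_edges (V t)}"
    using assms(2-5) by auto
  ultimately show ?thesis by simp
qed

lemma side_inner_edge:
  assumes "side s i j u \<sigma>" "0 < m" "m < len (i + j)"
  shows "V s i + m *\<^sub>R u \<in> tri_edge (V s) (3 - i - j)" "V s i + m *\<^sub>R u \<in> tri_edges (V s)"
proof -
  show "V s i + m *\<^sub>R u \<in> tri_edge (V s) (3 - i - j)"
    by (rule tri_side_edge[OF sideD(2,3)[OF assms(1)] assms(2,3)])
  then show "V s i + m *\<^sub>R u \<in> tri_edges (V s)"
    using third_less(1)[OF sideD(4-6)[OF assms(1)]] unfolding tri_edges_def by blast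
qed

lemma through_line:
  assumes "through Q = 1"
    and s: "side s i j u \<sigma>" "Q = V s i + m *\<^sub>R u" "0 < m" "m < len (i + j)"
    and s': "side s' i' j' u' \<sigma>'" "Q = V s' i' + m' *\<^sub>R u'" "0 < m'" "m' < len (i' + j')"
  shows "u' = u \<and> \<sigma>' = \<sigma> \<or> u' = - u \<and> \<sigma>' = - \<sigma>"
proof -
  note e = side_inner_edge[OF s(1,3,4), folded s(2)] and e' = side_inner_edge[OF s'(1,3,4), folded s'(2)]
  note d = sideD(4-6)[OF s(1)] and d' = sideD(4-6)[OF s'(1)]
  have ss: "s = s'" by (rule through_unique[OF assms(1) sideD(1)[OF s(1)] sideD(1)[OF s'(1)] e(2) e'(2)])
  have "3 - i - j = 3 - i' - j'"
    using e(1) e'(1) third_less(1)[OF d] third_less(1)[OF d'] unfolding tri_edge_def ss by (auto dest: less_imp_neq)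
  then have "i' = i \<and> j' = j \<or> i' = j \<and> j' = i" using d d' by auto
  then show ?thesis
    using side_det s(1) s'(1) side_rev[OF s(1)] unfolding ss by blast
qed

text \<open>If the second run were shorter, it would start at an intermediate point of the first.
  Its mismatch provides a flag across the line there, contrary to \<open>landing\<close>.\<close>

lemma landing_less:
  assumes "mismatch \<tau> t' i' j' u \<sigma>"
    and "landing \<tau> (V t i) u \<sigma> n Q" "landing \<tau> (V t' i') u \<sigma> n' Q"
  shows "\<not> n' < n"
proof
  assume n: "n' < n"
  have "V t i + (real n * len \<tau>) *\<^sub>R u = V t' i' + (real n' * len \<tau>) *\<^sub>R u"
    using assms(2,3) unfolding landing_def by simp
  moreover have "real n * len \<tau> = real (n - n') * len \<tau> + real n' * len \<tau>"
    using n by (simp add: of_nat_diff algebra_simps)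
  ultimately have "V t' i' = V t i + (real (n - n') * len \<tau>) *\<^sub>R u"
    by (simp add: scaleR_add_left)
  moreover have "flag u (- \<sigma>) (V t' i')" using assms(1) unfolding mismatch_def flag_def by metis
  moreover have "\<not> flag u (- \<sigma>) (V t i + (real (n - n') * len \<tau>) *\<^sub>R u)"
  proof -
    have "1 \<le> n - n'" "n - n' \<le> n" using n by auto
    then show ?thesis using assms(2) unfolding landing_def by blast
  qed
  ultimately show False by simp
qed

text \<open>The only tile having \<open>Q\<close> inside a side determines the line and the
  half-plane of the run up to reversal. Reversal is impossible: the last side of the first run, read
  backwards from \<open>Q\<close>, would continue the second. Equal directions then force equal
  lengths by \<open>landing_less\<close>.\<close>

lemma landing_inj:
  assumes mis: "mismatch \<tau> t i j u \<sigma>" "mismatch \<tau> t' i' j' u' \<sigma>'"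
    and land: "landing \<tau> (V t i) u \<sigma> n Q" "landing \<tau> (V t' i') u' \<sigma>' n' Q"
  shows "t = t' \<and> i = i' \<and> j = j'"
proof -
  obtain s a b m where s: "side s a b u (- \<sigma>)" "Q = V s a + m *\<^sub>R u" "0 < m" "m < len (a + b)"
    using land(1) unfolding landing_def by blast
  obtain s' a' b' m' where s': "side s' a' b' u' (- \<sigma>')" "Q = V s' a' + m' *\<^sub>R u'" "0 < m'" "m' < len (a' + b')"
    using land(2) unfolding landing_def by blast
  have th: "through Q = 1" using land(1) unfolding landing_def by blast
  have "\<not> (u' = - u \<and> \<sigma>' = - \<sigma>)"
  proof
    assume "u' = - u \<and> \<sigma>' = - \<sigma>"
    moreover have "typed_flag \<tau> (- u) (- \<sigma>) Q" "\<not> typed_flag \<tau> u' \<sigma>' Q"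
      using land unfolding landing_def by blast+
    ultimately show False by simp
  qed
  then have eq: "u' = u" "\<sigma>' = \<sigma>" using through_line[OF th s s'] by auto
  have "n = n'"
    using landing_less[OF mis(2)[unfolded eq] land(1) land(2)[unfolded eq]]
      landing_less[OF mis(1) land(2)[unfolded eq] land(1)] by simp
  then have "V t i = V t' i'" using land unfolding landing_def eq by simp
  moreover have sd: "side t i j u \<sigma>" "side t' i' j' u \<sigma>" using mis unfolding mismatch_def eq by auto
  ultimately show ?thesis
    using side_unique[OF sd, of 0 0] sideD(8)[OF sd(1)] sideD(8)[OF sd(2)] by simp
qed

text \<open>For \<tau> equal to 1 or 2 the side of type \<tau> joins the vertices 0 and \<tau>.
  Hence the sides of this type at \<open>P\<close> are counted by
  \<open>count 0 P + count \<tau> P\<close>.\<close>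

definition typed_flags :: "nat \<Rightarrow> point \<Rightarrow> ('t \<times> nat \<times> nat) set" where
  "typed_flags \<tau> P = {(t, i, j). t \<in> I \<and> V t i = P \<and> (i = 0 \<and> j = \<tau> \<or> i = \<tau> \<and> j = 0)}"

lemma typed_flags_card:
  assumes "\<tau> \<in> {1, 2}"
  shows "finite (typed_flags \<tau> P)" "card (typed_flags \<tau> P) = count 0 P + count \<tau> P"
proof -
  define A where "A = (\<lambda>t. (t, 0::nat, \<tau>)) ` {t\<in>I. V t 0 = P}"
  define B where "B = (\<lambda>t. (t, \<tau>, 0::nat)) ` {t\<in>I. V t \<tau> = P}"
  have eq: "typed_flags \<tau> P = A \<union> B" by (auto simp: typed_flags_def A_def B_def)
  have fin: "finite A" "finite B" using finite_I by (auto simp: A_def B_def)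
  show "finite (typed_flags \<tau> P)" using eq fin by simp
  have "A \<inter> B = {}" using assms by (auto simp: A_def B_def)
  moreover have "card A = count 0 P" "card B = count \<tau> P"
    unfolding A_def B_def count_def by (auto intro!: card_image inj_onI)
  ultimately show "card (typed_flags \<tau> P) = count 0 P + count \<tau> P"
    unfolding eq using fin by (simp add: card_Un_disjoint)
qed

lemma typed_flags_side:
  assumes "\<tau> \<in> {1, 2}"
  shows "(t, i, j) \<in> typed_flags \<tau> P \<longleftrightarrow> (\<exists>u \<sigma>. side t i j u \<sigma>) \<and> V t i = P \<and> i + j = \<tau>"
proof
  assume "(t, i, j) \<in> typed_flags \<tau> P"
  then have "t \<in> I" "V t i = P" "i < 3" "j < 3" "i \<noteq> j" "i + j = \<tau>"
    using assms by (auto simp: typed_flags_def)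
  then show "(\<exists>u \<sigma>. side t i j u \<sigma>) \<and> V t i = P \<and> i + j = \<tau>" using side_ex by blast
next
  assume a: "(\<exists>u \<sigma>. side t i j u \<sigma>) \<and> V t i = P \<and> i + j = \<tau>"
  then obtain u \<sigma> where s: "side t i j u \<sigma>" by blast
  have "i = 0 \<and> j = \<tau> \<or> i = \<tau> \<and> j = 0" using a sideD(6)[OF s] assms by auto
  then show "(t, i, j) \<in> typed_flags \<tau> P" using sideD(1)[OF s] a by (auto simp: typed_flags_def)
qed

text \<open>As no tile side passes through \<open>P\<close>, every side of type \<tau> starting at
  \<open>P\<close> has another side starting at \<open>P\<close> directly across it. Without
  mismatches this would pair off the sides of type \<tau>, making their number even.\<close>

lemma mismatch_at_odd:
  assumes tau: "\<tau> \<in> {1, 2}" and P: "P \<in> tri_int W" "through P = 0" and odd: "odd (count 0 P + count \<tau> P)"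
  shows "\<exists>t i j u \<sigma>. mismatch \<tau> t i j u \<sigma> \<and> V t i = P"
proof (rule ccontr)
  assume no: "\<not> ?thesis"
  define R where "R f g \<longleftrightarrow> (\<exists>t i j t' i' j' u \<sigma>. f = (t, i, j) \<and> g = (t', i', j') \<and> side t i j u \<sigma>
      \<and> side t' i' j' u (- \<sigma>) \<and> V t i = P \<and> V t' i' = P)" for f g
  have "even (card (typed_flags \<tau> P))"
  proof (rule even_card_matching[where R = R])
    show "finite (typed_flags \<tau> P)" by (rule typed_flags_card(1)[OF tau])
    show "\<exists>y\<in>typed_flags \<tau> P. R x y" if x: "x \<in> typed_flags \<tau> P" for x
    proof -
      obtain t i j where x': "x = (t, i, j)" by (cases x)
      obtain u \<sigma> where s: "side t i j u \<sigma>" and V: "V t i = P" "i + j = \<tau>"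
        using x typed_flags_side[OF tau] unfolding x' by blast
      have "u \<in> cone_open W (V t i + 0 *\<^sub>R u)" using V P(1) by (simp add: cone_open_int)
      from side_opposite[OF s order_refl sideD(8)[OF s] this] obtain t' i' j' m'
        where o: "side t' i' j' u (- \<sigma>)" "P = V t' i' + m' *\<^sub>R u" "0 \<le> m'" "m' < len (i' + j')"
        using V by auto
      have "m' = 0"
      proof (rule ccontr)
        assume "m' \<noteq> 0"
        then have "P \<in> tri_edges (V t')" using side_inner_edge(2)[OF o(1)] o by auto
        then show False
          using P(2) sideD(1)[OF o(1)] finite_I unfolding through_def by auto
      qed
      then have V': "V t' i' = P" using o(2) by simp
      moreover have "i' + j' = \<tau>"
      proof (rule ccontr)
        assume "i' + j' \<noteq> \<tau>"
        then have "mismatch \<tau> t i j u \<sigma>" unfolding mismatch_def using s V V' o(1) by metis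
        then show False using no V(1) by blast
      qed
      ultimately have "(t', i', j') \<in> typed_flags \<tau> P" using typed_flags_side[OF tau] o(1) by blast
      moreover have "R x (t', i', j')" unfolding R_def x' using s o(1) V(1) V' by blast
      ultimately show ?thesis by blast
    qed
    show "R y x" if "R x y" for x y
      using that unfolding R_def by (metis minus_minus)
    show "y = z" if "R x y" "R x z" for x y z
    proof -
      obtain t i j t' i' j' u \<sigma> where a: "x = (t, i, j)" "y = (t', i', j')" "side t i j u \<sigma>"
          "side t' i' j' u (- \<sigma>)" "V t' i' = P" using \<open>R x y\<close> unfolding R_def by blast
      obtain t2 i2 j2 u2 \<sigma>2 where b: "z = (t2, i2, j2)" "side t i j u2 \<sigma>2"
          "side t2 i2 j2 u2 (- \<sigma>2)" "V t2 i2 = P" using \<open>R x z\<close> unfolding R_def a(1) by blast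
      have "u2 = u" "\<sigma>2 = \<sigma>" using side_det[OF a(3) b(2)] by auto
      then show ?thesis
        using side_unique[OF a(4), of t2 i2 j2 0 0] b a sideD(8)[OF a(4)] sideD(8)[OF b(3)] by simp
    qed
    show "\<not> R x x" for x
    proof
      assume "R x x"
      then obtain t i j u \<sigma> where s: "side t i j u \<sigma>" "side t i j u (- \<sigma>)" unfolding R_def by blast
      then have "\<sigma> = - \<sigma>" using side_det by blast
      then show False using sideD(10)[OF s(1)] by auto
    qed
  qed
  then show False using odd typed_flags_card(2)[OF tau] by simp
qed

text \<open>One of the two sides of type \<tau> at \<open>Q\<close> is the last of the run. The
  other is neither that side nor a continuation of the run, so the side across it is not the one
  containing \<open>Q\<close> inside, and hence starts at \<open>Q\<close>. It is not of type
  \<tau>: the only candidate, the last side of the run, has no flag across from it.\<close>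

lemma mismatch_at_landing:
  assumes tau: "\<tau> \<in> {1, 2}" and land: "landing \<tau> P u \<sigma> n Q" and two: "count 0 Q + count \<tau> Q = 2"
  shows "\<exists>t i j u \<sigma>. mismatch \<tau> t i j u \<sigma> \<and> V t i = Q"
proof -
  have L: "1 \<le> n" "Q = P + (real n * len \<tau>) *\<^sub>R u" "\<not> typed_flag \<tau> u \<sigma> Q" "typed_flag \<tau> (- u) (- \<sigma>) Q"
      "Q \<in> tri_int W" "through Q = 1" "\<not> flag (- u) \<sigma> Q"
    using land unfolding landing_def by auto
  obtain s a b m where s: "side s a b u (- \<sigma>)" "Q = V s a + m *\<^sub>R u" "0 < m" "m < len (a + b)"
    using land unfolding landing_def by blast
  obtain t1 i1 j1 where f1: "side t1 i1 j1 (- u) (- \<sigma>)" "V t1 i1 = Q" "i1 + j1 = \<tau>"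
    using L(4) unfolding typed_flag_def by blast
  have "card (typed_flags \<tau> Q) = 2" using typed_flags_card(2)[OF tau] two by simp
  then obtain x y where xy: "typed_flags \<tau> Q = {x, y}" "x \<noteq> y" by (auto simp: card_2_iff)
  have m1: "(t1, i1, j1) \<in> typed_flags \<tau> Q" using typed_flags_side[OF tau] f1 by blast
  define f where "f = (if x = (t1, i1, j1) then y else x)"
  have f: "f \<in> typed_flags \<tau> Q" "f \<noteq> (t1, i1, j1)" "typed_flags \<tau> Q = {(t1, i1, j1), f}"
    using m1 xy by (auto simp: f_def)
  obtain t i j where ft: "f = (t, i, j)" by (cases f)
  obtain u2 \<sigma>2 where f2: "side t i j u2 \<sigma>2" "V t i = Q" "i + j = \<tau>"
    using f(1) typed_flags_side[OF tau] unfolding ft by blast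
  have ne1: "\<not> (u2 = u \<and> \<sigma>2 = \<sigma>)" using L(3) f2 unfolding typed_flag_def by blast
  have ne2: "\<not> (u2 = - u \<and> \<sigma>2 = - \<sigma>)"
  proof
    assume "u2 = - u \<and> \<sigma>2 = - \<sigma>"
    then show False
      using side_unique[OF f1(1), of t i j 0 0] f2 f1 f(2) sideD(8)[OF f2(1)] sideD(8)[OF f1(1)] ft by simp
  qed
  have "u2 \<in> cone_open W (V t i + 0 *\<^sub>R u2)" using f2(2) L(5) by (simp add: cone_open_int)
  from side_opposite[OF f2(1) order_refl sideD(8)[OF f2(1)] this] obtain t' i' j' m'
    where o: "side t' i' j' u2 (- \<sigma>2)" "Q = V t' i' + m' *\<^sub>R u2" "0 \<le> m'" "m' < len (i' + j')"
    using f2(2) by auto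
  have "m' = 0"
  proof (rule ccontr)
    assume "m' \<noteq> 0"
    then have "0 < m'" using o(3) by simp
    from through_line[OF L(6) s o(1,2) this o(4)] show False using ne1 ne2 by auto
  qed
  then have V': "V t' i' = Q" using o(2) by simp
  have "i' + j' \<noteq> \<tau>"
  proof
    assume "i' + j' = \<tau>"
    then have "(t', i', j') \<in> typed_flags \<tau> Q" using typed_flags_side[OF tau] o(1) V' by blast
    then consider "(t', i', j') = (t1, i1, j1)" | "(t', i', j') = (t, i, j)" using f(3) ft by auto
    then show False
    proof cases
      case 1
      then have "u2 = - u" "- \<sigma>2 = - \<sigma>" using side_det[OF o(1), of "- u" "- \<sigma>"] f1(1) by auto
      then have "flag (- u) \<sigma> Q" using f2 unfolding flag_def by auto
      then show False using L(7) by blast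
    next
      case 2
      then have "\<sigma>2 = - \<sigma>2" using side_det[OF o(1), of u2 \<sigma>2] f2(1) by auto
      then show False using sideD(10)[OF f2(1)] by auto
    qed
  qed
  then have "mismatch \<tau> t i j u2 \<sigma>2" unfolding mismatch_def using f2 o(1) V' by metis
  then show ?thesis using f2(2) by blast
qed

end

section \<open>Counting vertices\<close>

context tri_tiling
begin

definition vertex_set :: "point set" where
  "vertex_set = (\<lambda>(t, i). V t i) ` (I \<times> {0, 1, 2})"

lemma finite_vertex_set: "finite vertex_set"
  unfolding vertex_set_def using finite_I by simp

lemma vertex_setI: "t \<in> I \<Longrightarrow> i < 3 \<Longrightarrow> V t i \<in> vertex_set"
  unfolding vertex_set_def using less_3_cases[of i] by force

lemma vertex_setD:
  assumes "P \<in> vertex_set"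
  shows "\<exists>t i. t \<in> I \<and> i < 3 \<and> V t i = P"
proof -
  have "\<exists>x\<in>I \<times> {0, 1, 2}. P = V (fst x) (snd x)"
    using assms unfolding vertex_set_def image_iff case_prod_beta .
  then obtain x where "x \<in> I \<times> {0, 1, 2}" "P = V (fst x) (snd x)" by blast
  then show ?thesis by (intro exI[of _ "fst x"] exI[of _ "snd x"]) auto
qed

lemma vertex_set_subset: "vertex_set \<subseteq> tri W"
  unfolding vertex_set_def using tri_vertex_mem tile_subset by fastforce

text \<open>Vertices of the first kind and landing points of type \<open>\<alpha>\<beta>\<gamma>\<close> carry mismatched sides, while there are
  exactly as many landing points as mismatched sides.\<close>
lemma star_bound:
  assumes tau: "\<tau> \<in> {1, 2}" and nr: "no_relation \<tau>"
    and cls: "\<And>Q. Q \<in> tri_int W \<Longrightarrow>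
      real (count 0 Q) * ang 0 + real (count 1 Q) * ang 1 + real (count 2 Q) * ang 2 = pi \<Longrightarrow>
      count 0 Q = 3 \<and> count 1 Q = 2 \<and> count 2 Q = 0 \<or> count 0 Q = 1 \<and> count 1 Q = 1 \<and> count 2 Q = 1"
  shows "card {P \<in> vertex_set. P \<in> tri_int W \<and> through P = 0 \<and> count 0 P = 0 \<and> count 1 P = 1 \<and> count 2 P = 3}
    \<le> card {P \<in> vertex_set. P \<in> tri_int W \<and> count 0 P = 3 \<and> count 1 P = 2 \<and> count 2 P = 0}"
    (is "card ?S \<le> card ?T")
proof -
  \<comment> \<open>A tile with an ordered pair of vertices determines \<open>u\<close> and
    \<sigma>, so triples suffice to count mismatched sides.\<close>
  define F where "F = {(t, i, j). \<exists>u \<sigma>. mismatch \<tau> t i j u \<sigma>}"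
  have "F \<subseteq> I \<times> {..<3} \<times> {..<3}"
    unfolding F_def mismatch_def using sideD(1,4,5) by fastforce
  then have finF: "finite F" using finite_I finite_subset by blast
  define base where "base = (\<lambda>(t, i, j::nat). V t i)"
  have "\<exists>Q u \<sigma> n. mismatch \<tau> (fst f) (fst (snd f)) (snd (snd f)) u \<sigma> \<and> landing \<tau> (V (fst f) (fst (snd f))) u \<sigma> n Q"
    if "f \<in> F" for f
    using that landing_exists[OF nr] unfolding F_def by fastforce
  then obtain \<phi> where phi: "\<And>f. f \<in> F \<Longrightarrow> \<exists>u \<sigma> n. mismatch \<tau> (fst f) (fst (snd f)) (snd (snd f)) u \<sigma>
      \<and> landing \<tau> (V (fst f) (fst (snd f))) u \<sigma> n (\<phi> f)"
    by metis
  have "inj_on \<phi> F"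
  proof (rule inj_onI)
    fix f g assume fg: "f \<in> F" "g \<in> F" "\<phi> f = \<phi> g"
    obtain u \<sigma> n where f: "mismatch \<tau> (fst f) (fst (snd f)) (snd (snd f)) u \<sigma>"
        "landing \<tau> (V (fst f) (fst (snd f))) u \<sigma> n (\<phi> f)" using phi[OF fg(1)] by blast
    obtain u' \<sigma>' n' where g: "mismatch \<tau> (fst g) (fst (snd g)) (snd (snd g)) u' \<sigma>'"
        "landing \<tau> (V (fst g) (fst (snd g))) u' \<sigma>' n' (\<phi> f)" using phi[OF fg(2)] fg(3) by auto
    show "f = g" using landing_inj[OF f(1) g(1) f(2) g(2)] by (simp add: prod_eq_iff)
  qed
  then have cardF: "card (\<phi> ` F) = card F" by (rule card_image)
  have land: "\<exists>P u \<sigma> n. landing \<tau> P u \<sigma> n Q" if "Q \<in> \<phi> ` F" for Q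
    using that phi by blast
  define A1 where "A1 = {Q \<in> \<phi> ` F. count 0 Q = 1 \<and> count 1 Q = 1 \<and> count 2 Q = 1}"
  define A3 where "A3 = {Q \<in> \<phi> ` F. count 0 Q = 3 \<and> count 1 Q = 2 \<and> count 2 Q = 0}"
  have fin: "finite A1" "finite A3" using finF by (auto simp: A1_def A3_def)
  have "\<phi> ` F \<subseteq> A1 \<union> A3"
  proof
    fix Q assume Q: "Q \<in> \<phi> ` F"
    then obtain P u \<sigma> n where "landing \<tau> P u \<sigma> n Q" using land by blast
    then have "Q \<in> tri_int W"
      "real (count 0 Q) * ang 0 + real (count 1 Q) * ang 1 + real (count 2 Q) * ang 2 = pi"
      unfolding landing_def by blast+
    from cls[OF this] have "count 0 Q = 3 \<and> count 1 Q = 2 \<and> count 2 Q = 0 \<or> count 0 Q = 1 \<and> count 1 Q = 1 \<and> count 2 Q = 1"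
      .
    then show "Q \<in> A1 \<union> A3" using Q by (auto simp: A1_def A3_def)
  qed
  then have "card (\<phi> ` F) \<le> card (A1 \<union> A3)" using fin by (intro card_mono) auto
  also have "\<dots> \<le> card A1 + card A3" by (rule card_Un_le)
  finally have 1: "card F \<le> card A1 + card A3" using cardF by simp
  have base: "V t i \<in> base ` F" if "mismatch \<tau> t i j u \<sigma>" for t i j u \<sigma>
    using that unfolding base_def F_def by force
  have "?S \<union> A1 \<subseteq> base ` F"
  proof
    fix P assume "P \<in> ?S \<union> A1"
    then consider "P \<in> ?S" | "P \<in> A1" by blast
    then have "\<exists>t i j u \<sigma>. mismatch \<tau> t i j u \<sigma> \<and> V t i = P"
    proof cases
      case 1
      then have "odd (count 0 P + count \<tau> P)" using tau by auto
      then show ?thesis using mismatch_at_odd[OF tau] 1 by blast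
    next
      case 2
      then have "count 0 P + count \<tau> P = 2" using tau by (auto simp: A1_def)
      moreover obtain P' u \<sigma> n where "landing \<tau> P' u \<sigma> n P" using land 2 unfolding A1_def by blast
      ultimately show ?thesis using mismatch_at_landing[OF tau] by blast
    qed
    then show "P \<in> base ` F" using base by blast
  qed
  then have "card (?S \<union> A1) \<le> card (base ` F)" using finF by (intro card_mono) auto
  also have "\<dots> \<le> card F" by (rule card_image_le[OF finF])
  finally have 2: "card (?S \<union> A1) \<le> card F" .
  have "?S \<inter> A1 = {}" by (auto simp: A1_def)
  then have "card (?S \<union> A1) = card ?S + card A1"
    using fin finite_vertex_set by (intro card_Un_disjoint) auto
  \<comment> \<open>Together, \<open>card ?S + card A1 \<le> card F \<le> card A1 + card A3\<close>,
    and the contribution of \<open>A1\<close> cancels.\<close>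
  then have "card ?S \<le> card A3" using 1 2 by linarith
  also have "card A3 \<le> card ?T"
  proof (rule card_mono)
    show "finite ?T" using finite_vertex_set by simp
    show "A3 \<subseteq> ?T"
    proof
      fix Q assume Q: "Q \<in> A3"
      then obtain P u \<sigma> n where l: "landing \<tau> P u \<sigma> n Q" using land unfolding A3_def by blast
      then obtain t i j where "side t i j (- u) (- \<sigma>)" "V t i = Q" unfolding landing_def typed_flag_def by blast
      then have "Q \<in> vertex_set" using vertex_setI sideD(1,4) by blast
      moreover have "Q \<in> tri_int W" using l unfolding landing_def by blast
      ultimately show "Q \<in> ?T" using Q by (simp add: A3_def)
    qed
  qed
  finally show ?thesis .
qed

text \<open>Each tile has exactly one vertex \<open>i\<close>. Any finite superset of the vertices
  may be summed over, as the further points count 0.\<close>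

lemma sum_count:
  assumes "i < 3" "finite A" "vertex_set \<subseteq> A"
  shows "(\<Sum>P\<in>A. count i P) = card I"
proof -
  have "(\<Sum>P\<in>A. \<Sum>t\<in>{t\<in>I. V t i = P}. 1) = (\<Sum>t\<in>I. 1::nat)"
    by (rule sum.group) (use finite_I assms vertex_setI in auto)
  then show ?thesis by (simp add: count_def)
qed

end

section \<open>Counting angles when \<open>3\<alpha> + 2\<beta> = \<pi>\<close>\<close>

locale triquadratic_tiling = tri_tiling +
  assumes angle_rel: "3 * ang 0 + 2 * ang 1 = pi" "ang 2 = 2 * ang 0 + ang 1"
    and angles_W: "tri_angle W 0 = 2 * ang 0" "tri_angle W 1 = ang 1" "tri_angle W 2 = ang 0 + ang 1"
begin

lemma ang_pos: "0 < ang 0" "0 < ang 1" "0 < ang 2"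
  using ang_bounds[OF I_nonempty] by auto

lemma angle_parts_nonneg:
  "0 \<le> real n * ang 0" "0 \<le> real n * ang 1" "0 \<le> real n * ang 2" "0 \<le> real n * pi" "0 \<le> real n * (2 * pi)"
  using ang_pos by auto

lemma angle_at_corner: "i < 3 \<Longrightarrow> angle_measure (cone_open W (W i)) = tri_angle W i"
  by (rule angle_measure_vertex(1)[OF nondeg_W])

lemma corner_angle_less:
  assumes "i < 3"
  shows "tri_angle W i < ang 2"
  using less_3_cases[OF assms] angles_W angle_rel ang_pos by (elim disjE) simp_all

lemma no_gamma_at_corner:
  assumes "i < 3"
  shows "count 2 (W i) = 0"
proof (rule ccontr)
  assume "count 2 (W i) \<noteq> 0"
  then have "1 * ang 2 \<le> real (count 2 (W i)) * ang 2" using ang_pos by (intro mult_right_mono) auto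
  then show False
    using angle_sum[OF tri_vertex_mem[OF assms]] angle_parts_nonneg(1)[of "count 0 (W i)"]
      angle_parts_nonneg(2)[of "count 1 (W i)"] angle_parts_nonneg(4)[of "through (W i)"]
      angle_parts_nonneg(5)[of "card {t\<in>I. W i \<in> tri_int (V t)}"]
      angle_at_corner[OF assms] corner_angle_less[OF assms] by linarith
qed

text \<open>Twice \<gamma> is \<open>4\<alpha> + 2\<beta>\<close>, which exceeds the straight angle
  \<open>3\<alpha> + 2\<beta>\<close>.\<close>

lemma gamma_on_edge:
  assumes "P \<in> tri_edges W"
  shows "count 2 P \<le> 1"
proof (rule ccontr)
  assume "\<not> count 2 P \<le> 1"
  then have "2 * ang 2 \<le> real (count 2 P) * ang 2" using ang_pos by (intro mult_right_mono) auto
  moreover have "P \<in> tri W" using assms tri_edge_subset[OF nondeg_W] by (auto simp: tri_edges_def)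
  note angle_sum[OF this]
  ultimately show False
    using angle_parts_nonneg(1)[of "count 0 P"] angle_parts_nonneg(2)[of "count 1 P"]
      angle_parts_nonneg(4)[of "through P"] angle_parts_nonneg(5)[of "card {t\<in>I. P \<in> tri_int (V t)}"]
      angle_measure_edge[OF nondeg_W assms] angle_rel ang_pos by linarith
qed

lemma side_lengths:
  assumes "i < 3" "j < 3" "i \<noteq> j"
  shows "\<exists>c :: nat \<Rightarrow> nat. dist (W i) (W j) = real (c 1) * len 1 + real (c 2) * len 2 + real (c 3) * len 3 \<and> 0 < c 1 + c 2"
proof -
  obtain u \<sigma> where s: "tri_side W i j u \<sigma> (dist (W i) (W j))"
    using tri_side_ex[OF nondeg_W assms] by blast
  show ?thesis
  proof (rule W_side_counts[OF s no_gamma_at_corner[OF assms(1)] no_gamma_at_corner[OF assms(2)]])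
    fix y assume "0 < y" "y < dist (W i) (W j)"
    then have "W i + y *\<^sub>R u \<in> tri_edges W"
      using tri_side_edge[OF nondeg_W s] third_less(1)[OF assms] unfolding tri_edges_def by blast
    then show "count 2 (W i + y *\<^sub>R u) \<le> 1" by (rule gamma_on_edge)
  qed
qed

text \<open>The full angle at \<open>P\<close> is \<open>pi\<close> or \<open>2 * pi\<close>. Tiles
  containing \<open>P\<close> otherwise than as a vertex remove multiples of \<open>pi\<close> from
  it, and a positive angle must remain.\<close>

lemma vertex_angle_sum:
  assumes "P \<in> vertex_set" "\<And>i. i < 3 \<Longrightarrow> P \<noteq> W i"
  defines "S \<equiv> real (count 0 P) * ang 0 + real (count 1 P) * ang 1 + real (count 2 P) * ang 2"
  shows "S = pi \<or> S = 2 * pi \<and> P \<in> tri_int W \<and> through P = 0"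
proof -
  obtain t i where ti: "t \<in> I" "i < 3" "V t i = P"
    using vertex_setD[OF assms(1)] by blast
  have PW: "P \<in> tri W" using assms(1) vertex_set_subset by blast
  define n where "n = card {t\<in>I. P \<in> tri_int (V t)}"
  have sum: "S + real (through P) * pi + real n * (2 * pi) = angle_measure (cone_open W P)"
    using angle_sum[OF PW] by (simp add: S_def n_def)
  have "0 < count i P" by (rule count_pos[OF ti(1,3)])
  then have pos: "0 < real (count i P) * ang i" using ang_bounds[OF I_nonempty ti(2)] by simp
  from less_3_cases[OF ti(2)] consider "i = 0" | "i = 1" | "i = 2" by blast
  then have S: "0 < S"
  proof cases
    case 1
    then show ?thesis using pos angle_parts_nonneg[of "count 1 P"] angle_parts_nonneg[of "count 2 P"] unfolding S_def 1 by linarith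
  next
    case 2
    then show ?thesis using pos angle_parts_nonneg[of "count 0 P"] angle_parts_nonneg[of "count 2 P"] unfolding S_def 2 by linarith
  next
    case 3
    then show ?thesis using pos angle_parts_nonneg[of "count 1 P"] angle_parts_nonneg[of "count 0 P"] unfolding S_def 3 by linarith
  qed
  have arith: "S = pi \<and> k = 1 \<or> S = pi \<and> k = 2 \<and> through P = 1 \<or> S = 2 * pi \<and> k = 2 \<and> through P = 0"
    if k: "k \<in> {1, 2}" "angle_measure (cone_open W P) = real k * pi" for k :: nat
  proof -
    have *: "S = (real k - real (through P) - 2 * real n) * pi" using sum k(2) by (simp add: algebra_simps)
    then have "0 < real k - real (through P) - 2 * real n" using S by (simp add: zero_less_mult_iff)
    then have "through P + 2 * n < k" by linarith
    then consider "k = 1" "through P = 0" "n = 0" | "k = 2" "through P = 0" "n = 0" | "k = 2" "through P = 1" "n = 0"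
      using k(1) by fastforce
    then show ?thesis by cases (use * in auto)
  qed
  from nondeg_W PW show ?thesis
  proof (cases rule: tri_cases)
    case 1
    then show ?thesis using arith[of 2] angle_measure_int[OF 1] by auto
  next
    case (2 k)
    then have "P \<in> tri_edges W" by (auto simp: tri_edges_def)
    then show ?thesis using arith[of 1] angle_measure_edge[OF nondeg_W] by auto
  next
    case (3 i)
    then show ?thesis using assms(2) by blast
  qed
qed

text \<open>Summing the number of \<open>\<alpha>\<close> minus the number of \<open>\<gamma>\<close> over all vertices gives \<open>0\<close>; the corners contribute
  \<open>3\<close>, and only the vertices of type \<open>\<beta>\<gamma>\<gamma>\<gamma>\<close> contribute a negative number, namely \<open>-3\<close>.\<close>
lemma relation_exists:
  assumes irr: "\<And>x y :: int. of_int x * ang 0 + of_int y * ang 1 = 0 \<Longrightarrow> x = 0 \<and> y = 0"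
    and tau: "\<tau> \<in> {1, 2}"
  shows "\<not> no_relation \<tau>"
proof
  assume nr: "no_relation \<tau>"
  \<comment> \<open>Replacing \<open>ang 2\<close> by \<open>2 * ang 0 + ang 1\<close> and using
    independence compares the coefficients of the two remaining angles.\<close>
  have cls: "p + 2 * r = a \<and> q + r = b"
    if "real p * ang 0 + real q * ang 1 + real r * ang 2 = real a * ang 0 + real b * ang 1" for p q r a b :: nat
  proof -
    have "of_int (int p + 2 * int r - int a) * ang 0 + of_int (int q + int r - int b) * ang 1 = 0"
      using that angle_rel(2) by (simp add: algebra_simps)
    from irr[OF this] show ?thesis by linarith
  qed
  have pi_eq: "pi = real 3 * ang 0 + real 2 * ang 1" "2 * pi = real 6 * ang 0 + real 4 * ang 1"
    using angle_rel by auto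
  let ?S = "{P \<in> vertex_set. P \<in> tri_int W \<and> through P = 0 \<and> count 0 P = 0 \<and> count 1 P = 1 \<and> count 2 P = 3}"
  let ?T = "{P \<in> vertex_set. P \<in> tri_int W \<and> count 0 P = 3 \<and> count 1 P = 2 \<and> count 2 P = 0}"
  have bound: "card ?S \<le> card ?T"
  proof (rule star_bound[OF tau nr])
    fix Q assume "real (count 0 Q) * ang 0 + real (count 1 Q) * ang 1 + real (count 2 Q) * ang 2 = pi"
    from cls[OF this[unfolded pi_eq(1)]]
    show "count 0 Q = 3 \<and> count 1 Q = 2 \<and> count 2 Q = 0 \<or> count 0 Q = 1 \<and> count 1 Q = 1 \<and> count 2 Q = 1"
      by presburger
  qed
  define C where "C = {W 0, W 1, W 2}"
  \<comment> \<open>With the corners adjoined, it need not be shown separately that they are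
    vertices of tiles.\<close>
  define A where "A = vertex_set \<union> C"
  define d where "d P = int (count 0 P) - int (count 2 P)" for P
  have fin: "finite A" "finite C" using finite_vertex_set by (auto simp: A_def C_def)
  have "(\<Sum>P\<in>A. d P) = int (\<Sum>P\<in>A. count 0 P) - int (\<Sum>P\<in>A. count 2 P)"
    by (simp add: d_def sum_subtractf)
  also have "\<dots> = 0"
    using sum_count[of 0 A] sum_count[of 2 A] fin(1) by (simp add: A_def)
  finally have zero: "(\<Sum>P\<in>A. d P) = 0" .
  have corner: "real (count 0 (W i)) * ang 0 + real (count 1 (W i)) * ang 1 + real (count 2 (W i)) * ang 2 = tri_angle W i"
    if i: "i < 3" for i
  proof -
    have "tri_angle W i < pi" by (rule angle_measure_vertex(3)[OF nondeg_W i])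
    moreover define n where "n = card {t\<in>I. W i \<in> tri_int (V t)}"
    note sum = angle_sum[OF tri_vertex_mem[OF i], folded n_def, unfolded angle_at_corner[OF i]]
    have "\<not> 1 \<le> through (W i)" "\<not> 1 \<le> n"
    proof -
      show "\<not> 1 \<le> through (W i)"
      proof
        assume "1 \<le> through (W i)"
        then have "1 * pi \<le> real (through (W i)) * pi" by (intro mult_right_mono) auto
        then show False
          using sum calculation angle_parts_nonneg(1)[of "count 0 (W i)"] angle_parts_nonneg(2)[of "count 1 (W i)"]
            angle_parts_nonneg(3)[of "count 2 (W i)"] angle_parts_nonneg(5)[of n] by linarith
      qed
      show "\<not> 1 \<le> n"
      proof
        assume "1 \<le> n"
        then have "1 * (2 * pi) \<le> real n * (2 * pi)" by (intro mult_right_mono) auto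
        then show False
          using sum calculation angle_parts_nonneg(1)[of "count 0 (W i)"] angle_parts_nonneg(2)[of "count 1 (W i)"]
            angle_parts_nonneg(3)[of "count 2 (W i)"] angle_parts_nonneg(4)[of "through (W i)"] pi_gt_zero by linarith
      qed
    qed
    then have "through (W i) = 0" "n = 0" by auto
    then show ?thesis using sum by simp
  qed
  have "d (W 0) = 2"
    using cls[of "count 0 (W 0)" "count 1 (W 0)" "count 2 (W 0)" 2 0] corner[of 0] angles_W(1) by (simp add: d_def)
  moreover have "d (W 1) = 0"
    using cls[of "count 0 (W 1)" "count 1 (W 1)" "count 2 (W 1)" 0 1] corner[of 1] angles_W(2) by (simp add: d_def)
  moreover have "d (W 2) = 1"
    using cls[of "count 0 (W 2)" "count 1 (W 2)" "count 2 (W 2)" 1 1] corner[of 2] angles_W(3)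
      no_gamma_at_corner[of 2] by (simp add: d_def)
  moreover have "W 0 \<noteq> W 1" "W 0 \<noteq> W 2" "W 1 \<noteq> W 2"
    using tri_parts_disjoint(4)[OF nondeg_W, of 0 1] tri_parts_disjoint(4)[OF nondeg_W, of 0 2]
      tri_parts_disjoint(4)[OF nondeg_W, of 1 2] by auto
  ultimately have sumC: "(\<Sum>P\<in>C. d P) = 3" by (simp add: C_def)
  \<comment> \<open>With angle sum \<open>pi\<close> the value of \<open>d\<close> is 3 or 0; with
    \<open>2 * pi\<close> it is 6, 3, 0 or -3, the last only on \<open>?S\<close>. On
    \<open>?T\<close> it is 3.\<close>
  have ge: "(if P \<in> ?T then 3 else 0) - (if P \<in> ?S then 3 else 0) \<le> d P" if P: "P \<in> A - C" for P
  proof -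
    have PV: "P \<in> vertex_set" and "\<And>i. i < 3 \<Longrightarrow> P \<noteq> W i"
      using P less_3_cases unfolding A_def C_def by auto
    from vertex_angle_sum[OF this] show ?thesis
    proof
      assume "real (count 0 P) * ang 0 + real (count 1 P) * ang 1 + real (count 2 P) * ang 2 = pi"
      from cls[OF this[unfolded pi_eq(1)]] have "count 0 P + 2 * count 2 P = 3" "count 1 P + count 2 P = 2" by auto
      then have "count 2 P = 0 \<and> count 0 P = 3 \<or> count 2 P = 1 \<and> count 0 P = 1" by presburger
      then show ?thesis by (auto simp: d_def)
    next
      assume a: "real (count 0 P) * ang 0 + real (count 1 P) * ang 1 + real (count 2 P) * ang 2 = 2 * pi
          \<and> P \<in> tri_int W \<and> through P = 0"
      from a have "real (count 0 P) * ang 0 + real (count 1 P) * ang 1 + real (count 2 P) * ang 2 = 2 * pi" by blast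
      from cls[OF this[unfolded pi_eq(2)]] have c: "count 0 P + 2 * count 2 P = 6" "count 1 P + count 2 P = 4" by auto
      then have "P \<in> ?S" if "count 2 P = 3" using PV a that by simp
      moreover have "count 2 P = 0 \<and> count 0 P = 6 \<or> count 2 P = 1 \<and> count 0 P = 4 \<or> count 2 P = 2 \<and> count 0 P = 2
          \<or> count 2 P = 3 \<and> count 0 P = 0" using c(1) by presburger
      ultimately show ?thesis by (auto simp: d_def)
    qed
  qed
  have notC: "?S \<subseteq> A - C" "?T \<subseteq> A - C"
    using tri_parts_disjoint(2)[OF nondeg_W] unfolding A_def C_def by auto
  have "3 * int (card ?T) - 3 * int (card ?S) = (\<Sum>P\<in>A - C. if P \<in> ?T then 3 else 0) - (\<Sum>P\<in>A - C. if P \<in> ?S then 3 else 0)"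
    using notC fin(1) by (simp add: sum.If_cases Int_absorb1)
  also have "\<dots> = (\<Sum>P\<in>A - C. (if P \<in> ?T then 3 else 0) - (if P \<in> ?S then 3 else 0))"
    by (simp add: sum_subtractf)
  also have "\<dots> \<le> (\<Sum>P\<in>A - C. d P)"
    by (rule sum_mono) (rule ge)
  also have "\<dots> = - 3"
    using zero sumC sum.subset_diff[of C A d] fin(1) by (simp add: A_def)
  finally show False using bound by linarith
qed

end

section \<open>Algebraic integers with bounded conjugates\<close>

text \<open>Polymorphic, so that one integer polynomial can be evaluated both at the real number
  \<open>s\<close> and at its complex conjugates.\<close>

definition int_eval :: "int poly \<Rightarrow> 'a::{comm_ring_1,ring_char_0} \<Rightarrow> 'a" where
  "int_eval p x = poly (map_poly of_int p) x"

lemma int_eval_simps [simp]: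
  "int_eval 0 x = 0" "int_eval (pCons a p) x = of_int a + x * int_eval p x"
  by (simp_all add: int_eval_def map_poly_pCons)

lemma int_eval_add [simp]: "int_eval (p + q) x = int_eval p x + int_eval q x"
proof -
  have "map_poly of_int (p + q) = map_poly of_int p + (map_poly of_int q :: 'a poly)"
    by (intro poly_eqI) (simp add: coeff_map_poly)
  then show ?thesis by (simp add: int_eval_def)
qed

lemma int_eval_smult [simp]: "int_eval (smult c p) x = of_int c * int_eval p x"
  by (induction p) (simp_all add: algebra_simps)

lemma int_eval_mult [simp]: "int_eval (p * q) x = int_eval p x * int_eval q x"
  by (induction p) (simp_all add: algebra_simps mult_pCons_left)

lemma int_eval_minus [simp]: "int_eval (- p) x = - int_eval p x"
  using int_eval_smult[of "-1" p x] by simp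

lemma int_eval_diff [simp]: "int_eval (p - q) x = int_eval p x - int_eval q x"
  using int_eval_add[of p "- q" x] by simp

lemma int_eval_of_real: "int_eval p (complex_of_real x) = complex_of_real (int_eval p x)"
  by (induction p) simp_all

text \<open>The two values are conjugate in the ring generated by \<open>sqrt 2\<close>, so their
  product is the integer \<open>A\<^sup>2 - 2 * B\<^sup>2\<close>.\<close>

lemma int_eval_at_root2:
  "\<exists>A B :: int. int_eval p (sqrt 2) = of_int A + of_int B * sqrt 2 \<and> int_eval p (- sqrt 2) = of_int A - of_int B * sqrt 2"
proof (induction p)
  case 0
  show ?case by (intro exI[of _ 0]) simp
next
  case (pCons a p)
  then obtain A B :: int where AB: "int_eval p (sqrt 2) = of_int A + of_int B * sqrt 2"
      "int_eval p (- sqrt 2) = of_int A - of_int B * sqrt 2" by blast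
  show ?case
    unfolding int_eval_simps AB
    by (intro exI[of _ "a + 2 * B"] exI[of _ A]) (simp add: algebra_simps)
qed

text \<open>Take a polynomial of least degree and make it primitive. Pseudo-division shows that it
  divides an integer multiple of each \<open>g\<close>, and Gauss's lemma removes the multiple.
  Dividing the monic \<open>h\<close> makes it monic up to sign, and a zero constant term would
  allow a smaller degree.\<close>

lemma minimal_int_poly:
  fixes s :: real
  assumes "h \<noteq> 0" "int_eval h s = 0" "lead_coeff h = 1" "s \<noteq> 0"
  obtains f where "int_eval f s = 0" "f \<noteq> 0" "coeff f 0 \<noteq> 0" "\<bar>lead_coeff f\<bar> = 1"
    "\<And>g. int_eval g s = 0 \<Longrightarrow> f dvd g"
proof -
  define Q where "Q n \<longleftrightarrow> (\<exists>p. p \<noteq> 0 \<and> int_eval p s = 0 \<and> degree p = n)" for n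
  have "\<exists>n. Q n" using assms by (auto simp: Q_def)
  then obtain n where n: "Q n" "\<And>m. m < n \<Longrightarrow> \<not> Q m" by (metis exists_least_iff)
  obtain p where p: "p \<noteq> 0" "int_eval p s = 0" "degree p = n" using n(1) by (auto simp: Q_def)
  define f where "f = primitive_part p"
  have pf: "p = smult (content p) f" by (simp add: f_def)
  have c: "content p \<noteq> 0" using p(1) by simp
  have f: "f \<noteq> 0" "content f = 1" "degree f = n"
    using p by (auto simp: f_def)
  have "of_int (content p) * int_eval f s = 0" using p(2) by (metis pf int_eval_smult)
  then have fs: "int_eval f s = 0" using c by simp
  have dvd: "f dvd g" if g: "int_eval g s = 0" for g
  proof -
    obtain a q where aq: "a \<noteq> 0" "smult a g = f * q + pseudo_mod g f" using pseudo_mod(1)[OF f(1)] by blast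
    have "int_eval (smult a g) s = int_eval (f * q + pseudo_mod g f) s" using aq(2) by simp
    then have r: "int_eval (pseudo_mod g f) s = 0" using g fs by simp
    have "pseudo_mod g f = 0"
    proof (rule ccontr)
      assume nz: "pseudo_mod g f \<noteq> 0"
      then have "degree (pseudo_mod g f) < n" using pseudo_mod(2)[OF f(1), of g] f(3) by simp
      then show False using n(2) nz r by (auto simp: Q_def)
    qed
    then have "f dvd smult a g" using aq(2) by simp
    then have "map_poly to_fract f dvd smult (to_fract a) (map_poly to_fract g)"
      using fract_poly_dvd fract_poly_smult by metis
    then have "map_poly to_fract f dvd map_poly to_fract g"
      using aq(1) by (simp add: dvd_smult_iff)
    then show ?thesis using fract_poly_dvdD f(2) by blast
  qed
  have "f dvd h" by (rule dvd[OF assms(2)])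
  then obtain q where "h = f * q" by (elim dvdE)
  then have "lead_coeff f * lead_coeff q = 1" using assms(3) by (simp add: lead_coeff_mult)
  then have "\<bar>lead_coeff f\<bar> = 1" by (metis zmult_eq_1_iff abs_1 abs_minus_cancel)
  moreover have "coeff f 0 \<noteq> 0"
  proof
    assume z: "coeff f 0 = 0"
    obtain a q where aq: "f = pCons a q" by (rule pCons_cases)
    then have "f = pCons 0 q" using z by simp
    then have q: "q \<noteq> 0" "int_eval q s = 0" "degree q < n" using f(1,3) fs assms(4) by (auto simp: degree_pCons_eq)
    then show False using n(2) by (auto simp: Q_def)
  qed
  ultimately show ?thesis using that[of f] fs f(1) dvd by blast
qed

lemma norm_int_eval:
  assumes "\<bar>lead_coeff f\<bar> = 1"
  shows "norm (int_eval f (y :: complex)) = (\<Prod>z | int_eval f z = 0. norm (y - z) ^ order z (map_poly of_int f))"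
proof -
  define p :: "complex poly" where "p = map_poly of_int f"
  have "lead_coeff p = of_int (lead_coeff f)"
    by (simp add: p_def coeff_map_poly degree_map_poly)
  then have "norm (lead_coeff p) = 1"
    using assms by (simp add: norm_of_int)
  moreover have "poly p y = lead_coeff p * (\<Prod>z | poly p z = 0. (y - z) ^ order z p)"
    using arg_cong[OF complex_poly_decompose[of p], of "\<lambda>q. poly q y"] by (simp add: poly_prod)
  ultimately have "norm (poly p y) = (\<Prod>z | poly p z = 0. norm (y - z) ^ order z p)"
    by (simp add: norm_mult norm_power flip: prod_norm)
  then show ?thesis by (simp add: p_def int_eval_def)
qed

text \<open>\<open>h\<close> makes \<open>s\<close> an algebraic integer with real conjugates, and
  \<open>g\<close> bounds these. Each factor \<open>x\<^sup>2 * (2 - x\<^sup>2)\<close> equals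
  \<open>1 - (1 - x\<^sup>2)\<^sup>2\<close>, hence is at most 1, and it is smaller at
  \<open>s\<close> because \<open>s\<^sup>2 \<noteq> 1\<close>. The product over all conjugates is
  nevertheless a nonzero integer up to sign.\<close>

lemma no_bounded_conjugates:
  fixes s :: real and g h :: "int poly"
  assumes h: "int_eval h s = 0" "lead_coeff h = 1" and s: "s \<noteq> 0" "s\<^sup>2 \<noteq> 1" and g: "int_eval g s = 0"
    and real_roots: "\<And>z :: complex. int_eval h z = 0 \<Longrightarrow> z \<in> \<real>"
    and bound: "\<And>x :: real. int_eval g x = 0 \<Longrightarrow> x\<^sup>2 < 2"
  shows False
proof -
  have "h \<noteq> 0" using h(2) by auto
  then obtain f where f: "int_eval f s = 0" "f \<noteq> 0" "coeff f 0 \<noteq> 0" "\<bar>lead_coeff f\<bar> = 1"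
      "\<And>g. int_eval g s = 0 \<Longrightarrow> f dvd g"
    using minimal_int_poly[OF _ h s(1)] by blast
  define Z :: "complex set" where "Z = {z. int_eval f z = 0}"
  define k where "k z = order z (map_poly of_int f :: complex poly)" for z
  have p: "map_poly of_int f \<noteq> (0 :: complex poly)"
    using f(2) by (metis coeff_map_poly leading_coeff_0_iff of_int_0 of_int_0_eq_iff poly_eq_iff coeff_0)
  have finZ: "finite Z" using poly_roots_finite[OF p] by (simp add: Z_def int_eval_def)
  have root: "\<exists>x. z = complex_of_real x \<and> int_eval f x = 0 \<and> x\<^sup>2 < 2" if "z \<in> Z" for z
  proof -
    obtain q where "h = f * q" using f(5)[OF h(1)] by (elim dvdE)
    then have "int_eval h z = 0" using that by (simp add: Z_def)
    then have "z \<in> \<real>" by (rule real_roots)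
    then obtain x where x: "z = complex_of_real x" by (auto elim: Reals_cases)
    then have fx: "int_eval f x = 0" using that by (simp add: Z_def int_eval_of_real)
    obtain q' where "g = f * q'" using f(5)[OF g] by (elim dvdE)
    then have "int_eval g x = 0" using fx by simp
    then show ?thesis using bound x fx by blast
  qed
  define r where "r = complex_of_real (sqrt 2)"
  have fac: "norm (0 - z) ^ 2 * (norm (r - z) * norm (- r - z)) = x\<^sup>2 * (2 - x\<^sup>2)"
    if "z = complex_of_real x" "x\<^sup>2 < 2" for z x
  proof -
    have "(r - z) * (- r - z) = complex_of_real (x\<^sup>2 - 2)"
      by (simp add: r_def that(1) algebra_simps power2_eq_square flip: of_real_mult)
    then have "norm (r - z) * norm (- r - z) = norm (complex_of_real (x\<^sup>2 - 2))"
      by (metis norm_mult)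
    also have "\<dots> = 2 - x\<^sup>2" unfolding norm_of_real using that(2) by simp
    finally show ?thesis using that(1) by (simp add: power_mult_distrib)
  qed
  \<comment> \<open>Evaluating \<open>f\<close> at 0 and at both square roots of 2 turns the product
    over the roots into values of an integer polynomial.\<close>
  let ?v = "norm (int_eval f (0::complex)) ^ 2 * (norm (int_eval f r) * norm (int_eval f (- r)))"
  have "?v = (\<Prod>z\<in>Z. (norm (0 - z) ^ 2 * (norm (r - z) * norm (- r - z))) ^ k z)"
    unfolding norm_int_eval[OF f(4)] Z_def[symmetric] k_def[symmetric]
    by (simp only: power_mult_distrib prod.distrib prod_power_distrib power_mult[symmetric] mult.commute)
  also have "\<dots> < 1"
  proof -
    have le: "0 \<le> (norm (0 - z) ^ 2 * (norm (r - z) * norm (- r - z))) ^ k z \<and>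
        (norm (0 - z) ^ 2 * (norm (r - z) * norm (- r - z))) ^ k z \<le> 1" if z: "z \<in> Z" for z
    proof -
      obtain x where x: "z = complex_of_real x" "x\<^sup>2 < 2" using root[OF z] by blast
      have "x\<^sup>2 * (2 - x\<^sup>2) \<le> 1" using zero_le_power2[of "1 - x\<^sup>2"] by (simp add: power2_eq_square algebra_simps)
      moreover have "0 \<le> x\<^sup>2 * (2 - x\<^sup>2)" using x(2) by simp
      ultimately show ?thesis unfolding fac[OF x] by (simp add: power_le_one)
    qed
    let ?s = "complex_of_real s"
    have sZ: "?s \<in> Z" using f(1) by (simp add: Z_def int_eval_of_real)
    then have k: "k ?s \<noteq> 0" using p by (simp add: k_def Z_def int_eval_def order_root)
    have s2: "s\<^sup>2 < 2" using bound g by blast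
    have "0 < (1 - s\<^sup>2)\<^sup>2" using s(2) by simp
    then have "s\<^sup>2 * (2 - s\<^sup>2) < 1" by (simp add: power2_eq_square algebra_simps)
    then have lt: "(norm (0 - ?s) ^ 2 * (norm (r - ?s) * norm (- r - ?s))) ^ k ?s < 1"
      unfolding fac[OF refl s2] using k s2 by (simp add: power_less_one_iff)
    have "(\<Prod>z\<in>Z. (norm (0 - z) ^ 2 * (norm (r - z) * norm (- r - z))) ^ k z)
        = (norm (0 - ?s) ^ 2 * (norm (r - ?s) * norm (- r - ?s))) ^ k ?s
          * (\<Prod>z\<in>Z - {?s}. (norm (0 - z) ^ 2 * (norm (r - z) * norm (- r - z))) ^ k z)"
      by (rule prod.remove[OF finZ sZ])
    also have "\<dots> \<le> (norm (0 - ?s) ^ 2 * (norm (r - ?s) * norm (- r - ?s))) ^ k ?s * 1"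
      using le sZ by (intro mult_left_mono prod_le_1) auto
    finally show ?thesis using lt by simp
  qed
  finally have small: "?v < 1" .
  obtain A B :: int where AB: "int_eval f (sqrt 2) = of_int A + of_int B * sqrt 2" "int_eval f (- sqrt 2) = of_int A - of_int B * sqrt 2"
    using int_eval_at_root2 by blast
  have e0: "int_eval f (0::complex) = of_int (coeff f 0)" by (cases f) simp
  have "int_eval f r = of_real (of_int A + of_int B * sqrt 2)" "int_eval f (- r) = of_real (of_int A - of_int B * sqrt 2)"
    using int_eval_of_real[of f "sqrt 2"] int_eval_of_real[of f "- sqrt 2"] AB by (simp_all add: r_def)
  then have "norm (int_eval f r) * norm (int_eval f (- r)) = \<bar>(of_int A + of_int B * sqrt 2) * (of_int A - of_int B * sqrt 2)\<bar>"
    by (simp only: norm_of_real abs_mult)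
  also have "(of_int A + of_int B * sqrt 2) * (of_int A - of_int B * sqrt 2) = real_of_int (A\<^sup>2 - 2 * B\<^sup>2)"
    by (simp add: algebra_simps power2_eq_square)
  finally have e2: "norm (int_eval f r) * norm (int_eval f (- r)) = real_of_int \<bar>A\<^sup>2 - 2 * B\<^sup>2\<bar>" by simp
  \<comment> \<open>Otherwise a square root of 2 would be a conjugate, against the strict bound
    \<open>x\<^sup>2 < 2\<close>.\<close>
  have nz: "A\<^sup>2 - 2 * B\<^sup>2 \<noteq> 0"
  proof
    assume "A\<^sup>2 - 2 * B\<^sup>2 = 0"
    then have "norm (int_eval f r) * norm (int_eval f (- r)) = 0" using e2 by simp
    then have "r \<in> Z \<or> - r \<in> Z" by (auto simp: Z_def)
    then obtain z x where "z = r \<or> z = - r" "z = complex_of_real x" "x\<^sup>2 < 2" using root by blast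
    then have "x = sqrt 2 \<or> x = - sqrt 2" "x\<^sup>2 < 2" unfolding r_def by (metis of_real_eq_iff of_real_minus)+
    then show False by auto
  qed
  have "1 \<le> (coeff f 0)\<^sup>2 * \<bar>A\<^sup>2 - 2 * B\<^sup>2\<bar>"
    using nz f(3) by (smt (verit) mult_pos_pos zero_less_power2 zero_less_abs_iff)
  moreover have "?v = real_of_int ((coeff f 0)\<^sup>2 * \<bar>A\<^sup>2 - 2 * B\<^sup>2\<bar>)"
    unfolding e0 e2 by (simp add: norm_of_int)
  ultimately show False using small by linarith
qed

section \<open>Twice the cosine of a rational multiple of \<open>pi\<close>\<close>

text \<open>The Chebyshev polynomials of the first kind rescaled to \<open>2 T_n(x/2)\<close>: monic
  with integer coefficients for positive \<open>n\<close>, and sending \<open>w + 1 / w\<close> to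
  \<open>w ^ n + (1 / w) ^ n\<close>.\<close>

fun chebyshev :: "nat \<Rightarrow> int poly" where
  "chebyshev 0 = [:2:]"
| "chebyshev (Suc 0) = [:0, 1:]"
| "chebyshev (Suc (Suc n)) = pCons 0 (chebyshev (Suc n)) - chebyshev n"

lemma chebyshev_eval:
  fixes w :: complex
  assumes "w \<noteq> 0"
  shows "int_eval (chebyshev n) (w + 1 / w) = w ^ n + (1 / w) ^ n"
proof (induction n rule: chebyshev.induct)
  case (3 n)
  define v where "v = 1 / w"
  have wv: "w * v = 1" using assms by (simp add: v_def)
  have "int_eval (chebyshev (Suc (Suc n))) (w + v) = (w + v) * (w ^ Suc n + v ^ Suc n) - (w ^ n + v ^ n)"
    using 3 by (simp add: v_def)
  also have "\<dots> = w ^ Suc (Suc n) + v ^ Suc (Suc n) + (w * v) * (w ^ n + v ^ n) - (w ^ n + v ^ n)"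
    by (simp add: algebra_simps)
  finally show ?case using wv by (simp add: v_def)
qed simp_all

lemma chebyshev_coeffs: "(\<forall>i>n. coeff (chebyshev n) i = 0) \<and> (1 \<le> n \<longrightarrow> coeff (chebyshev n) n = 1)"
proof (induction n rule: chebyshev.induct)
  case 1
  show ?case by (auto simp: coeff_pCons split: nat.splits)
next
  case 2
  show ?case by (auto simp: coeff_pCons split: nat.splits)
next
  case (3 n)
  then show ?case by (auto simp: coeff_pCons split: nat.splits)
qed

lemma chebyshev_minus_2_monic:
  assumes "1 \<le> n"
  shows "lead_coeff (chebyshev n - [:2:]) = 1"
proof -
  let ?h = "chebyshev n - [:2:]"
  have n: "coeff ?h n = 1" using chebyshev_coeffs[of n] assms by (cases n) (auto simp: coeff_pCons)
  moreover have "degree ?h \<le> n"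
    by (rule degree_le) (use chebyshev_coeffs[of n] in \<open>auto simp: coeff_pCons split: nat.splits\<close>)
  ultimately have "degree ?h = n" by (metis le_degree le_antisym zero_neq_one)
  then show ?thesis using n by simp
qed

text \<open>Every complex \<open>z\<close> has the form \<open>w + 1 / w\<close>. At a root,
  \<open>w ^ n\<close> and its inverse sum to 2, so \<open>w ^ n = 1\<close>; thus \<open>w\<close>
  lies on the unit circle and \<open>z = w + cnj w\<close>.\<close>

lemma chebyshev_minus_2_roots:
  fixes z :: complex
  assumes "int_eval (chebyshev n - [:2:]) z = 0" "1 \<le> n"
  shows "z \<in> \<real>"
proof -
  define w where "w = (z + csqrt (z\<^sup>2 - 4)) / 2"
  have "2 * w = z + csqrt (z\<^sup>2 - 4)" by (simp add: w_def)
  then have "2 * w - z = csqrt (z\<^sup>2 - 4)" by (simp add: algebra_simps)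
  then have "(2 * w - z)\<^sup>2 = z\<^sup>2 - 4" by simp
  then have wz: "w * (z - w) = 1" by algebra
  then have w0: "w \<noteq> 0" by auto
  then have z: "z = w + 1 / w" using wz by (simp add: field_simps)
  define a where "a = w ^ n"
  have a0: "a \<noteq> 0" using w0 by (simp add: a_def)
  have "a + 1 / a = 2" using assms(1) chebyshev_eval[OF w0, of n] by (simp add: z a_def power_one_over)
  then have "(a - 1)\<^sup>2 = 0" using a0 by (simp add: field_simps power2_eq_square)
  then have "w ^ n = 1" by (simp add: a_def)
  then have "norm w ^ n = 1" by (metis norm_one norm_power)
  then have "norm w = 1" using assms(2) by (metis norm_ge_zero power_eq_1_iff not_one_le_zero real_norm_def abs_norm_cancel)
  then have "w * cnj w = 1" using complex_norm_square[of w] by simp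
  then have "1 / w = cnj w" using w0 by (simp add: field_simps)
  then have "z = w + cnj w" using z by simp
  also have "\<dots> \<in> \<real>" by (simp add: complex_add_cnj)
  finally show ?thesis .
qed

lemma sin_half_bounds:
  assumes "0 < \<alpha>" "\<alpha> < pi / 3"
  shows "0 < 2 * sin (\<alpha> / 2)" "2 * sin (\<alpha> / 2) < 1"
proof -
  show "0 < 2 * sin (\<alpha> / 2)" using assms by (simp add: sin_gt_zero)
  have "sin (\<alpha> / 2) < sin (pi / 6)"
    using assms by (intro sin_monotone_2pi) auto
  then show "2 * sin (\<alpha> / 2) < 1" by (simp add: sin_30)
qed

lemma angle_not_rational:
  fixes p :: "int poly" and a :: int and b N :: nat
  assumes "0 < \<alpha>" "\<alpha> < pi / 3" "real b * \<alpha> = of_int a * pi" "1 \<le> b"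
    and s: "s = 2 * sin (\<alpha> / 2)" and eq: "(int_eval p s)\<^sup>2 * (2 - s\<^sup>2) = real N" "0 < N"
  shows False
proof -
  \<comment> \<open>The factor 4 turns \<open>n\<close> times the angle of \<open>w\<close> into the
    multiple \<open>2 * pi * (b - a)\<close> of a full turn, so that
    \<open>w ^ n = 1\<close>.\<close>
  define n where "n = 4 * b"
  define w where "w = cis (pi / 2 - \<alpha> / 2)"
  have n: "1 \<le> n" using assms(4) by (simp add: n_def)
  have "s = 2 * cos (pi / 2 - \<alpha> / 2)" unfolding s by (simp add: cos_diff)
  then have ws: "w + 1 / w = of_real s"
    by (simp add: w_def complex_eq_iff flip: cis_inverse inverse_eq_divide)
  have ang: "real n * (pi / 2 - \<alpha> / 2) = 2 * pi * of_int (int b - a)"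
    using assms(3) by (simp add: n_def algebra_simps)
  have "w ^ n = cis (real n * (pi / 2 - \<alpha> / 2))"
    unfolding w_def by (rule Complex.DeMoivre)
  also have "\<dots> = cis (2 * pi * of_int (int b - a))"
    by (simp only: ang)
  also have "\<dots> = 1" by (rule cis_multiple_2pi) simp
  finally have wn: "w ^ n = 1" .
  then have "int_eval (chebyshev n - [:2:]) (of_real s :: complex) = 0"
    using chebyshev_eval[of w n] ws by (simp add: w_def power_one_over)
  then have hs: "int_eval (chebyshev n - [:2:]) s = 0"
    by (simp only: int_eval_of_real of_real_eq_0_iff)
  \<comment> \<open>The area equation as a polynomial. At each of its real roots
    \<open>2 - x\<^sup>2\<close> must be positive because \<open>N\<close> is, which bounds all
    conjugates of \<open>s\<close> at once.\<close>
  define g where "g = p * p * [:2, 0, -1:] - [:int N:]"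
  have g: "int_eval g x = (int_eval p x)\<^sup>2 * (2 - x\<^sup>2) - real N" for x :: real
    by (simp add: g_def power2_eq_square algebra_simps)
  show False
  proof (rule no_bounded_conjugates[OF hs chebyshev_minus_2_monic[OF n]])
    have "0 < s" "s < 1" using sin_half_bounds[OF assms(1,2)] by (simp_all add: s)
    moreover from this have "s\<^sup>2 < 1" by (simp add: power_less_one_iff)
    ultimately show "s \<noteq> 0" "s\<^sup>2 \<noteq> 1" by auto
    show "int_eval g s = 0" using g eq by simp
    show "z \<in> \<real>" if "int_eval (chebyshev n - [:2:]) z = 0" for z :: complex
      by (rule chebyshev_minus_2_roots[OF that n])
    show "x\<^sup>2 < 2" if "int_eval g x = 0" for x :: real
    proof -
      have "0 < (int_eval p x)\<^sup>2 * (2 - x\<^sup>2)" using that g eq(2) by simp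
      then show ?thesis by (simp add: zero_less_mult_iff)
    qed
  qed
qed

text \<open>Substituting \<open>2\<beta> = \<pi> - 3\<alpha>\<close> turns the relation into
  \<open>(2x - 3y)\<alpha> = -y\<pi>\<close>. A nonzero left coefficient would make \<alpha> a
  rational multiple of \<pi>.\<close>

lemma angles_independent:
  fixes p :: "int poly" and x y :: int and N :: nat
  assumes "0 < \<alpha>" "0 < \<beta>" "3 * \<alpha> + 2 * \<beta> = pi"
    and s: "s = 2 * sin (\<alpha> / 2)" and eq: "(int_eval p s)\<^sup>2 * (2 - s\<^sup>2) = real N" "0 < N"
    and rel: "of_int x * \<alpha> + of_int y * \<beta> = 0"
  shows "x = 0 \<and> y = 0"
proof -
  have al: "\<alpha> < pi / 3" using assms(2,3) by simp
  have b: "2 * \<beta> = pi - 3 * \<alpha>" using assms(3) by simp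
  have "2 * (of_int x * \<alpha> + of_int y * \<beta>) = 0" using rel by simp
  then have "2 * of_int x * \<alpha> + of_int y * (2 * \<beta>) = 0" by (simp add: algebra_simps)
  then have e: "of_int (2 * x - 3 * y) * \<alpha> = of_int (- y) * pi"
    unfolding b by (simp add: algebra_simps)
  have "2 * x - 3 * y = 0"
  proof (rule ccontr)
    assume nz: "2 * x - 3 * y \<noteq> 0"
    define q where "q = 2 * x - 3 * y"
    have "real (nat \<bar>q\<bar>) * \<alpha> = of_int (sgn q * (- y)) * pi"
      using e by (auto simp: q_def[symmetric] sgn_if abs_if)
    moreover have "1 \<le> nat \<bar>q\<bar>" using nz by (simp add: q_def)
    ultimately show False using angle_not_rational[OF assms(1) al _ _ s eq] by blast
  qed
  moreover from this have "y = 0" using e by simp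
  ultimately show ?thesis by simp
qed

section \<open>Rationality of \<open>s\<close> and the integral solution\<close>

text \<open>The second relation expresses \<open>J * (1 - s\<^sup>2)\<close> linearly in
  \<open>s\<close>, with \<open>J\<close> positive. Inserting this into the first leaves a linear
  equation for \<open>s\<close>. If its coefficient vanishes, then so do \<open>c3\<close> and
  \<open>d3\<close>, and the second relation gives \<open>s\<^sup>2\<close> directly.\<close>

lemma square_rational:
  fixes s :: real and n1 n2 c1 c2 c3 d1 d2 d3 :: nat
  assumes s: "0 < s" "s < 1"
    and r1: "real n1 = real c1 + real c2 * (1 - s\<^sup>2) + real c3 * s" "0 < c2 \<or> 0 < c3"
    and r2: "real n2 * (1 - s\<^sup>2) = real d1 + real d2 * (1 - s\<^sup>2) + real d3 * s" "0 < d1 \<or> 0 < d3"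
  shows "s\<^sup>2 \<in> \<rat>"
proof -
  define J where "J = real n2 - real d2"
  have JQ: "J \<in> \<rat>" by (simp add: J_def)
  have b: "0 < 1 - s\<^sup>2" using s by (simp add: power_less_one_iff)
  have e2: "J * (1 - s\<^sup>2) = real d1 + real d3 * s" using r2(1) by (simp add: J_def algebra_simps)
  also have "\<dots> > 0" using r2(2) s(1) by (auto intro: add_pos_nonneg add_nonneg_pos)
  finally have J: "0 < J" using b by (simp add: zero_less_mult_iff)
  have "real n1 - real c1 = real c2 * (1 - s\<^sup>2) + real c3 * s" using r1(1) by simp
  then have "J * (real n1 - real c1) = J * (real c2 * (1 - s\<^sup>2) + real c3 * s)" by simp
  also have "\<dots> = real c2 * (J * (1 - s\<^sup>2)) + real c3 * J * s" by (simp add: algebra_simps)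
  finally have "J * (real n1 - real c1) = real c2 * (J * (1 - s\<^sup>2)) + real c3 * J * s" .
  then have e: "(real c2 * real d3 + real c3 * J) * s = J * (real n1 - real c1) - real c2 * real d1"
    unfolding e2 by (simp add: algebra_simps)
  show ?thesis
  proof (cases "real c2 * real d3 + real c3 * J = 0")
    case False
    then have "s = (J * (real n1 - real c1) - real c2 * real d1) / (real c2 * real d3 + real c3 * J)"
      using e by (simp add: field_simps)
    then have "s \<in> \<rat>" using JQ by simp
    then show ?thesis by simp
  next
    case True
    have "0 \<le> real c2 * real d3" "0 \<le> real c3 * J" using J by auto
    then have "real c2 * real d3 = 0" "real c3 * J = 0" using True by linarith+
    then have "c3 = 0" "d3 = 0" using J r1(2) by auto
    then have "1 - s\<^sup>2 = real d1 / J" using e2 J by (simp add: field_simps)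
    then have "s\<^sup>2 = 1 - real d1 / J" by simp
    then show ?thesis using JQ by simp
  qed
qed

text \<open>Write \<open>X = A + c3 * s\<close> with \<open>A\<close> rational and positive. If
  \<open>c3\<close> is nonzero, the mixed term of the rational number \<open>X\<^sup>2\<close>
  yields \<open>s\<close>. Otherwise \<open>X\<close> is rational, and the equation for the other
  side is linear in \<open>s\<close> with positive right-hand side \<open>E\<close>.\<close>

lemma root_rational:
  fixes s X :: real and c1 c2 c3 e1 e2 e3 N :: nat
  assumes s: "0 < s" "s < 1" and q: "s\<^sup>2 \<in> \<rat>"
    and X: "X = real c1 + real c2 * (1 - s\<^sup>2) + real c3 * s" "0 < c1 + c2"
    and N: "X\<^sup>2 * (2 - s\<^sup>2) = real N"
    and Y: "X * s * (2 - s\<^sup>2) = real e1 + real e2 * (1 - s\<^sup>2) + real e3 * s" "0 < e1 + e2"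
  shows "s \<in> \<rat>"
proof -
  have b: "0 < 1 - s\<^sup>2" using s by (simp add: power_less_one_iff)
  have pos: "0 < real m + real n * (1 - s\<^sup>2)" if "0 < m + n" for m n :: nat
    using that b by (cases "m = 0") (auto intro: add_pos_nonneg)
  define A where "A = real c1 + real c2 * (1 - s\<^sup>2)"
  define E where "E = real e1 + real e2 * (1 - s\<^sup>2)"
  have A: "0 < A" "A \<in> \<rat>" and E: "0 < E" "E \<in> \<rat>"
    using pos[OF X(2)] pos[OF Y(2)] q by (auto simp: A_def E_def)
  have XA: "X = A + real c3 * s" using X(1) by (simp add: A_def)
  show ?thesis
  proof (cases "c3 = 0")
    case False
    have "X\<^sup>2 = real N / (2 - s\<^sup>2)" using N b by (simp add: field_simps)
    then have "X\<^sup>2 \<in> \<rat>" using q by simp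
    moreover have "s = (X\<^sup>2 - A\<^sup>2 - (real c3)\<^sup>2 * s\<^sup>2) / (2 * A * real c3)"
      using A(1) False unfolding XA by (simp add: field_simps power2_eq_square)
    ultimately show ?thesis using q A(2)
      by (metis Rats_diff Rats_divide Rats_mult Rats_number_of Rats_of_nat Rats_power)
  next
    case True
    have e: "(A * (2 - s\<^sup>2) - real e3) * s = E"
      using Y(1) True unfolding XA E_def by (simp add: algebra_simps)
    then have nz: "A * (2 - s\<^sup>2) - real e3 \<noteq> 0" using E(1) by auto
    then have "s = E / (A * (2 - s\<^sup>2) - real e3)" using e by (simp add: field_simps)
    also have "\<dots> \<in> \<rat>" using A(2) E(2) q by simp
    finally show ?thesis .
  qed
qed

text \<open>With \<open>s = m / k\<close> in lowest terms, \<open>Z = X * k\<^sup>2\<close> is an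
  integer and the area equation reads
  \<open>Z\<^sup>2 * (2 * k\<^sup>2 - m\<^sup>2) = N * k ^ 6\<close>. As \<open>k\<close> is coprime
  to the second factor, \<open>k ^ 3\<close> divides \<open>Z\<close>, so both \<open>X\<close> and
  \<open>X * s\<close> are integers.\<close>

lemma integral_solution:
  fixes s X :: real and c1 c2 c3 N :: nat
  assumes s: "0 < s" "s < 1" "s \<in> \<rat>"
    and X: "X = real c1 + real c2 * (1 - s\<^sup>2) + real c3 * s" "0 < X"
    and N: "X\<^sup>2 * (2 - s\<^sup>2) = real N"
  shows "\<exists>M K :: nat. 0 < M \<and> 0 < K \<and> M\<^sup>2 + N = 2 * K\<^sup>2 \<and> M\<^sup>2 < N \<and> s = real M / real K"
proof -
  obtain m k :: nat where mk: "k \<noteq> 0" "\<bar>s\<bar> = real m / real k" "coprime m k"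
    using Rats_abs_nat_div_natE[OF s(3)] by metis
  have sk: "s * real k = real m" using mk(1,2) s(1) by simp
  have k: "0 < real k" using mk(1) by simp
  define Z where "Z = int c1 * (int k)\<^sup>2 + int c2 * ((int k)\<^sup>2 - (int m)\<^sup>2) + int c3 * int m * int k"
  have s2: "s\<^sup>2 * (real k)\<^sup>2 = (real m)\<^sup>2" using sk by (metis power_mult_distrib)
  have "X * (real k)\<^sup>2 = real c1 * (real k)\<^sup>2 + real c2 * ((real k)\<^sup>2 - s\<^sup>2 * (real k)\<^sup>2) + real c3 * (s * real k) * real k"
    unfolding X(1) by (simp add: algebra_simps power2_eq_square)
  then have Z: "of_int Z = X * (real k)\<^sup>2" unfolding sk s2 by (simp add: Z_def)
  have "of_int (Z\<^sup>2 * (2 * (int k)\<^sup>2 - (int m)\<^sup>2)) = (X\<^sup>2 * (real k) ^ 4) * (2 * (real k)\<^sup>2 - s\<^sup>2 * (real k)\<^sup>2)"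
    unfolding s2 by (simp add: Z power_mult_distrib)
  also have "\<dots> = (X\<^sup>2 * (2 - s\<^sup>2)) * (real k) ^ 6" by (simp add: algebra_simps power_numeral_reduce)
  also have "\<dots> = of_int (int N * (int k) ^ 6)" unfolding N by simp
  finally have eq: "Z\<^sup>2 * (2 * (int k)\<^sup>2 - (int m)\<^sup>2) = int N * (int k) ^ 6"
    by (simp only: of_int_eq_iff)
  have "coprime (int k) ((int m)\<^sup>2)" using mk(3) by (simp add: coprime_commute)
  moreover have "gcd (int k) (2 * (int k)\<^sup>2 - (int m)\<^sup>2) dvd (int m)\<^sup>2"
  proof -
    let ?d = "gcd (int k) (2 * (int k)\<^sup>2 - (int m)\<^sup>2)"
    have "?d dvd 2 * (int k)\<^sup>2" by (simp add: power2_eq_square)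
    moreover have "?d dvd 2 * (int k)\<^sup>2 - (int m)\<^sup>2" by simp
    ultimately have "?d dvd 2 * (int k)\<^sup>2 - (2 * (int k)\<^sup>2 - (int m)\<^sup>2)" by (rule dvd_diff)
    then show ?thesis by simp
  qed
  ultimately have "coprime (int k) (2 * (int k)\<^sup>2 - (int m)\<^sup>2)"
    by (meson coprimeI coprime_common_divisor dvd_trans gcd_greatest)
  then have cop: "coprime ((int k) ^ 6) (2 * (int k)\<^sup>2 - (int m)\<^sup>2)" by simp
  have "(int k) ^ 6 dvd Z\<^sup>2 * (2 * (int k)\<^sup>2 - (int m)\<^sup>2)" unfolding eq by simp
  then have "(int k) ^ 6 dvd Z\<^sup>2" using cop by (simp add: coprime_dvd_mult_left_iff)
  then have "((int k) ^ 3)\<^sup>2 dvd Z\<^sup>2" by (simp flip: power_mult)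
  then have "(int k) ^ 3 dvd Z" by (subst (asm) pow_divides_pow_iff) simp_all
  then obtain z where z: "Z = (int k) ^ 3 * z" by (elim dvdE)
  have "X * (real k)\<^sup>2 = of_int ((int k) ^ 3 * z)" using Z unfolding z by (rule sym)
  also have "\<dots> = real k * of_int z * (real k)\<^sup>2" by (simp add: power_numeral_reduce)
  finally have "X * (real k)\<^sup>2 = real k * of_int z * (real k)\<^sup>2" .
  then have Xz: "X = real k * of_int z" using k by auto
  then have z0: "0 < z" using X(2) k by (simp add: zero_less_mult_iff)
  define K where "K = k * nat z"
  define M where "M = m * nat z"
  have KX: "real K = X" using Xz z0 by (simp add: K_def)
  have MX: "real M = X * s" using Xz z0 sk by (simp add: M_def mult_ac)
  have pos: "0 < real M" "0 < real K" using KX MX X(2) s(1) by auto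
  have "real (M\<^sup>2 + N) = real (2 * K\<^sup>2)"
    using N[symmetric] by (simp add: KX MX algebra_simps power_mult_distrib)
  then have e: "M\<^sup>2 + N = 2 * K\<^sup>2" by (simp only: of_nat_eq_iff)
  have "s\<^sup>2 < 1" using s by (simp add: power_less_one_iff)
  then have "X\<^sup>2 * s\<^sup>2 < X\<^sup>2 * 1" using X(2) by (intro mult_strict_left_mono) auto
  then have "(real M)\<^sup>2 < real N" using N[symmetric] by (simp add: MX power_mult_distrib algebra_simps)
  then have "M\<^sup>2 < N" by (metis of_nat_less_iff of_nat_power)
  moreover have "s = real M / real K" using KX MX X(2) by simp
  ultimately show ?thesis using e pos by auto
qed

section \<open>The prime factors of numbers \<open>2 K\<^sup>2 - M\<^sup>2\<close>\<close>

text \<open>Thue's pigeonhole argument produces \<open>u, v\<close> with \<open>u\<^sup>2 - 2 v\<^sup>2\<close> a nonzero multiple of \<open>p\<close> strictly between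
  \<open>-2 p\<close> and \<open>p\<close>.\<close>
lemma thue_sqrt2:
  fixes p :: nat and x y :: int
  assumes p: "prime p" "p \<noteq> 2" and dvd: "int p dvd x\<^sup>2 - 2 * y\<^sup>2" and y: "\<not> int p dvd y"
  shows "\<exists>n :: int. int p = 8 * n + 1 \<or> int p = 8 * n - 1"
proof -
  have p0: "0 < p" using p(1) by (simp add: prime_gt_0_nat)
  \<comment> \<open>There are \<open>(k + 1)\<^sup>2 > p\<close> pairs with entries from 0 to
    \<open>k\<close>, more than residues modulo \<open>p\<close>.\<close>
  define k where "k = nat \<lfloor>sqrt (real p)\<rfloor>"
  have kr: "real k \<le> sqrt (real p)" "sqrt (real p) < real k + 1" by (simp_all add: k_def)
  have "(real k)\<^sup>2 \<le> (sqrt (real p))\<^sup>2" by (rule power_mono[OF kr(1)]) simp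
  then have k1: "k\<^sup>2 \<le> p" by (simp flip: of_nat_power)
  have "(sqrt (real p))\<^sup>2 < (real k + 1)\<^sup>2" by (rule power_strict_mono[OF kr(2)]) simp_all
  then have "real p < real ((k + 1)\<^sup>2)" by (simp add: add.commute)
  then have k2: "p < (k + 1)\<^sup>2" by (simp only: of_nat_less_iff)
  define A where "A = {0..int k} \<times> {0..int k}"
  define f where "f = (\<lambda>(a, b). (a * y - b * x) mod int p)"
  have "f ` A \<subseteq> {0..<int p}" using p0 by (auto simp: f_def)
  then have "card (f ` A) \<le> p" using card_mono[of "{0..<int p}"] by fastforce
  moreover have "card {0..int k} = k + 1" by (simp add: nat_add_distrib)
  then have "card A = (k + 1)\<^sup>2" unfolding A_def card_cartesian_product by (simp add: power2_eq_square)
  ultimately have "card (f ` A) < card A" using k2 by simp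
  then have "\<not> inj_on f A" using card_image by fastforce
  then obtain a b c d where ab: "(a, b) \<in> A" "(c, d) \<in> A" "(a, b) \<noteq> (c, d)" "f (a, b) = f (c, d)"
    unfolding inj_on_def by fast
  define u where "u = a - c"
  define v where "v = b - d"
  have uv: "\<bar>u\<bar> \<le> int k" "\<bar>v\<bar> \<le> int k" "u \<noteq> 0 \<or> v \<noteq> 0"
    using ab(1-3) by (auto simp: A_def u_def v_def)
  have "int p dvd (a * y - b * x) - (c * y - d * x)"
    using ab(4) by (simp add: f_def mod_eq_dvd_iff)
  then have d1: "int p dvd u * y - v * x" by (simp add: u_def v_def algebra_simps)
  have "int p dvd (u * y - v * x) * (u * y + v * x) + v\<^sup>2 * (x\<^sup>2 - 2 * y\<^sup>2)"
    using d1 dvd by simp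
  also have "(u * y - v * x) * (u * y + v * x) + v\<^sup>2 * (x\<^sup>2 - 2 * y\<^sup>2) = y\<^sup>2 * (u\<^sup>2 - 2 * v\<^sup>2)"
    by (simp add: power2_eq_square algebra_simps)
  finally have "int p dvd u\<^sup>2 - 2 * v\<^sup>2"
    using y p(1) by (metis prime_dvd_mult_iff prime_dvd_power prime_nat_int_transfer)
  then obtain q where q: "u\<^sup>2 - 2 * v\<^sup>2 = int p * q" by (elim dvdE)
  \<comment> \<open>A prime is no square. The resulting strict bound \<open>k\<^sup>2 < p\<close>
    confines \<open>q\<close> to the values -1 and 0.\<close>
  have "int (k\<^sup>2) \<noteq> int p"
  proof
    assume "int (k\<^sup>2) = int p"
    then have "k * k = p" by (simp add: power2_eq_square flip: of_nat_mult)
    then show False using p(1) prime_product by (metis mult_1 nat_neq_iff not_prime_1)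
  qed
  then have kp: "(int k)\<^sup>2 < int p" using k1 by simp
  have sq: "u\<^sup>2 \<le> (int k)\<^sup>2" "v\<^sup>2 \<le> (int k)\<^sup>2"
    using uv by (simp_all add: abs_le_square_iff[symmetric])
  have up: "int p * q < int p * 1" "int p * (- 2) < int p * q"
    using sq kp q by (smt (verit) zero_le_power2)+
  then have "q < 1" "- 2 < q" using p0 by (simp_all only: mult_less_cancel_left_pos of_nat_0_less_iff)
  moreover have "q \<noteq> 0"
  proof
    assume "q = 0"
    then have uv2: "u\<^sup>2 = 2 * v\<^sup>2" using q by simp
    have "v \<noteq> 0" using uv(3) uv2 by auto
    then have "multiplicity 2 (2 * v\<^sup>2) = 1 + 2 * multiplicity 2 v"
      by (subst prime_elem_multiplicity_mult_distrib) (simp_all add: prime_elem_multiplicity_power_distrib)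
    moreover have "multiplicity 2 (u\<^sup>2) = 2 * multiplicity 2 u"
      using \<open>v \<noteq> 0\<close> uv2 by (subst prime_elem_multiplicity_power_distrib) auto
    ultimately have "1 + 2 * multiplicity 2 v = 2 * multiplicity 2 u" using uv2 by simp
    then show False by presburger
  qed
  ultimately have "q = - 1" by linarith
  \<comment> \<open>Since \<open>p\<close> and hence \<open>u\<close> are odd,
    \<open>u\<^sup>2\<close> is 1 modulo 8, while \<open>2 * v\<^sup>2\<close> is 0 or 2 modulo 8
    according to the parity of \<open>v\<close>.\<close>
  then have e: "int p = 2 * v\<^sup>2 - u\<^sup>2" using q by simp
  have "odd (int p)" using p by (metis even_of_nat prime_nat_iff dvd_refl numeral_eq_one_iff semiring_norm(84) prime_ge_2_nat primes_dvd_imp_eq two_is_prime_nat)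
  then have "odd u" using e by simp
  then obtain w where w: "u = 2 * w + 1" by (elim oddE)
  have "even (w * (w + 1))" by simp
  then obtain w' where w': "w * (w + 1) = 2 * w'" by (elim evenE)
  have "u\<^sup>2 = 4 * (w * (w + 1)) + 1" unfolding w by (simp add: power2_eq_square algebra_simps)
  then have u2: "u\<^sup>2 = 8 * w' + 1" unfolding w' by simp
  show ?thesis
  proof (cases "even v")
    case True
    then obtain v' where "v = 2 * v'" by (elim evenE)
    then have "int p = 8 * (v'\<^sup>2 - w') - 1" unfolding e u2 by (simp add: power2_eq_square)
    then show ?thesis by blast
  next
    case False
    then obtain z where z: "v = 2 * z + 1" by (elim oddE)
    have "int p = 8 * (z\<^sup>2 + z - w') + 1" unfolding e u2 z by (simp add: power2_eq_square algebra_simps)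
    then show ?thesis by blast
  qed
qed

text \<open>If \<open>p\<close> does not divide \<open>K\<close>, then 2 is a square modulo
  \<open>p\<close> and \<open>thue_sqrt2\<close> applies. Otherwise \<open>p\<close> divides
  \<open>M\<close> as well; cancelling \<open>p\<^sup>2\<close> keeps the parity of the
  multiplicity, and induction on \<open>N\<close> finishes.\<close>

lemma odd_multiplicity_prime:
  fixes p N :: nat and K M :: int
  assumes "prime p" "0 < N" "int N = 2 * K\<^sup>2 - M\<^sup>2" "odd (multiplicity p N)"
  shows "p = 2 \<or> (\<exists>n :: int. int p = 8 * n + 1 \<or> int p = 8 * n - 1)"
  using assms
proof (induction N arbitrary: K M rule: less_induct)
  case (less N)
  show ?case
  proof (cases "p = 2")
    case False
    have pint: "prime (int p)" using less.prems(1) by simp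
    have "p dvd N" using less.prems(4) by (metis even_zero not_dvd_imp_multiplicity_0)
    then have dN: "int p dvd 2 * K\<^sup>2 - M\<^sup>2" using less.prems(3) by (metis of_nat_dvd_iff)
    show ?thesis
    proof (cases "int p dvd K")
      case False
      have "int p dvd M\<^sup>2 - 2 * K\<^sup>2" using dN by (metis dvd_minus_iff minus_diff_eq)
      then show ?thesis using thue_sqrt2[OF less.prems(1) \<open>p \<noteq> 2\<close> _ False] by blast
    next
      case True
      then have "int p dvd 2 * K\<^sup>2" by (simp add: power2_eq_square)
      then have "int p dvd 2 * K\<^sup>2 - (2 * K\<^sup>2 - M\<^sup>2)" using dN by (rule dvd_diff)
      then have "int p dvd M" using prime_dvd_power[OF pint] by simp
      then obtain M' where M': "M = int p * M'" by (elim dvdE)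
      obtain K' where K': "K = int p * K'" using True by (elim dvdE)
      have "int N = int (p\<^sup>2) * (2 * K'\<^sup>2 - M'\<^sup>2)"
        unfolding less.prems(3) M' K' by (simp add: power_mult_distrib algebra_simps)
      moreover from this have pos: "0 < 2 * K'\<^sup>2 - M'\<^sup>2"
        using less.prems(2) by (metis of_nat_0_less_iff of_nat_0_le_iff zero_less_mult_pos zero_less_mult_iff less_le_not_le)
      ultimately obtain N' where N': "int N' = 2 * K'\<^sup>2 - M'\<^sup>2" "N = p\<^sup>2 * N'"
        by (metis of_nat_eq_iff of_nat_mult zero_less_imp_eq_int)
      have "0 < N'" using N'(1) pos by simp
      have p1: "1 < p" using less.prems(1) by (rule prime_gt_1_nat)
      then have "1 < p\<^sup>2" by (rule one_less_power) simp
      then have "N' < N" unfolding N'(2) using \<open>0 < N'\<close> by simp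
      have "multiplicity p N = multiplicity p (p\<^sup>2) + multiplicity p N'"
        unfolding N'(2) using less.prems(1) \<open>0 < N'\<close> by (intro prime_elem_multiplicity_mult_distrib) auto
      also have "multiplicity p (p\<^sup>2) = 2" using p1 by (intro multiplicity_same_power) auto
      finally have "odd (multiplicity p N')" using less.prems(4) by simp
      then show ?thesis
        using less.IH[OF \<open>N' < N\<close> less.prems(1) \<open>0 < N'\<close> N'(1)] by blast
    qed
  qed simp
qed

lemma square_times_primes:
  fixes N :: nat
  assumes "0 < N"
  shows "\<exists>m. N = m\<^sup>2 * \<Prod>{p \<in> prime_factors N. odd (multiplicity p N)}"
proof -
  let ?m = "\<Prod>p\<in>prime_factors N. p ^ (multiplicity p N div 2)"
  have "N = (\<Prod>p\<in>prime_factors N. p ^ multiplicity p N)"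
    using assms prime_factorization_nat by simp
  also have "\<dots> = (\<Prod>p\<in>prime_factors N. (p ^ (multiplicity p N div 2))\<^sup>2 * p ^ (multiplicity p N mod 2))"
    by (intro prod.cong refl) (simp flip: power_mult power_add)
  also have "\<dots> = ?m\<^sup>2 * (\<Prod>p\<in>prime_factors N. p ^ (multiplicity p N mod 2))"
    by (simp add: prod.distrib prod_power_distrib)
  also have "(\<Prod>p\<in>prime_factors N. p ^ (multiplicity p N mod 2)) = (\<Prod>p\<in>prime_factors N. if odd (multiplicity p N) then p else 1)"
    by (intro prod.cong refl) (auto simp: odd_iff_mod_2_eq_one)
  also have "\<dots> = \<Prod>{p \<in> prime_factors N. odd (multiplicity p N)}"
    by (simp add: prod.inter_filter)
  finally show ?thesis by blast
qed

lemma prime_form: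
  fixes N M K :: nat
  assumes "0 < N" "M\<^sup>2 + N = 2 * K\<^sup>2"
  shows "\<exists>(m :: nat) (S :: nat set). finite S \<and>
    (\<forall>p\<in>S. prime p \<and> (p = 2 \<or> (\<exists>n :: int. int p = 8 * n + 1 \<or> int p = 8 * n - 1))) \<and> N = m\<^sup>2 * \<Prod>S"
proof -
  let ?S = "{p \<in> prime_factors N. odd (multiplicity p N)}"
  obtain m where "N = m\<^sup>2 * \<Prod>?S" using square_times_primes[OF assms(1)] by blast
  moreover have "int M ^ 2 + int N = 2 * int K ^ 2" using assms(2) by (metis of_nat_add of_nat_mult of_nat_numeral of_nat_power)
  then have "int N = 2 * (int K)\<^sup>2 - (int M)\<^sup>2" by simp
  then have "prime p \<and> (p = 2 \<or> (\<exists>n :: int. int p = 8 * n + 1 \<or> int p = 8 * n - 1))" if "p \<in> ?S" for p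
    using odd_multiplicity_prime[OF _ assms(1)] that by (metis (mono_tags, lifting) in_prime_factors_imp_prime mem_Collect_eq)
  ultimately show ?thesis by (intro exI[of _ m] exI[of _ ?S]) auto
qed

section \<open>Congruent triangles and their angles\<close>

text \<open>For \<sigma> equal to -1 the plane is reflected, so that triangles of either orientation
  can be treated as counterclockwise.\<close>

definition to_complex :: "real \<Rightarrow> point \<Rightarrow> complex" where
  "to_complex \<sigma> p = Complex (p $ 1) (\<sigma> * p $ 2)"

lemma to_complex_diff: "to_complex \<sigma> (p - q) = to_complex \<sigma> p - to_complex \<sigma> q"
  by (simp add: to_complex_def complex_eq_iff algebra_simps)

lemma to_complex_cnj_mult: "\<sigma> \<in> {1, -1} \<Longrightarrow> cnj (to_complex \<sigma> p) * to_complex \<sigma> q = Complex (p \<bullet> q) (\<sigma> * cross2 p q)"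
  by (auto simp: to_complex_def complex_eq_iff inner_point cross2_def algebra_simps)

lemma to_complex_norm: "\<sigma> \<in> {1, -1} \<Longrightarrow> cnj (to_complex \<sigma> p) * to_complex \<sigma> p = complex_of_real ((norm p)\<^sup>2)"
  by (subst to_complex_cnj_mult) (auto simp: complex_eq_iff power2_norm_eq_inner)

lemma sin_cos_vertex_angle:
  assumes "0 < \<sigma> * cross2 p q" "\<sigma> \<in> {1, -1}"
  defines "\<theta> \<equiv> arccos (p \<bullet> q / (norm p * norm q))"
  shows "sin \<theta> = \<bar>cross2 p q\<bar> / (norm p * norm q)" "cis \<theta> = cnj (to_complex \<sigma> p) * to_complex \<sigma> q / complex_of_real (norm p * norm q)"
proof -
  have nz: "p \<noteq> 0" "q \<noteq> 0" using assms(1) by auto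
  define m where "m = norm p * norm q"
  have m: "0 < m" using nz by (simp add: m_def)
  have abs: "\<bar>p \<bullet> q\<bar> \<le> m" unfolding m_def by (rule Cauchy_Schwarz_ineq2)
  then have b: "\<bar>p \<bullet> q / m\<bar> \<le> 1" using m by simp
  have "(cross2 p q)\<^sup>2 = m\<^sup>2 - (p \<bullet> q)\<^sup>2" by (simp add: cross2_sq m_def power_mult_distrib)
  then have "(\<bar>cross2 p q\<bar> / m)\<^sup>2 = 1 - (p \<bullet> q / m)\<^sup>2"
    using m by (simp add: power_divide diff_divide_distrib)
  then have "1 - (p \<bullet> q / m)\<^sup>2 = (\<bar>cross2 p q\<bar> / m)\<^sup>2" ..
  then have "sqrt (1 - (p \<bullet> q / m)\<^sup>2) = \<bar>cross2 p q\<bar> / m" using m by simp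
  then show s: "sin \<theta> = \<bar>cross2 p q\<bar> / (norm p * norm q)"
    using b unfolding \<theta>_def m_def[symmetric] by (simp add: sin_arccos_abs)
  have c: "cos \<theta> = p \<bullet> q / m" unfolding \<theta>_def m_def[symmetric] using b by (simp add: cos_arccos_abs)
  have "\<bar>cross2 p q\<bar> = \<sigma> * cross2 p q" using assms(1,2) by auto
  then show "cis \<theta> = cnj (to_complex \<sigma> p) * to_complex \<sigma> q / complex_of_real (norm p * norm q)"
    unfolding to_complex_cnj_mult[OF assms(2)] using s c by (simp add: complex_eq_iff m_def)
qed

text \<open>The sines express twice the area by two sides and their angle. For the angle sum, each
  complex side occurs once with and once without conjugation in the product of the three
  \<open>cis\<close> values, which is therefore -1. The sum is an odd multiple of \<open>pi\<close>
  between 0 and \<open>3 * pi\<close>.\<close>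

lemma tri_angle_sin_cis:
  assumes "nondeg v"
  defines "D \<equiv> cross2 (v 1 - v 0) (v 2 - v 0)"
  shows "sin (tri_angle v 0) = \<bar>D\<bar> / (dist (v 0) (v 1) * dist (v 0) (v 2))"
    "sin (tri_angle v 1) = \<bar>D\<bar> / (dist (v 0) (v 1) * dist (v 1) (v 2))"
    "sin (tri_angle v 2) = \<bar>D\<bar> / (dist (v 0) (v 2) * dist (v 1) (v 2))"
    "tri_angle v 0 + tri_angle v 1 + tri_angle v 2 = pi"
proof -
  define \<sigma> where "\<sigma> = sgn D"
  have D: "D \<noteq> 0" using assms by (simp add: nondeg_def)
  then have sg: "\<sigma> \<in> {1, -1}" "0 < \<sigma> * D" by (auto simp: \<sigma>_def sgn_if)
  have D1: "cross2 (v 2 - v 1) (v 0 - v 1) = D" and D2: "cross2 (v 0 - v 2) (v 1 - v 2) = D"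
    by (simp_all add: D_def cross2_def algebra_simps)
  have ta: "tri_angle v 0 = arccos ((v 1 - v 0) \<bullet> (v 2 - v 0) / (norm (v 1 - v 0) * norm (v 2 - v 0)))"
    "tri_angle v 1 = arccos ((v 2 - v 1) \<bullet> (v 0 - v 1) / (norm (v 2 - v 1) * norm (v 0 - v 1)))"
    "tri_angle v 2 = arccos ((v 0 - v 2) \<bullet> (v 1 - v 2) / (norm (v 0 - v 2) * norm (v 1 - v 2)))"
    by (simp_all add: tri_angle_def vertex_angle_def flip: numeral_2_eq_2)
  note s0 = sin_cos_vertex_angle[of \<sigma> "v 1 - v 0" "v 2 - v 0", folded D_def ta, OF sg(2,1)]
  note s1 = sin_cos_vertex_angle[of \<sigma> "v 2 - v 1" "v 0 - v 1", unfolded D1, folded ta, OF sg(2,1)]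
  note s2 = sin_cos_vertex_angle[of \<sigma> "v 0 - v 2" "v 1 - v 2", unfolded D2, folded ta, OF sg(2,1)]
  show "sin (tri_angle v 0) = \<bar>D\<bar> / (dist (v 0) (v 1) * dist (v 0) (v 2))"
    using s0(1) by (simp add: dist_norm norm_minus_commute)
  show "sin (tri_angle v 1) = \<bar>D\<bar> / (dist (v 0) (v 1) * dist (v 1) (v 2))"
    using s1(1) by (simp add: dist_norm norm_minus_commute mult.commute)
  show "sin (tri_angle v 2) = \<bar>D\<bar> / (dist (v 0) (v 2) * dist (v 1) (v 2))"
    using s2(1) by (simp add: dist_norm norm_minus_commute mult.commute)
  define a b c where "a = to_complex \<sigma> (v 1 - v 0)" and "b = to_complex \<sigma> (v 2 - v 1)" and "c = to_complex \<sigma> (v 0 - v 2)"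
  have neg: "to_complex \<sigma> (v 2 - v 0) = - c" "to_complex \<sigma> (v 0 - v 1) = - a" "to_complex \<sigma> (v 1 - v 2) = - b"
    by (simp_all add: a_def b_def c_def to_complex_diff)
  define na nb nc where "na = norm (v 1 - v 0)" and "nb = norm (v 2 - v 1)" and "nc = norm (v 0 - v 2)"
  have n: "cnj a * a = of_real (na\<^sup>2)" "cnj b * b = of_real (nb\<^sup>2)" "cnj c * c = of_real (nc\<^sup>2)"
    by (simp_all add: a_def b_def c_def na_def nb_def nc_def to_complex_norm[OF sg(1)])
  have "na \<noteq> 0" "nb \<noteq> 0" "nc \<noteq> 0" using D D1 D2 by (auto simp: na_def nb_def nc_def D_def)
  then have pos: "complex_of_real (na * nb * nc) \<noteq> 0" by simp
  have "cis (tri_angle v 0 + tri_angle v 1 + tri_angle v 2)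
      = (cnj a * (- c) / of_real (na * nc)) * (cnj b * (- a) / of_real (nb * na)) * (cnj c * (- b) / of_real (nc * nb))"
    using s0(2) s1(2) s2(2) unfolding neg a_def[symmetric] b_def[symmetric] c_def[symmetric]
    by (simp add: na_def nb_def nc_def norm_minus_commute flip: cis_mult)
  also have "\<dots> = - ((cnj a * a) * (cnj b * b) * (cnj c * c)) / (of_real (na * nb * nc))\<^sup>2"
    by (simp add: field_simps power2_eq_square)
  also have "\<dots> = - 1"
    unfolding n using pos by (simp add: power_mult_distrib)
  finally have "cos (tri_angle v 0 + tri_angle v 1 + tri_angle v 2) = - 1"
    by (simp add: complex_eq_iff)
  then obtain k :: int where k: "tri_angle v 0 + tri_angle v 1 + tri_angle v 2 = (2 * of_int k + 1) * pi"
    using cos_eq_minus1 by (metis add.commute)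
  have "0 < (2 * of_int k + 1) * pi" "(2 * of_int k + 1) * pi < 3 * pi"
    using angle_measure_vertex(2,3)[OF assms(1), of 0] angle_measure_vertex(2,3)[OF assms(1), of 1]
      angle_measure_vertex(2,3)[OF assms(1), of 2] unfolding k[symmetric] by auto
  then have "0 < 2 * real_of_int k + 1" "2 * real_of_int k + 1 < 3" by (simp_all add: zero_less_mult_iff)
  then have "k = 0" by linarith
  then show "tri_angle v 0 + tri_angle v 1 + tri_angle v 2 = pi" using k by simp
qed

section \<open>From tilings as sets of regions to labelled triangles\<close>

lemma measure_tri: "measure lebesgue (tri v) = \<bar>cross2 (v 1 - v 0) (v 2 - v 0)\<bar> / 2"
proof -
  have "compact (tri v)" unfolding tri_def by (intro finite_imp_compact_convex_hull) auto
  then have "measure lebesgue (tri v) = measure lborel (tri v)"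
    by (intro measure_completion) (simp add: borel_compact)
  then show ?thesis
    unfolding tri_def content_triangle cross2_def by (simp add: abs_minus_commute mult.commute)
qed

definition points3 :: "point \<Rightarrow> point \<Rightarrow> point \<Rightarrow> nat \<Rightarrow> point" where
  "points3 A B C = (\<lambda>i. if i = 0 then A else if i = 1 then B else C)"

lemma points3_simps [simp]: "points3 A B C 0 = A" "points3 A B C (Suc 0) = B" "points3 A B C 2 = C"
  by (simp_all add: points3_def)

lemma nondeg_points3:
  assumes "\<not> collinear {A, B, C}"
  shows "nondeg (points3 A B C)"
proof -
  have "cross2 (B - A) (C - A) \<noteq> 0"
  proof
    assume z: "cross2 (B - A) (C - A) = 0"
    have "B \<noteq> A" using assms by auto
    define u where "u = (1 / norm (B - A)) *\<^sub>R (B - A)"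
    have "norm u = 1" using \<open>B \<noteq> A\<close> by (simp add: u_def)
    moreover have "cross2 (C - A) u = 0" using z cross2_commute[of "C - A" "B - A"] by (simp add: u_def)
    ultimately have "C - A = ((C - A) \<bullet> u) *\<^sub>R u" using cross2_parallel by blast
    then have "C - A = (((C - A) \<bullet> u) / norm (B - A)) *\<^sub>R (B - A)" by (simp add: u_def)
    then have "collinear {0, B - A, C - A}" unfolding collinear_lemma by blast
    then have "collinear {B, A, C}" by (simp add: collinear_3)
    then show False using assms by (simp add: insert_commute)
  qed
  then show ?thesis by (simp add: nondeg_def)
qed

lemma tri_points3: "tri (points3 A B C) = triangle_region A B C"
  by (simp add: tri_def triangle_region_def)

lemma tri_angle_points3:
  assumes "triangle_with_angles A B C a b c"
  shows "tri_angle (points3 A B C) 0 = a" "tri_angle (points3 A B C) 1 = b" "tri_angle (points3 A B C) 2 = c"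
  using assms vertex_angle_commute[of A B C]
  by (simp_all add: triangle_with_angles_def tri_angle_def flip: numeral_2_eq_2)

text \<open>An isometry is a translation after an orthogonal map. The latter preserves inner
  products and hence, by \<open>cross2_sq\<close>, determinants up to sign.\<close>

lemma isometry_triangle:
  fixes f :: "point \<Rightarrow> point"
  assumes "\<And>x y. dist (f x) (f y) = dist x y"
  shows "f ` tri v = tri (f \<circ> v)" "vertex_angle (f X) (f Y) (f Z) = vertex_angle X Y Z"
    "nondeg v \<Longrightarrow> nondeg (f \<circ> v)" "measure lebesgue (tri (f \<circ> v)) = measure lebesgue (tri v)"
proof -
  define g where "g x = f x - f 0" for x
  have "orthogonal_transformation g"
    unfolding orthogonal_transformation_isometry using assms by (simp add: g_def dist_norm)
  then have lin: "linear g" and inn: "\<And>x y. g x \<bullet> g y = x \<bullet> y"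
    by (auto simp: orthogonal_transformation_def)
  have f: "f = (\<lambda>x. f 0 + x) \<circ> g" by (auto simp: g_def)
  have "f ` (convex hull S) = convex hull (f ` S)" for S
    by (subst (1 2) f) (simp only: image_comp[symmetric] convex_hull_translation convex_hull_linear_image[OF lin])
  then show "f ` tri v = tri (f \<circ> v)" by (simp add: tri_def)
  have diff: "f x - f y = g (x - y)" for x y using linear_diff[OF lin, of x y] by (simp add: g_def)
  have nrm: "norm (g x) = norm x" for x using inn[of x x] by (simp add: norm_eq_sqrt_inner)
  show "vertex_angle (f X) (f Y) (f Z) = vertex_angle X Y Z"
    by (simp add: vertex_angle_def diff inn nrm)
  have "(cross2 (g p) (g q))\<^sup>2 = (cross2 p q)\<^sup>2" for p q by (simp add: cross2_sq nrm inn)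
  then have cross2: "\<bar>cross2 (g p) (g q)\<bar> = \<bar>cross2 p q\<bar>" for p q by (simp add: power2_eq_iff abs_eq_iff)
  show "measure lebesgue (tri (f \<circ> v)) = measure lebesgue (tri v)"
    unfolding measure_tri by (simp add: diff cross2)
  show "nondeg v \<Longrightarrow> nondeg (f \<circ> v)"
    unfolding nondeg_def using cross2[of "v 1 - v 0" "v 2 - v 0"] by (simp add: diff)
qed

lemma tilingD:
  assumes "tiling N R T \<T>"
  shows "finite \<T>" "card \<T> = N" "\<Union>\<T> = R" "\<forall>S\<in>\<T>. congruent_regions T S"
    "\<forall>S\<in>\<T>. \<forall>S'\<in>\<T>. S \<noteq> S' \<longrightarrow> S \<inter> S' \<subseteq> frontier S \<inter> frontier S'"
proof -
  note c1 = assms[unfolded tiling_def]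
  note c2 = conjunct2[OF c1] note c3 = conjunct2[OF c2] note c4 = conjunct2[OF c3]
  show "finite \<T>" "card \<T> = N" "\<Union>\<T> = R" "\<forall>S\<in>\<T>. congruent_regions T S"
    "\<forall>S\<in>\<T>. \<forall>S'\<in>\<T>. S \<noteq> S' \<longrightarrow> S \<inter> S' \<subseteq> frontier S \<inter> frontier S'"
    by (fact conjunct1[OF c1] conjunct1[OF c2] conjunct1[OF c3] conjunct1[OF c4] conjunct2[OF c4])+
qed

text \<open>Tiles overlap only in frontiers of convex sets, which are negligible, so the areas add
  up.\<close>

lemma tiling_measure:
  assumes "tiling N R T \<T>" and iso: "\<And>S. S \<in> \<T> \<Longrightarrow> measure lebesgue S = m \<and> convex S \<and> compact S"
  shows "measure lebesgue R = real N * m"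
proof -
  note d = tilingD[OF assms(1)]
  have t4: "S \<inter> S' \<subseteq> frontier S" if "S \<in> \<T>" "S' \<in> \<T>" "S \<noteq> S'" for S S'
    using d(5) that by (meson Int_lower1 subset_trans)
  have "measure lebesgue (\<Union>\<T>) = (\<Sum>S\<in>\<T>. measure lebesgue S)"
  proof (rule measure_negligible_finite_Union[OF d(1)])
    show "S \<in> lmeasurable" if "S \<in> \<T>" for S using iso[OF that] lmeasurable_compact by blast
    show "pairwise (\<lambda>S T. negligible (S \<inter> T)) \<T>"
      unfolding pairwise_def
    proof (intro ballI impI)
      fix S S' assume S: "S \<in> \<T>" "S' \<in> \<T>" "S \<noteq> S'"
      have "negligible (frontier S)" using iso[OF S(1)] by (intro negligible_convex_frontier) blast
      then show "negligible (S \<inter> S')" using t4[OF S] by (rule negligible_subset)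
    qed
  qed
  then show ?thesis using d iso by simp
qed

definition edge_len :: "point \<Rightarrow> point \<Rightarrow> point \<Rightarrow> nat \<Rightarrow> real" where
  "edge_len P Q R k = (if k = 1 then dist P Q else if k = 2 then dist P R else dist Q R)"

lemma edge_len_dist:
  assumes "i < 3" "j < 3" "i \<noteq> j"
  shows "dist (points3 P Q R i) (points3 P Q R j) = edge_len P Q R (i + j)"
  using less_3_cases[OF assms(1)] less_3_cases[OF assms(2)] assms(3)
  by (elim disjE) (simp_all add: edge_len_def dist_commute)

lemma triquadratic_setup:
  assumes "3 * \<alpha> + 2 * \<beta> = pi"
    and W: "triangle_with_angles A B C (2 * \<alpha>) \<beta> (\<alpha> + \<beta>)"
    and T: "triangle_with_angles P Q R \<alpha> \<beta> \<gamma>"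
    and N: "N_tiled N (triangle_region A B C) (triangle_region P Q R)"
  shows "\<exists>(\<T> :: point set set) V. triquadratic_tiling \<T> V (points3 A B C) (edge_len P Q R) (tri_angle (points3 P Q R))
      \<and> real N * \<bar>cross2 (Q - P) (R - P)\<bar> = \<bar>cross2 (B - A) (C - A)\<bar> \<and> card \<T> = N"
proof -
  define v where "v = points3 P Q R"
  have nd: "nondeg v" "nondeg (points3 A B C)"
    using W T unfolding triangle_with_angles_def v_def by (simp_all add: nondeg_points3)
  obtain \<T> where til: "tiling N (triangle_region A B C) (triangle_region P Q R) \<T>"
    using N unfolding N_tiled_def by blast
  note d = tilingD[OF til]
  have "\<forall>S\<in>\<T>. \<exists>f. (\<forall>x y. dist (f x) (f y) = dist x y) \<and> S = f ` tri v"
    using d(4) unfolding congruent_regions_def v_def tri_points3 .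
  then obtain F where F: "\<And>S x y. S \<in> \<T> \<Longrightarrow> dist (F S x) (F S y) = dist x y" "\<And>S. S \<in> \<T> \<Longrightarrow> S = F S ` tri v"
    by (metis bchoice)
  \<comment> \<open>The tiles themselves serve as index set. Transporting the vertices by the chosen
    isometry fixes the labels, which the region alone need not determine.\<close>
  define V where "V S = F S \<circ> v" for S
  have triV: "tri (V S) = S" if "S \<in> \<T>" for S
    using isometry_triangle(1)[of "F S" v] F[OF that] by (simp add: V_def)
  have ndV: "nondeg (V S)" if "S \<in> \<T>" for S
    using isometry_triangle(3)[of "F S" v] F(1)[OF that] nd(1) by (simp add: V_def)
  have tile: "tri_tiling \<T> V (points3 A B C) (edge_len P Q R) (tri_angle v)"
  proof
    show "(\<Union>t\<in>\<T>. tri (V t)) = tri (points3 A B C)"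
      using triV d(3) by (simp add: tri_points3)
    show "tri_int (V S) \<inter> tri (V S') = {}" if S: "S \<in> \<T>" "S' \<in> \<T>" "S \<noteq> S'" for S S'
    proof -
      have "S \<inter> S' \<subseteq> frontier S" using d(5) S by (meson Int_lower1 subset_trans)
      moreover have "tri_int (V S) \<subseteq> interior S" using tri_int_subset[OF ndV[OF S(1)]] triV[OF S(1)] by simp
      ultimately show ?thesis using triV[OF S(2)] interior_subset[of S] by (auto simp: frontier_def)
    qed
    show "dist (V S i) (V S j) = edge_len P Q R (i + j)" if "S \<in> \<T>" "i < 3" "j < 3" "i \<noteq> j" for S i j
      using edge_len_dist[OF that(2-4)] F(1)[OF that(1)] by (simp add: V_def v_def)
    show "tri_angle (V S) i = tri_angle v i" if "S \<in> \<T>" "i < 3" for S i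
      using isometry_triangle(2)[of "F S"] F(1)[OF that(1)] by (simp add: tri_angle_def V_def)
  qed (use d nd ndV in auto)
  have a: "tri_angle v 0 = \<alpha>" "tri_angle v 1 = \<beta>" "tri_angle v 2 = \<gamma>"
    unfolding v_def by (rule tri_angle_points3[OF T])+
  have quad: "triquadratic_tiling \<T> V (points3 A B C) (edge_len P Q R) (tri_angle v)"
  proof (intro triquadratic_tiling.intro tile triquadratic_tiling_axioms.intro)
    show "3 * tri_angle v 0 + 2 * tri_angle v 1 = pi" using assms(1) a by simp
    show "tri_angle v 2 = 2 * tri_angle v 0 + tri_angle v 1"
      using tri_angle_sin_cis(4)[OF nd(1)] assms(1) a by simp
  qed (use tri_angle_points3[OF W] a in simp_all)
  have "measure lebesgue (triangle_region A B C) = real N * measure lebesgue (tri v)"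
  proof (rule tiling_measure[OF til])
    fix S assume S: "S \<in> \<T>"
    have "measure lebesgue (tri (F S \<circ> v)) = measure lebesgue (tri v)"
      by (rule isometry_triangle(4)) (rule F(1)[OF S])
    then have "measure lebesgue S = measure lebesgue (tri v)"
      using triV[OF S] by (simp add: V_def)
    moreover have "convex (tri (V S))" "compact (tri (V S))"
      unfolding tri_def by (auto intro!: finite_imp_compact_convex_hull)
    ultimately show "measure lebesgue S = measure lebesgue (tri v) \<and> convex S \<and> compact S"
      using triV[OF S] by simp
  qed
  then have "\<bar>cross2 (B - A) (C - A)\<bar> = real N * \<bar>cross2 (Q - P) (R - P)\<bar>"
    unfolding tri_points3[symmetric] measure_tri by (simp add: v_def)
  then show ?thesis using quad d(2) unfolding v_def by metis
qed

section \<open>Side ratios of tile and triangle, and the conclusion\<close>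

text \<open>In terms of \<open>h = \<alpha>/2\<close> the other angles are
  \<open>\<beta> = \<pi>/2 - 3h\<close> and \<open>\<alpha> + \<beta> = \<pi>/2 - h\<close>, so each
  sine is \<open>cos h\<close> times a polynomial in \<open>s = 2 sin h\<close>.\<close>

lemma trig_identities:
  fixes \<alpha> \<beta> s :: real
  assumes "3 * \<alpha> + 2 * \<beta> = pi" "s = 2 * sin (\<alpha> / 2)"
  defines "c \<equiv> cos (\<alpha> / 2)"
  shows "sin \<alpha> = s * c" "sin \<beta> = (1 - s\<^sup>2) * c" "sin (\<alpha> + \<beta>) = c" "sin (2 * \<alpha>) = s * (2 - s\<^sup>2) * c"
proof -
  define h where "h = \<alpha> / 2"
  have al: "\<alpha> = 2 * h" and be: "\<beta> = pi / 2 - 3 * h" using assms(1) by (simp_all add: h_def)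
  have s: "s = 2 * sin h" and c: "c = cos h" by (simp_all add: assms(2) c_def h_def)
  have sc: "(sin h)\<^sup>2 = 1 - (cos h)\<^sup>2" by (simp add: sin_squared_eq)
  show sa: "sin \<alpha> = s * c" unfolding al s c by (simp add: sin_double)
  show "sin \<beta> = (1 - s\<^sup>2) * c"
  proof -
    have "sin \<beta> = cos (3 * h)" unfolding be by (simp add: sin_diff)
    also have "\<dots> = 4 * cos h ^ 3 - 3 * cos h" by (rule cos_treble_cos)
    also have "\<dots> = (1 - s\<^sup>2) * c" unfolding s c power_mult_distrib sc
      by (simp add: algebra_simps power3_eq_cube power2_eq_square)
    finally show ?thesis .
  qed
  show "sin (\<alpha> + \<beta>) = c"
  proof -
    have "\<alpha> + \<beta> = pi / 2 - h" by (simp add: al be)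
    then show ?thesis by (simp add: sin_diff c)
  qed
  have "sin (2 * \<alpha>) = 2 * sin \<alpha> * cos \<alpha>" by (rule sin_double)
  moreover have "cos \<alpha> = 1 - 2 * (sin h)\<^sup>2" unfolding al by (rule cos_double_sin)
  ultimately show "sin (2 * \<alpha>) = s * (2 - s\<^sup>2) * c"
    unfolding sa s by (simp add: algebra_simps power_mult_distrib)
qed

lemma side_ratios:
  fixes s c a b AB AC BC D E N k :: real
  assumes pos: "0 < s" "s < 1" "0 < k" "0 < a" "0 < b" "0 < c" "0 < AB" "0 < AC" "0 < BC"
    and t: "s * k = D / (c * b)" "(1 - s\<^sup>2) * k = D / (c * a)" "k = D / (b * a)"
    and w: "s * (2 - s\<^sup>2) * k = E / (AB * AC)" "(1 - s\<^sup>2) * k = E / (AB * BC)" "k = E / (AC * BC)"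
    and N: "N * D = E"
  shows "a = s * c" "b = (1 - s\<^sup>2) * c" "BC = s * (2 - s\<^sup>2) * AB" "(AB / c)\<^sup>2 * (2 - s\<^sup>2) = N"
proof -
  have s2: "0 < 1 - s\<^sup>2" using pos by (simp add: power_less_one_iff)
  have D1: "k * (b * a) = D" unfolding t(3) using pos by simp
  have D2: "(s * k) * (c * b) = D" unfolding t(1) using pos by simp
  have D3: "((1 - s\<^sup>2) * k) * (c * a) = D" unfolding t(2) using pos by simp
  have E1: "k * (AC * BC) = E" unfolding w(3) using pos by simp
  have E2: "(s * (2 - s\<^sup>2) * k) * (AB * AC) = E" unfolding w(1) using pos by simp
  have E3: "((1 - s\<^sup>2) * k) * (AB * BC) = E" unfolding w(2) using pos by simp
  have cancel: "y = z" if "x * y = e" "x * z = e" "0 < x" for x y z e :: real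
    using that by auto
  show "a = s * c"
    by (rule cancel[of "k * b" _ D]) (use D1 D2 pos in \<open>simp_all only: mult_ac, simp\<close>)
  show b: "b = (1 - s\<^sup>2) * c"
    by (rule cancel[of "k * a" _ D]) (use D1 D3 pos in \<open>simp_all only: mult_ac, simp\<close>)
  show "BC = s * (2 - s\<^sup>2) * AB"
    by (rule cancel[of "k * AC" _ E]) (use E1 E2 pos in \<open>simp_all only: mult_ac, simp\<close>)
  have AC: "AC = (1 - s\<^sup>2) * AB"
    by (rule cancel[of "k * BC" _ E]) (use E1 E3 pos in \<open>simp_all only: mult_ac, simp\<close>)
  have "(s * k * (1 - s\<^sup>2)) * (N * c\<^sup>2) = N * ((s * k) * (c * b))"
    unfolding b by (simp only: power2_eq_square mult_ac)
  also have "\<dots> = (s * (2 - s\<^sup>2) * k) * (AB * AC)" unfolding D2 E2 by (rule N)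
  also have "\<dots> = (s * k * (1 - s\<^sup>2)) * ((2 - s\<^sup>2) * AB\<^sup>2)"
    unfolding AC by (simp only: power2_eq_square mult_ac)
  finally have "(s * k * (1 - s\<^sup>2)) * (N * c\<^sup>2) = (s * k * (1 - s\<^sup>2)) * ((2 - s\<^sup>2) * AB\<^sup>2)" .
  then have "N * c\<^sup>2 = (2 - s\<^sup>2) * AB\<^sup>2" using pos s2 by simp
  then show "(AB / c)\<^sup>2 * (2 - s\<^sup>2) = N" using pos(6) by (simp add: field_simps)
qed

theorem theorem4:
  fixes A B C P Q R :: "real^2" and \<alpha> \<beta> \<gamma> :: real and N :: nat
  assumes "3 * \<alpha> + 2 * \<beta> = pi"
    and "triangle_with_angles A B C (2 * \<alpha>) \<beta> (\<alpha> + \<beta>)"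
    and "triangle_with_angles P Q R \<alpha> \<beta> \<gamma>"
    and "N_tiled N (triangle_region A B C) (triangle_region P Q R)"
  shows "(\<exists>M K :: nat. M > 0 \<and> K > 0 \<and> M^2 + N = 2 * K^2 \<and> M^2 < N \<and>
            2 * sin (\<alpha> / 2) = real M / real K) \<and>
         (\<exists>(m :: nat) (S :: nat set). finite S \<and>
            (\<forall>p\<in>S. prime p \<and> (p = 2 \<or> (\<exists>n :: int. int p = 8 * n + 1 \<or> int p = 8 * n - 1))) \<and>
            N = m^2 * \<Prod>S)"
proof -
  obtain \<T> :: "point set set" and V where tl:
      "triquadratic_tiling \<T> V (points3 A B C) (edge_len P Q R) (tri_angle (points3 P Q R))
      \<and> real N * \<bar>cross2 (Q - P) (R - P)\<bar> = \<bar>cross2 (B - A) (C - A)\<bar> \<and> card \<T> = N"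
    using triquadratic_setup[OF assms] by (elim exE)
  note til = conjunct1[OF tl] and area = conjunct1[OF conjunct2[OF tl]]
    and cardN = conjunct2[OF conjunct2[OF tl]]
  interpret triquadratic_tiling \<T> V "points3 A B C" "edge_len P Q R" "tri_angle (points3 P Q R)"
    by (rule til)
  have N0: "0 < N" using cardN I_nonempty finite_I by (auto simp: card_gt_0_iff)
  note angT = tri_angle_points3[OF assms(3)] and angW = tri_angle_points3[OF assms(2)]
  have ndT: "nondeg (points3 P Q R)" using assms(3) by (simp add: triangle_with_angles_def nondeg_points3)
  have al: "0 < \<alpha>" "0 < \<beta>" using ang_pos angT by auto
  then have al3: "\<alpha> < pi / 3" using assms(1) by simp
  define s where "s = 2 * sin (\<alpha> / 2)"
  have s: "0 < s" "s < 1" using sin_half_bounds[OF al(1) al3] by (simp_all add: s_def)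
  define k where "k = cos (\<alpha> / 2)"
  have k: "0 < k" unfolding k_def using al(1) al3 by (intro cos_gt_zero) auto
  note trig = trig_identities[OF assms(1) s_def, folded k_def]
  have gam: "\<gamma> = pi - (\<alpha> + \<beta>)" using tri_angle_sin_cis(4)[OF ndT] angT by simp
  define a b c where "a = dist Q R" and "b = dist P R" and "c = dist P Q"
  have el: "edge_len P Q R 1 = c" "edge_len P Q R 2 = b" "edge_len P Q R 3 = a"
    by (simp_all add: edge_len_def a_def b_def c_def)
  have abc: "0 < a" "0 < b" "0 < c"
    using len_type_pos[of 1] len_type_pos[of 2] len_type_pos[of 3] by (simp_all add: el del: One_nat_def)
  have dW: "0 < dist A B" "0 < dist A C" "0 < dist B C"
    using tri_parts_disjoint(4)[OF nondeg_W, of 0 1] tri_parts_disjoint(4)[OF nondeg_W, of 0 2]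
      tri_parts_disjoint(4)[OF nondeg_W, of 1 2] by auto
  have sT: "s * k = \<bar>cross2 (Q - P) (R - P)\<bar> / (c * b)" "(1 - s\<^sup>2) * k = \<bar>cross2 (Q - P) (R - P)\<bar> / (c * a)"
      "k = \<bar>cross2 (Q - P) (R - P)\<bar> / (b * a)"
    using tri_angle_sin_cis(1-3)[OF ndT] angT trig(1-3) gam by (simp_all add: a_def b_def c_def)
  have sW: "s * (2 - s\<^sup>2) * k = \<bar>cross2 (B - A) (C - A)\<bar> / (dist A B * dist A C)"
      "(1 - s\<^sup>2) * k = \<bar>cross2 (B - A) (C - A)\<bar> / (dist A B * dist B C)"
      "k = \<bar>cross2 (B - A) (C - A)\<bar> / (dist A C * dist B C)"
    using tri_angle_sin_cis(1-3)[OF nondeg_W] angW trig(2-4) by simp_all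
  note ratios = side_ratios[OF s k abc dW sT sW area]
  define X where "X = dist A B / c"
  have X0: "0 < X" using dW(1) abc(3) by (simp add: X_def)
  have XN: "X\<^sup>2 * (2 - s\<^sup>2) = real N" using ratios(4) by (simp add: X_def)
  have scale: "y / c = real c1 + real c2 * (1 - s\<^sup>2) + real c3 * s"
    if "y = real c1 * edge_len P Q R 1 + real c2 * edge_len P Q R 2 + real c3 * edge_len P Q R 3" for y and c1 c2 c3 :: nat
    using abc(3) unfolding that el ratios(1,2) by (simp add: field_simps)
  obtain p :: "nat \<Rightarrow> nat" where p: "dist A B = real (p 1) * edge_len P Q R 1 + real (p 2) * edge_len P Q R 2 + real (p 3) * edge_len P Q R 3"
      "0 < p 1 + p 2"
    using side_lengths[of 0 1] by auto
  \<comment> \<open>In units of \<open>c\<close> the side \<open>BC\<close> has length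
    \<open>X * s * (2 - s\<^sup>2)\<close>. This second equation settles the case in which
    \<open>AB\<close> is written without sides opposite \<alpha>.\<close>
  obtain q :: "nat \<Rightarrow> nat" where q: "dist B C = real (q 1) * edge_len P Q R 1 + real (q 2) * edge_len P Q R 2 + real (q 3) * edge_len P Q R 3"
      "0 < q 1 + q 2"
    using side_lengths[of 1 2] by auto
  have X: "X = real (p 1) + real (p 2) * (1 - s\<^sup>2) + real (p 3) * s"
    unfolding X_def by (rule scale[OF p(1)])
  have "dist B C / c = X * s * (2 - s\<^sup>2)" unfolding ratios(3) by (simp add: X_def)
  then have Y: "X * s * (2 - s\<^sup>2) = real (q 1) + real (q 2) * (1 - s\<^sup>2) + real (q 3) * s"
    using scale[OF q(1)] by simp
  \<comment> \<open>\<open>X\<close> is a value of an integer polynomial at \<open>s\<close>, so the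
    area equation passes to all conjugates of \<open>s\<close>.\<close>
  have ev: "int_eval [:int (p 1 + p 2), int (p 3), - int (p 2):] s = X"
    unfolding X by (simp add: algebra_simps power2_eq_square)
  have irr: "x = 0 \<and> y = 0" if "of_int x * tri_angle (points3 P Q R) 0 + of_int y * tri_angle (points3 P Q R) 1 = 0" for x y :: int
    using angles_independent[OF al assms(1) s_def _ N0, of "[:int (p 1 + p 2), int (p 3), - int (p 2):]"] that angT XN
    unfolding ev by auto
  have rel: "\<exists>(n::nat) (c :: nat \<Rightarrow> nat). real n * edge_len P Q R \<tau> = (\<Sum>k\<in>{1,2,3}. real (c k) * edge_len P Q R k)
      \<and> (\<exists>k\<in>{1,2,3}. k \<noteq> \<tau> \<and> c k \<noteq> 0)" if "\<tau> \<in> {1, 2}" for \<tau>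
    using relation_exists[OF irr that] unfolding no_relation_def by blast
  obtain n1 :: nat and f :: "nat \<Rightarrow> nat" where f: "real n1 * edge_len P Q R 1 = (\<Sum>k\<in>{1,2,3}. real (f k) * edge_len P Q R k)"
      "\<exists>k\<in>{1,2,3}. k \<noteq> 1 \<and> f k \<noteq> 0" using rel[of 1] by auto
  obtain n2 :: nat and g :: "nat \<Rightarrow> nat" where g: "real n2 * edge_len P Q R 2 = (\<Sum>k\<in>{1,2,3}. real (g k) * edge_len P Q R k)"
      "\<exists>k\<in>{1,2,3}. k \<noteq> 2 \<and> g k \<noteq> 0" using rel[of 2] by auto
  have r1: "real n1 = real (f 1) + real (f 2) * (1 - s\<^sup>2) + real (f 3) * s"
  proof -
    have "real n1 * edge_len P Q R 1 = real (f 1) * edge_len P Q R 1 + real (f 2) * edge_len P Q R 2 + real (f 3) * edge_len P Q R 3"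
      using f(1) by (simp add: add.assoc)
    from scale[OF this] show ?thesis unfolding el(1) using abc(3) by simp
  qed
  have r2: "real n2 * (1 - s\<^sup>2) = real (g 1) + real (g 2) * (1 - s\<^sup>2) + real (g 3) * s"
  proof -
    have "real n2 * edge_len P Q R 2 = real (g 1) * edge_len P Q R 1 + real (g 2) * edge_len P Q R 2 + real (g 3) * edge_len P Q R 3"
      using g(1) by (simp add: add.assoc)
    from scale[OF this] show ?thesis unfolding el(2) ratios(2) using abc(3) by simp
  qed
  have "s\<^sup>2 \<in> \<rat>"
    by (rule square_rational[OF s r1 _ r2]) (use f(2) g(2) in auto)
  then have "s \<in> \<rat>" by (rule root_rational[OF s _ X p(2) XN Y q(2)])
  from integral_solution[OF s this X X0 XN] obtain M K :: nat
    where MK: "0 < M" "0 < K" "M\<^sup>2 + N = 2 * K\<^sup>2" "M\<^sup>2 < N" "s = real M / real K" by blast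
  show ?thesis
    using MK prime_form[OF N0 MK(3)] unfolding s_def by blast
qed

end
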